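(* Let $n\ge 2$. For every $\epsilon>0$ there exists a constant $C_\epsilon>0$, depending only on $n$ and $\epsilon$, such that for every finite set $\Omega\subset\mathbb R^n$ of cardinality $N\ge 1$ and every $f\in L^2(\mathbb R^{n+1})$, $$\|H_\Omega f\|_{L^2(\mathbb R^{n+1})}\le C_\epsilon\, N^{\frac{n-1}{2n}+\epsilon}\,\|f\|_{L^2(\mathbb R^{n+1})}.$$
   Context: For $v\in\mathbb R^n$ write $\langle v,1\rangle=(v_1,\dots,v_n,1)\in\mathbb R^{n+1}$. The directional Hilbert transform $H_v$ on $\mathbb R^{n+1}$ is $H_vf(x)=\mathrm{p.v.}\,\frac1\pi\int_{\mathbb R}f(x-t\langle v,1\rangle)\frac{dt}{t}$; it is bounded on $L^2(\mathbb R^{n+1})$ (it is the Fourier multiplier operator with symbol $-i\,\mathrm{sgn}(\xi\cdot\langle v,1\rangle)$). For a finite set $\Omega\subset\mathbb R^n$ the maximal directional Hilbert transform is $H_\Omega f(x)=\sup_{v\in\Omega}|H_vf(x)|$, $x\in\mathbb R^{n+1}$. *)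

theory Defs
  imports "HOL-Analysis.Analysis"
begin

text \<open>Throughout, \<^typ>\<open>(real ^ 'n) \<times> real\<close> is \<open>(n + 1)\<close>-dimensional Euclidean space with
  \<open>n = CARD('n)\<close>; its last coordinate is the second component, so \<open>\<langle>v,1\<rangle>\<close> is the pair
  \<open>(v, 1)\<close>. Elements of the \<open>L2\<close> space are represented by functions, not by classes modulo
  null sets.\<close>

definition L2 :: "('a::euclidean_space \<Rightarrow> 'b::real_normed_vector) set" where
  "L2 = {f \<in> borel_measurable lebesgue. integrable lebesgue (\<lambda>x. (norm (f x))\<^sup>2)}"

definition L2_norm :: "('a::euclidean_space \<Rightarrow> 'b::real_normed_vector) \<Rightarrow> real" where
  "L2_norm f = sqrt (LINT x|lebesgue. (norm (f x))\<^sup>2)"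

text \<open>For \<open>f\<close> in \<open>L2\<close> the restriction of \<open>f\<close> to almost every line in direction \<open>(v, 1)\<close> is square
  integrable, so for almost every \<open>x\<close> the truncated integrals converge absolutely and have a limit.
  On the remaining null set the value of the principal value below is unspecified.\<close>

definition truncated_dir_hilbert ::
    "real \<Rightarrow> real ^ 'n \<Rightarrow> ((real ^ 'n) \<times> real \<Rightarrow> complex) \<Rightarrow> (real ^ 'n) \<times> real \<Rightarrow> complex" where
  "truncated_dir_hilbert \<delta> v f x =
     (1 / of_real pi) *
     (LINT t:{t. \<delta> < \<bar>t\<bar>}|lebesgue. f (x - t *\<^sub>R (v, 1)) / of_real t)"

definition dir_hilbert ::
    "real ^ 'n \<Rightarrow> ((real ^ 'n) \<times> real \<Rightarrow> complex) \<Rightarrow> (real ^ 'n) \<times> real \<Rightarrow> complex" where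
  "dir_hilbert v f x = Lim (at_right 0) (\<lambda>\<delta>. truncated_dir_hilbert \<delta> v f x)"

definition max_dir_hilbert ::
    "(real ^ 'n) set \<Rightarrow> ((real ^ 'n) \<times> real \<Rightarrow> complex) \<Rightarrow> (real ^ 'n) \<times> real \<Rightarrow> real" where
  "max_dir_hilbert \<Omega> f x = (SUP v\<in>\<Omega>. cmod (dir_hilbert v f x))"

end

theory Submission
  imports Defs "HOL-Probability.Probability" "HOL-Real_Asymp.Real_Asymp"
begin

text \<open>The symbol of \<open>H_v\<close> is \<open>- \<i> sgn (\<xi> \<bullet> (v, 1))\<close>. Hence, with \<open>M\<close> the measure of density
  \<open>\<bar>F\<bar>\<^sup>2\<close> for the normalised Fourier transform \<open>F\<close> of \<open>f\<close>, the squared distance of \<open>H_v f\<close> and \<open>H_w f\<close>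
  is at most \<open>4 M (sep v w)\<close>, where \<open>sep v w\<close> is the set of frequencies at which \<open>v\<close> and \<open>w\<close> get
  different signs. Among \<open>N\<close> points some two satisfy \<open>M (sep v w) \<le> \<delta> M UNIV\<close> with
  \<open>\<delta> = O (N powr (- 1 / n) * ln N)\<close>: if not, about \<open>ln N / \<delta>\<close> random frequencies give all \<open>N\<close> points
  different sign patterns, whereas \<open>m\<close> hyperplanes cut \<open>n\<close>-space into at most \<open>(m + 1) ^ n\<close> cells.
  So a maximal \<open>\<delta>\<close>-separated subset of \<open>\<Omega>\<close>, for \<open>N / 2\<close> in place of \<open>N\<close>, has at most \<open>N / 2\<close> points
  and is \<open>\<delta>\<close>-close to all of \<open>\<Omega>\<close>. Passing from \<open>\<Omega>\<close> to this subset costs at most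
  \<open>(N * 4 * \<delta> * M UNIV) powr (1 / 2)\<close> in the maximal function, and the costs of the iterated halvings
  form a geometric series, up to logarithms absorbed by \<open>\<epsilon>\<close>.

  The principal value exists almost everywhere by one-dimensional theory on almost every line: the
  Cauchy transform of a square-integrable function is the Poisson extension of its boundary value,
  and the truncated Hilbert transform differs from the Cauchy transform at height \<open>\<delta>\<close> by an integral
  against a dilated integrable kernel, which converges at every Lebesgue point.\<close>

text \<open>The net is chosen after \<open>f\<close>: distances between directions are masses of the
  spectral measure of \<open>f\<close>, and the cell count bounds the size of a separated set in the
  same way for every measure. The exponent can be read off from one halving: N points moved at
  squared cost of order \<open>N powr (- 1 / n)\<close> each give \<open>N powr (1 - 1 / n)\<close>,
  and the square root has exponent \<open>(n - 1) / (2 * n)\<close>. The obstacle is the link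
  between the multiplier and the pointwise principal value. The kernel \<open>1 / t\<close> is
  integrable neither at 0 nor at infinity, so Fourier integrals are formed only for integrable
  functions and for kernels cut off at both ends. Fatou's lemma then carries the energy bounds to
  the limit, provided that the limit exists almost everywhere; this is why pointwise existence is
  settled separately. A general \<open>f\<close> is cut to balls, and a crude \<open>L2\<close>
  bound for each single direction removes the cut with \<Omega> fixed.\<close>

abbreviation L2_energy :: "'a measure \<Rightarrow> ('a \<Rightarrow> 'b::real_normed_vector) \<Rightarrow> ennreal" where
  "L2_energy M f \<equiv> (\<integral>\<^sup>+x. ennreal ((norm (f x))\<^sup>2) \<partial>M)"

section \<open>Integral operators and square-integrable functions\<close>

lemma borel_measurable_cnj_comp[measurable (raw)]:
  "f \<in> borel_measurable M \<Longrightarrow> (\<lambda>x. cnj (f x)) \<in> borel_measurable M"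
  by (rule borel_measurable_continuous_on[OF linear_continuous_on[OF bounded_linear_cnj]])

lemma ennreal_le_suminf: "f k \<le> (\<Sum>k. f k :: ennreal)"
  using sum_le_suminf[OF summableI, of "{k}" f] by simp

section \<open>Translations, reflections and Cauchy-Schwarz\<close>

lemma nn_integral_lborel_translate:
  fixes a :: "'a::euclidean_space"
  assumes [measurable]: "f \<in> borel_measurable borel"
  shows "(\<integral>\<^sup>+x. f (x + a) \<partial>lborel) = (\<integral>\<^sup>+x. f x \<partial>lborel)"
proof -
  have "(\<integral>\<^sup>+x. f x \<partial>lborel) = (\<integral>\<^sup>+x. f x \<partial>distr lborel borel ((+) a))"
    by (simp add: lborel_distr_plus)
  also have "\<dots> = (\<integral>\<^sup>+x. f (x + a) \<partial>lborel)"
    by (subst nn_integral_distr) (auto simp: add.commute)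
  finally show ?thesis ..
qed

lemma lborel_translate:
  fixes a :: "'a::euclidean_space" and f :: "'a \<Rightarrow> 'b::{banach, second_countable_topology}"
  assumes [measurable]: "f \<in> borel_measurable borel"
  shows lborel_integrable_translate: "integrable lborel (\<lambda>x. f (x + a)) \<longleftrightarrow> integrable lborel f"
    and lborel_integral_translate: "(\<integral>x. f (x + a) \<partial>lborel) = (\<integral>x. f x \<partial>lborel)"
proof -
  have "integrable lborel f = integrable (distr lborel borel ((+) a)) f"
    by (simp add: lborel_distr_plus)
  also have "\<dots> = integrable lborel (\<lambda>x. f (x + a))"
    by (subst integrable_distr_eq) (auto simp: add.commute)
  finally show "integrable lborel (\<lambda>x. f (x + a)) \<longleftrightarrow> integrable lborel f" ..
  have "(\<integral>x. f x \<partial>lborel) = (\<integral>x. f x \<partial>distr lborel borel ((+) a))"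
    by (simp add: lborel_distr_plus)
  also have "\<dots> = (\<integral>x. f (x + a) \<partial>lborel)"
    by (subst integral_distr) (auto simp: add.commute)
  finally show "(\<integral>x. f (x + a) \<partial>lborel) = (\<integral>x. f x \<partial>lborel)" ..
qed

lemma nn_integral_real_reflect:
  assumes [measurable]: "f \<in> borel_measurable borel"
  shows "(\<integral>\<^sup>+y. f (x - y) \<partial>lborel) = (\<integral>\<^sup>+y. f (y :: real) \<partial>lborel)"
  using nn_integral_real_affine[of f "-1" x] by simp

lemma integral_real_reflect:
  fixes f :: "real \<Rightarrow> 'b::{banach, second_countable_topology}"
  shows "(\<integral>y. f (x - y) \<partial>lborel) = (\<integral>y. f y \<partial>lborel)"
  using lborel_integral_real_affine[of "-1" f x] by simp

lemma integrable_real_reflect: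
  fixes f :: "real \<Rightarrow> 'b::{banach, second_countable_topology}"
  shows "integrable lborel (\<lambda>y. f (x - y)) \<longleftrightarrow> integrable lborel f"
  using lborel_integrable_real_affine_iff[of "-1" f x] by simp

text \<open>Energies in \<open>ennreal\<close>, bounded by squares of reals, are meaningful before
  any integrability is known; the same hypotheses thus give both the existence of the product
  integral and its bound.\<close>

lemma cauchy_schwarz_integral:
  fixes f g :: "'a \<Rightarrow> complex"
  assumes [measurable]: "f \<in> borel_measurable M" "g \<in> borel_measurable M"
    and f: "L2_energy M f \<le> ennreal (a\<^sup>2)"
    and g: "L2_energy M g \<le> ennreal (b\<^sup>2)"
    and ab: "0 \<le> a" "0 \<le> b"
  shows "integrable M (\<lambda>x. f x * g x)" "norm (\<integral>x. f x * g x \<partial>M) \<le> a * b"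
proof -
  have "(\<integral>\<^sup>+x. ennreal (norm (f x)) * ennreal (norm (g x)) \<partial>M)\<^sup>2
      \<le> (\<integral>\<^sup>+x. (ennreal (norm (f x)))\<^sup>2 \<partial>M) * (\<integral>\<^sup>+x. (ennreal (norm (g x)))\<^sup>2 \<partial>M)"
    by (rule Cauchy_Schwarz_nn_integral) auto
  also have "\<dots> \<le> ennreal (a\<^sup>2) * ennreal (b\<^sup>2)"
    using f g by (intro mult_mono) (auto simp: ennreal_power)
  also have "\<dots> = (ennreal (a * b))\<^sup>2"
    using ab by (simp add: ennreal_mult[symmetric] ennreal_power power_mult_distrib)
  finally have "(\<integral>\<^sup>+x. ennreal (norm (f x)) * ennreal (norm (g x)) \<partial>M) \<le> ennreal (a * b)"
    using ab
    by (cases "\<integral>\<^sup>+x. ennreal (norm (f x)) * ennreal (norm (g x)) \<partial>M")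
       (auto simp: ennreal_power top_unique power2_le_iff_abs_le ennreal_le_iff)
  then have le: "(\<integral>\<^sup>+x. ennreal (norm (f x * g x)) \<partial>M) \<le> ennreal (a * b)"
    by (simp add: norm_mult ennreal_mult)
  then show int: "integrable M (\<lambda>x. f x * g x)"
    by (auto simp: integrable_iff_bounded less_top[symmetric] top_unique)
  have "ennreal (norm (\<integral>x. f x * g x \<partial>M)) \<le> (\<integral>\<^sup>+x. ennreal (norm (f x * g x)) \<partial>M)"
    by (rule integral_norm_bound_ennreal[OF int])
  with le have "ennreal (norm (\<integral>x. f x * g x \<partial>M)) \<le> ennreal (a * b)" by (rule order.trans[rotated])
  then show "norm (\<integral>x. f x * g x \<partial>M) \<le> a * b"
    using ab by (simp add: ennreal_le_iff)
qed

lemma integrable_mult_bounded: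
  fixes u g :: "'a \<Rightarrow> complex"
  assumes "integrable M u" and [measurable]: "g \<in> borel_measurable M" and "\<And>x. norm (g x) \<le> B"
  shows "integrable M (\<lambda>x. u x * g x)"
proof (rule Bochner_Integration.integrable_bound[OF integrable_mult_right[OF integrable_norm[OF assms(1)], of B]])
  have [measurable]: "u \<in> borel_measurable M" using assms(1) by (rule borel_measurable_integrable)
  show "(\<lambda>x. u x * g x) \<in> borel_measurable M" by measurable
  have "norm (u x * g x) \<le> B * norm (u x)" for x
    using mult_left_mono[OF assms(3), of "norm (u x)"] by (simp add: norm_mult mult.commute)
  then show "AE x in M. norm (u x * g x) \<le> norm (B * norm (u x))"
    by (intro AE_I2) (use abs_ge_self order.trans in fastforce)
qed

lemma integrable_lborel_product:
  fixes u :: "'a::euclidean_space \<Rightarrow> complex" and v :: "'b::euclidean_space \<Rightarrow> complex"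
  assumes [measurable]: "integrable lborel u" "integrable lborel v"
  shows "integrable (lborel \<Otimes>\<^sub>M lborel) (\<lambda>(a, b). u a * v b)"
proof (rule lborel_pair.Fubini_integrable)
  have [measurable]: "u \<in> borel_measurable borel" "v \<in> borel_measurable borel"
    using assms by (auto dest: borel_measurable_integrable)
  show "(\<lambda>(a, b). u a * v b) \<in> borel_measurable (lborel \<Otimes>\<^sub>M lborel)" by measurable
  show "integrable lborel (\<lambda>x. LINT y|lborel. norm (case (x, y) of (a, b) \<Rightarrow> u a * v b))"
    using assms by (simp add: norm_mult)
  show "AE x in lborel. integrable lborel (\<lambda>y. case (x, y) of (a, b) \<Rightarrow> u a * v b)"
    using assms by simp
qed

text \<open>Fubini for the square of an integral operator, which turns the inner product of two outputs
  into a quadratic form in the input.\<close>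

lemma integral_kernel_sesquilinear:
  fixes u :: "'a::euclidean_space \<Rightarrow> complex"
    and k l :: "'a \<Rightarrow> 'b::euclidean_space \<Rightarrow> complex"
  assumes u: "integrable lborel u"
    and k[measurable]: "(\<lambda>(a, x). k a x) \<in> borel_measurable (borel \<Otimes>\<^sub>M borel)"
    and l[measurable]: "(\<lambda>(a, x). l a x) \<in> borel_measurable (borel \<Otimes>\<^sub>M borel)"
    and kb: "\<And>a x. norm (k a x) \<le> B" and lb: "\<And>a x. norm (l a x) \<le> B"
    and int: "\<And>a b. integrable lborel (\<lambda>x. k a x * cnj (l b x))"
    and bound: "\<And>a b. (\<integral>x. norm (k a x * cnj (l b x)) \<partial>lborel) \<le> D"
  shows "integrable lborel (\<lambda>x. (\<integral>a. u a * k a x \<partial>lborel) * cnj (\<integral>a. u a * l a x \<partial>lborel))"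
    "(\<integral>x. (\<integral>a. u a * k a x \<partial>lborel) * cnj (\<integral>a. u a * l a x \<partial>lborel) \<partial>lborel)
      = (\<integral>p. u (fst p) * cnj (u (snd p)) * (\<integral>x. k (fst p) x * cnj (l (snd p) x) \<partial>lborel) \<partial>lborel)"
    "integrable lborel (\<lambda>p. u (fst p) * cnj (u (snd p)) * (\<integral>x. k (fst p) x * cnj (l (snd p) x) \<partial>lborel))"
proof -
  have [measurable]: "u \<in> borel_measurable borel" using u by (auto dest: borel_measurable_integrable)
  have kx[measurable]: "(\<lambda>a. k a x) \<in> borel_measurable borel" for x
    using measurable_compose[OF _ k, of "\<lambda>a. (a, x)"] by simp
  have lx[measurable]: "(\<lambda>a. l a x) \<in> borel_measurable borel" for x
    using measurable_compose[OF _ l, of "\<lambda>a. (a, x)"] by simp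
  define F where "F p x = (u (fst p) * k (fst p) x) * cnj (u (snd p) * l (snd p) x)" for p x
  have F_eq: "F p x = u (fst p) * cnj (u (snd p)) * (k (fst p) x * cnj (l (snd p) x))" for p x
    by (simp add: F_def mult_ac)
  have uu: "integrable (lborel \<Otimes>\<^sub>M lborel) (\<lambda>p. u (fst p) * cnj (u (snd p)))"
    using integrable_lborel_product[OF u, of "\<lambda>b. cnj (u b)"] u
    by (simp add: case_prod_beta')
  then have uu': "integrable lborel (\<lambda>p. u (fst p) * cnj (u (snd p)))" by (simp only: lborel_prod)
  have D0: "0 \<le> D" using bound[of undefined undefined] by (rule order.trans[rotated]) simp
  have meas[measurable]: "(\<lambda>(p, x). F p x) \<in> borel_measurable (lborel \<Otimes>\<^sub>M lborel)"
  proof -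
    have "(\<lambda>q. k (fst (fst q)) (snd q)) \<in> borel_measurable ((borel \<Otimes>\<^sub>M borel) \<Otimes>\<^sub>M borel)"
      using measurable_compose[OF _ k, of "\<lambda>q. (fst (fst q), snd q)" "(borel \<Otimes>\<^sub>M borel) \<Otimes>\<^sub>M borel"] by simp
    moreover have "(\<lambda>q. l (snd (fst q)) (snd q)) \<in> borel_measurable ((borel \<Otimes>\<^sub>M borel) \<Otimes>\<^sub>M borel)"
      using measurable_compose[OF _ l, of "\<lambda>q. (snd (fst q), snd q)" "(borel \<Otimes>\<^sub>M borel) \<Otimes>\<^sub>M borel"] by simp
    ultimately have "(\<lambda>(p, x). F p x) \<in> borel_measurable ((borel \<Otimes>\<^sub>M borel) \<Otimes>\<^sub>M borel)"
      unfolding F_def case_prod_beta by measurable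
    then show ?thesis by (simp only: borel_prod lborel_prod) simp
  qed
  have Fp: "integrable lborel (F p)" for p
    unfolding F_eq using int by simp
  \<comment> \<open>Absolute integrability in all three variables: for fixed \<open>p\<close> the
    integral of the norm over \<open>x\<close> is at most \<open>D\<close> times
    \<open>norm (u (fst p) * cnj (u (snd p)))\<close>, which is integrable over pairs.\<close>
  have intF: "integrable (lborel \<Otimes>\<^sub>M lborel) (\<lambda>(p, x). F p x)"
  proof (rule lborel_pair.Fubini_integrable[OF meas])
    show "integrable lborel (\<lambda>p. LINT x|lborel. norm (case (p, x) of (p, x) \<Rightarrow> F p x))"
    proof (rule Bochner_Integration.integrable_bound[OF integrable_mult_right[OF integrable_norm[OF uu'], of D]])
      show "(\<lambda>p. LINT x|lborel. norm (case (p, x) of (p, x) \<Rightarrow> F p x)) \<in> borel_measurable lborel"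
        using meas by measurable
      show "AE p in lborel. norm (LINT x|lborel. norm (case (p, x) of (p, x) \<Rightarrow> F p x))
          \<le> norm (D * norm (u (fst p) * cnj (u (snd p))))"
      proof (rule AE_I2)
        fix p :: "'a \<times> 'a"
        have "(LINT x|lborel. norm (F p x)) = norm (u (fst p) * cnj (u (snd p))) *
            (LINT x|lborel. norm (k (fst p) x * cnj (l (snd p) x)))"
          unfolding F_eq norm_mult[of "_ * cnj (u _)"] by simp
        also have "\<dots> \<le> norm (u (fst p) * cnj (u (snd p))) * D"
          by (intro mult_left_mono bound) auto
        finally show "norm (LINT x|lborel. norm (case (p, x) of (p, x) \<Rightarrow> F p x))
          \<le> norm (D * norm (u (fst p) * cnj (u (snd p))))"
          using D0 by (simp add: mult.commute)
      qed
    qed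
    show "AE p in lborel. integrable lborel (\<lambda>x. case (p, x) of (p, x) \<Rightarrow> F p x)"
      using Fp by simp
  qed
  \<comment> \<open>For fixed \<open>x\<close> the integrand is a function of \<open>a\<close> times
    a function of \<open>b\<close>. The bound \<open>B\<close> on the kernels makes both integrable,
    so the integral over pairs factorises.\<close>
  have inner: "(\<integral>p. F p x \<partial>lborel) = (\<integral>a. u a * k a x \<partial>lborel) * cnj (\<integral>a. u a * l a x \<partial>lborel)" for x
  proof -
    have ik: "integrable lborel (\<lambda>a. u a * k a x)"
      by (rule integrable_mult_bounded[OF u _ kb]) measurable
    have il: "integrable lborel (\<lambda>a. u a * l a x)"
      by (rule integrable_mult_bounded[OF u _ lb]) measurable
    have "integrable (lborel \<Otimes>\<^sub>M lborel) (\<lambda>(a, b). (u a * k a x) * cnj (u b * l b x))"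
      by (rule integrable_lborel_product[OF ik]) (use il in \<open>simp only: complex_integrable_cnj\<close>)
    from lborel_pair.integral_fst'[OF this]
    have "(\<integral>p. F p x \<partial>(lborel \<Otimes>\<^sub>M lborel)) = (\<integral>a. (\<integral>b. (u a * k a x) * cnj (u b * l b x) \<partial>lborel) \<partial>lborel)"
      by (simp add: F_def case_prod_beta')
    also have "\<dots> = (\<integral>a. (u a * k a x) * cnj (\<integral>b. u b * l b x \<partial>lborel) \<partial>lborel)"
      by (simp only: integral_mult_right_zero Bochner_Integration.integral_cnj)
    finally show ?thesis by (simp only: integral_mult_left_zero lborel_prod)
  qed
  show "integrable lborel (\<lambda>x. (\<integral>a. u a * k a x \<partial>lborel) * cnj (\<integral>a. u a * l a x \<partial>lborel))"
    using lborel_pair.integrable_snd[OF intF] by (simp add: inner)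
  show "integrable lborel (\<lambda>p. u (fst p) * cnj (u (snd p)) * (\<integral>x. k (fst p) x * cnj (l (snd p) x) \<partial>lborel))"
    using lborel_pair.integrable_fst[OF intF] by (simp add: F_eq)
  show "(\<integral>x. (\<integral>a. u a * k a x \<partial>lborel) * cnj (\<integral>a. u a * l a x \<partial>lborel) \<partial>lborel)
      = (\<integral>p. u (fst p) * cnj (u (snd p)) * (\<integral>x. k (fst p) x * cnj (l (snd p) x) \<partial>lborel) \<partial>lborel)"
    using lborel_pair.Fubini_integral[OF intF] by (simp add: inner) (simp add: F_eq)
qed

text \<open>The square-integrable differences are weighted by \<open>4 ^ k\<close>, so that finiteness of the weighted
  sum at a point bounds the \<open>k\<close>-th difference there by a geometric sequence.\<close>

lemma L2_Cauchy_imp_convergent: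
  fixes F :: "nat \<Rightarrow> 'a \<Rightarrow> complex"
  assumes F[measurable]: "\<And>n. F n \<in> borel_measurable M"
    and Cauchy: "\<And>e. 0 < e \<Longrightarrow> \<exists>K. \<forall>m\<ge>K. \<forall>n\<ge>K. L2_energy M (\<lambda>x. F m x - F n x) \<le> ennreal e"
  obtains h where "h \<in> borel_measurable M"
    "\<And>e. 0 < e \<Longrightarrow> \<exists>K. \<forall>n\<ge>K. L2_energy M (\<lambda>x. F n x - h x) \<le> ennreal e"
proof -
  have "\<exists>K. \<forall>k. \<forall>m\<ge>K k. \<forall>n\<ge>K k. L2_energy M (\<lambda>x. F m x - F n x) \<le> ennreal ((1/8) ^ k)"
    by (intro choice allI Cauchy) simp
  then obtain K where K: "\<And>k m n. K k \<le> m \<Longrightarrow> K k \<le> n \<Longrightarrow>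
      L2_energy M (\<lambda>x. F m x - F n x) \<le> ennreal ((1/8) ^ k)" by blast
  \<comment> \<open>Adding all earlier thresholds makes \<open>r\<close> nondecreasing and puts
    \<open>r j\<close> above \<open>K k\<close> for every \<open>k \<le> j\<close>; the summand
    \<open>k\<close> makes it unbounded.\<close>
  define r where "r k = k + (\<Sum>i\<le>k. K i)" for k
  have rK: "K k \<le> r k" "k \<le> r k" "r k \<le> r (Suc k)" for k
    using member_le_sum[of k "{..k}" K] by (auto simp: r_def)
  have rK': "K k \<le> r j" if "k \<le> j" for k j
    using member_le_sum[of k "{..j}" K] that by (auto simp: r_def)
  define d where "d k x = norm (F (r (Suc k)) x - F (r k) x)" for k x
  have [measurable]: "d k \<in> borel_measurable M" for k unfolding d_def by measurable
  have "(\<integral>\<^sup>+x. (\<Sum>k. ennreal (4 ^ k * (d k x)\<^sup>2)) \<partial>M) = (\<Sum>k. \<integral>\<^sup>+x. ennreal (4 ^ k * (d k x)\<^sup>2) \<partial>M)"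
    by (rule nn_integral_suminf) measurable
  also have "\<dots> \<le> (\<Sum>k. ennreal ((1/2) ^ k))"
  proof (intro suminf_le allI summableI)
    fix k
    have "(\<integral>\<^sup>+x. ennreal (4 ^ k * (d k x)\<^sup>2) \<partial>M) = ennreal (4 ^ k) * (\<integral>\<^sup>+x. ennreal ((d k x)\<^sup>2) \<partial>M)"
      by (simp add: ennreal_mult nn_integral_cmult)
    also have "\<dots> \<le> ennreal (4 ^ k) * ennreal ((1/8) ^ k)"
      unfolding d_def using rK[of k] by (intro mult_left_mono K) auto
    also have "\<dots> = ennreal ((1/2) ^ k)"
      by (simp add: ennreal_mult[symmetric] power_mult_distrib[symmetric])
    finally show "(\<integral>\<^sup>+x. ennreal (4 ^ k * (d k x)\<^sup>2) \<partial>M) \<le> ennreal ((1/2) ^ k)" .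
  qed
  also have "\<dots> = ennreal (\<Sum>k. (1/2) ^ k)" by (intro suminf_ennreal2 summable_geometric) auto
  also have "\<dots> < \<infinity>" by simp
  finally have "AE x in M. (\<Sum>k. ennreal (4 ^ k * (d k x)\<^sup>2)) \<noteq> \<infinity>"
    by (intro nn_integral_PInf_AE) auto
  then have conv: "AE x in M. convergent (\<lambda>k. F (r k) x)"
  proof eventually_elim
    case (elim x)
    define S where "S = (\<Sum>k. ennreal (4 ^ k * (d k x)\<^sup>2))"
    obtain s where s: "S = ennreal s" "0 \<le> s" using elim by (cases S) (auto simp: S_def)
    have "d k x \<le> sqrt s * (1/2) ^ k" for k
    proof -
      have "ennreal (4 ^ k * (d k x)\<^sup>2) \<le> S" unfolding S_def
        by (rule ennreal_le_suminf)
      then have "4 ^ k * (d k x)\<^sup>2 \<le> s" using s by simp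
      moreover have "(2 ^ k)\<^sup>2 = (4::real) ^ k" by (simp add: power_mult[symmetric] mult.commute[of k]) (simp add: power_mult)
      ultimately have "(2 ^ k * d k x)\<^sup>2 \<le> s" by (simp add: power_mult_distrib)
      then have "2 ^ k * d k x \<le> sqrt s" by (rule real_le_rsqrt)
      then show ?thesis by (simp add: field_simps)
    qed
    then have "norm (F (r (Suc k)) x - F (r k) x) \<le> sqrt s * (1/2) ^ k" for k by (simp add: d_def)
    moreover have "summable (\<lambda>k. sqrt s * (1/2) ^ k)" by (intro summable_mult summable_geometric) simp
    ultimately have "summable (\<lambda>k. F (r (Suc k)) x - F (r k) x)"
      by (rule summable_comparison_test'[where N = 0, rotated])
    then have "convergent (\<lambda>n. \<Sum>k<n. F (r (Suc k)) x - F (r k) x)"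
      by (simp add: summable_iff_convergent)
    then have "convergent (\<lambda>n. F (r n) x - F (r 0) x)" unfolding sum_lessThan_telescope[of "\<lambda>k. F (r k) x"] .
    from convergent_add[OF this convergent_const[of "F (r 0) x"]] show ?case by simp
  qed
  define h where "h x = lim (\<lambda>k. F (r k) x)" for x
  have [measurable]: "h \<in> borel_measurable M" unfolding h_def by measurable
  have lim: "AE x in M. (\<lambda>k. F (r k) x) \<longlonglongrightarrow> h x"
    using conv by eventually_elim (simp add: h_def convergent_LIMSEQ_iff)
  have "\<exists>K. \<forall>n\<ge>K. L2_energy M (\<lambda>x. F n x - h x) \<le> ennreal e" if e: "0 < e" for e
  proof -
    obtain L where L: "\<And>m n. L \<le> m \<Longrightarrow> L \<le> n \<Longrightarrow>
        L2_energy M (\<lambda>x. F m x - F n x) \<le> ennreal e"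
      using Cauchy[OF e] by blast
    have "L2_energy M (\<lambda>x. F n x - h x) \<le> ennreal e" if n: "L \<le> n" for n
    proof -
      \<comment> \<open>Fatou's lemma along \<open>r\<close>, with \<open>n\<close> fixed, turns the
        bound on pairs into a bound on the distance to the limit. Hence the whole sequence
        converges, not only the subsequence.\<close>
      have "L2_energy M (\<lambda>x. F n x - h x)
          = (\<integral>\<^sup>+x. liminf (\<lambda>k. ennreal ((norm (F n x - F (r k) x))\<^sup>2)) \<partial>M)"
      proof (rule nn_integral_cong_AE, use lim in eventually_elim)
        case (elim x)
        have "(\<lambda>k. ennreal ((norm (F n x - F (r k) x))\<^sup>2)) \<longlonglongrightarrow> ennreal ((norm (F n x - h x))\<^sup>2)"
          by (intro tendsto_ennrealI tendsto_intros elim)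
        from lim_imp_Liminf[OF sequentially_bot this] show ?case by (rule sym)
      qed
      also have "\<dots> \<le> liminf (\<lambda>k. \<integral>\<^sup>+x. ennreal ((norm (F n x - F (r k) x))\<^sup>2) \<partial>M)"
        by (rule nn_integral_liminf) measurable
      also have "\<dots> \<le> ennreal e"
      proof (rule Liminf_le)
        show "\<forall>\<^sub>F k in sequentially. L2_energy M (\<lambda>x. F n x - F (r k) x) \<le> ennreal e"
          using eventually_ge_at_top[of L]
        proof eventually_elim
          case (elim k)
          then show ?case using rK(2)[of k] n by (intro L) auto
        qed
      qed simp
      finally show ?thesis .
    qed
    then show ?thesis by blast
  qed
  then show ?thesis using that \<open>h \<in> borel_measurable M\<close> by blast
qed

section \<open>Sign patterns and chaining\<close>

text \<open>In the dual picture each frequency is a (possibly degenerate) hyperplane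
  \<open>{v. \<xi> j \<bullet> (v, 1) = 0}\<close>, and the pattern names the cell of the
  arrangement that contains \<open>v\<close>. Points on a hyperplane count with its negative side,
  so that there are only two sides.\<close>

definition sign_pattern :: "(nat \<Rightarrow> 'a::euclidean_space \<times> real) \<Rightarrow> nat \<Rightarrow> 'a \<Rightarrow> nat set" where
  "sign_pattern \<xi> m v = {j. j < m \<and> 0 < \<xi> j \<bullet> (v, 1)}"

lemma sign_pattern_Suc:
  "sign_pattern \<xi> (Suc m) v =
     (if 0 < \<xi> m \<bullet> (v, 1) then insert m (sign_pattern \<xi> m v) else sign_pattern \<xi> m v)"
  by (auto simp: sign_pattern_def less_Suc_eq)

lemma finite_sign_pattern_image: "finite (sign_pattern \<xi> m ` A)"
  by (rule finite_subset[of _ "Pow {..<m}"]) (auto simp: sign_pattern_def)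

text \<open>Cells are convex, being intersections of half-spaces, some open and some closed. The
  counting argument uses this to keep the old pattern while moving to a point of a new
  hyperplane.\<close>

lemma sign_pattern_segment:
  assumes "sign_pattern \<xi> m u = sign_pattern \<xi> m w" "0 \<le> s" "s \<le> 1"
  shows "sign_pattern \<xi> m ((1 - s) *\<^sub>R u + s *\<^sub>R w) = sign_pattern \<xi> m u"
proof -
  have eq: "\<xi> j \<bullet> ((1 - s) *\<^sub>R u + s *\<^sub>R w, 1) = (1 - s) * (\<xi> j \<bullet> (u, 1)) + s * (\<xi> j \<bullet> (w, 1))" for j
    by (cases "\<xi> j") (simp add: inner_add_right algebra_simps)
  have "(0 < (1 - s) * (\<xi> j \<bullet> (u, 1)) + s * (\<xi> j \<bullet> (w, 1))) \<longleftrightarrow> 0 < \<xi> j \<bullet> (u, 1)" if "j < m" for j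
  proof -
    have iff: "0 < \<xi> j \<bullet> (u, 1) \<longleftrightarrow> 0 < \<xi> j \<bullet> (w, 1)"
      using assms(1) that by (auto simp: sign_pattern_def set_eq_iff)
    show ?thesis
    proof (cases "0 < \<xi> j \<bullet> (u, 1)")
      case True
      then have "0 < \<xi> j \<bullet> (w, 1)" using iff by simp
      show ?thesis
      proof (cases "s = 0")
        case False
        then have "0 < s * (\<xi> j \<bullet> (w, 1))" using assms \<open>0 < \<xi> j \<bullet> (w, 1)\<close> by simp
        moreover have "0 \<le> (1 - s) * (\<xi> j \<bullet> (u, 1))" using True assms by simp
        ultimately show ?thesis using True by linarith
      qed (use True in simp)
    next
      case False
      then have "(1 - s) * (\<xi> j \<bullet> (u, 1)) \<le> 0" "s * (\<xi> j \<bullet> (w, 1)) \<le> 0"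
        using iff assms by (auto intro: mult_nonneg_nonpos)
      then show ?thesis using False by linarith
    qed
  qed
  then show ?thesis unfolding sign_pattern_def eq by auto
qed

lemma card_sign_pattern_le:
  fixes A :: "'a::euclidean_space set"
  assumes "affine A" "aff_dim A \<le> int d"
  shows "card (sign_pattern \<xi> m ` A) \<le> (m + 1) ^ d"
  using assms
proof (induction m arbitrary: A d)
  case 0
  have "sign_pattern \<xi> 0 ` A \<subseteq> {{}}" by (auto simp: sign_pattern_def)
  then have "card (sign_pattern \<xi> 0 ` A) \<le> card {{}::nat set}" by (rule card_mono[rotated]) simp
  then show ?case by simp
next
  case (Suc m)
  let ?P = "sign_pattern \<xi> m ` A" and ?P' = "sign_pattern \<xi> (Suc m) ` A"
  let ?H = "{v. \<xi> m \<bullet> (v, 1) = 0}"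
  \<comment> \<open>One representative, the positive half, of each cell that the new hyperplane
    cuts.\<close>
  define B where "B = {p \<in> ?P'. m \<in> p \<and> p - {m} \<in> ?P'}"
  have notin: "m \<notin> sign_pattern \<xi> m v" for v by (simp add: sign_pattern_def)
  have diff: "sign_pattern \<xi> (Suc m) v - {m} = sign_pattern \<xi> m v" for v
    using notin by (auto simp: sign_pattern_Suc)
  have fin: "finite ?P" "finite ?P'" by (rule finite_sign_pattern_image)+
  have inj: "inj_on (\<lambda>p. p - {m}) (?P' - B)"
  proof (rule inj_onI)
    fix p q assume p: "p \<in> ?P' - B" and q: "q \<in> ?P' - B" and e: "p - {m} = q - {m}"
    show "p = q"
    proof (cases "m \<in> p \<longleftrightarrow> m \<in> q")
      case True then show ?thesis using e by auto
    next
      case False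
      then show ?thesis
      proof (cases "m \<in> p")
        case True
        then have "p - {m} = q" using e False by auto
        then show ?thesis using p q True by (auto simp: B_def)
      next
        case False2: False
        then have "q - {m} = p" "m \<in> q" using e False by auto
        then show ?thesis using p q by (auto simp: B_def)
      qed
    qed
  qed
  have 1: "card (?P' - B) \<le> card ?P"
    by (rule card_inj_on_le[OF inj]) (use diff fin in auto)
  have sub: "(\<lambda>p. p - {m}) ` B \<subseteq> sign_pattern \<xi> m ` (A \<inter> ?H)"
  proof (clarsimp simp: B_def, goal_cases)
    case (1 u w)
    have u: "0 < \<xi> m \<bullet> (u, 1)" using 1 notin by (auto simp: sign_pattern_Suc split: if_splits)
    have pu: "sign_pattern \<xi> (Suc m) u - {m} = sign_pattern \<xi> m u" by (rule diff)
    have w: "\<not> 0 < \<xi> m \<bullet> (w, 1)"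
    proof
      assume "0 < \<xi> m \<bullet> (w, 1)"
      then have "m \<in> sign_pattern \<xi> (Suc m) w" by (simp add: sign_pattern_Suc)
      then show False using 1 by blast
    qed
    have pw: "sign_pattern \<xi> m w = sign_pattern \<xi> m u"
      using 1 w pu by (simp add: sign_pattern_Suc[of _ _ w])
    define a where "a = \<xi> m \<bullet> (u, 1)"
    define b where "b = \<xi> m \<bullet> (w, 1)"
    \<comment> \<open>The affine function that defines the new hyperplane is \<open>a > 0\<close> at
      \<open>u\<close> and \<open>b \<le> 0\<close> at \<open>w\<close>; it vanishes at this
      parameter of the segment.\<close>
    define s where "s = a / (a - b)"
    have ab: "0 < a" "b \<le> 0" using u w by (auto simp: a_def b_def)
    have s: "0 \<le> s" "s \<le> 1" using ab by (auto simp: s_def field_simps)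
    let ?z = "(1 - s) *\<^sub>R u + s *\<^sub>R w"
    have "\<xi> m \<bullet> (?z, 1) = (1 - s) * a + s * b"
      unfolding a_def b_def by (cases "\<xi> m") (simp add: inner_add_right algebra_simps)
    also have "\<dots> = 0" using ab by (simp add: s_def field_simps)
    finally have "?z \<in> ?H" by simp
    moreover have "?z \<in> A" using Suc.prems(1) 1 by (auto simp: affine_def)
    ultimately have "sign_pattern \<xi> m ?z \<in> sign_pattern \<xi> m ` (A \<inter> ?H)" by blast
    moreover have "sign_pattern \<xi> (Suc m) w = sign_pattern \<xi> m u"
      using w pw by (simp add: sign_pattern_Suc)
    ultimately show ?case unfolding sign_pattern_segment[OF pw[symmetric] s] by simp
  qed
  have injB: "inj_on (\<lambda>p. p - {m}) B"
    by (rule inj_onI) (auto simp: B_def)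
  have 2: "card B \<le> card (sign_pattern \<xi> m ` (A \<inter> ?H))"
    by (rule card_inj_on_le[OF injB sub finite_sign_pattern_image])
  have BP: "B \<subseteq> ?P'" by (auto simp: B_def)
  have split: "card ?P' = card (?P' - B) + card B"
    using fin(2) BP by (metis card_Diff_subset card_mono finite_subset le_add_diff_inverse2)
  have IH1: "card ?P \<le> (m + 1) ^ d" by (rule Suc.IH[OF Suc.prems])
  show ?case
  proof (cases "B = {}")
    \<comment> \<open>Without cut cells the count does not grow. The case \<open>d = 0\<close>
      always ends here.\<close>
    case True
    then have "card ?P' \<le> (m + 1) ^ d" using split 1 IH1 by simp
    also have "\<dots> \<le> (Suc m + 1) ^ d" by (intro power_mono) auto
    finally show ?thesis .
  next
    case False
    then obtain p where "p \<in> B" by blast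
    then obtain u where u: "u \<in> A" "m \<in> sign_pattern \<xi> (Suc m) u" by (auto simp: B_def)
    then have "u \<notin> ?H" using notin[of u] by (auto simp: sign_pattern_Suc split: if_splits)
    have affH: "affine ?H"
    proof -
      have "?H = {v. fst (\<xi> m) \<bullet> v = - snd (\<xi> m)}" by (cases "\<xi> m") auto
      then show ?thesis by (simp add: affine_hyperplane)
    qed
    have aff: "affine (A \<inter> ?H)" using Suc.prems(1) affH by (rule affine_Int)
    have ne: "A \<inter> ?H \<noteq> {}" using sub False by (metis image_is_empty subset_empty)
    \<comment> \<open>A cut cell has a point of \<open>A\<close> off the hyperplane and, by
      convexity, one on it. So the intersection is a nonempty proper affine subset, and
      \<open>d\<close> is a successor.\<close>
    have lt: "aff_dim (A \<inter> ?H) < aff_dim A"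
    proof (rule aff_dim_psubset)
      have "A \<inter> ?H \<noteq> A" using u(1) \<open>u \<notin> ?H\<close> by (metis IntD2)
      then have "A \<inter> ?H \<subset> A" by (simp add: psubsetI)
      then show "affine hull (A \<inter> ?H) \<subset> affine hull A"
        using aff Suc.prems(1) affine_hull_eq by metis
    qed
    have "0 \<le> aff_dim (A \<inter> ?H)" using ne
      by (metis aff_dim_negative_iff not_less)
    then obtain e where d: "d = Suc e" using lt Suc.prems(2) by (cases d) auto
    have "aff_dim (A \<inter> ?H) \<le> int e" using lt Suc.prems(2) d by linarith
    then have "card (sign_pattern \<xi> m ` (A \<inter> ?H)) \<le> (m + 1) ^ e" by (rule Suc.IH[OF aff])
    then have "card ?P' \<le> (m + 1) ^ d + (m + 1) ^ e" using split 1 2 IH1 by linarith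
    also have "\<dots> = (m + 2) * (m + 1) ^ e" by (simp add: d)
    also have "\<dots> \<le> (m + 2) * (m + 2) ^ e" by (intro mult_left_mono power_mono) auto
    finally show ?thesis by (simp add: d)
  qed
qed

section \<open>Separation of points by random frequencies\<close>

definition sep :: "'a::euclidean_space \<Rightarrow> 'a \<Rightarrow> ('a \<times> real) set" where
  "sep v w = {\<xi>. (0 < \<xi> \<bullet> (v, 1)) \<noteq> (0 < \<xi> \<bullet> (w, 1))}"

lemma sep_measurable[measurable]: "sep v w \<in> sets borel"
  unfolding sep_def by measurable

text \<open>First moment: a frequency drawn from the normalised \<open>M\<close> leaves each pair of
  \<open>U\<close> unseparated with probability at most \<open>1 - \<delta>\<close>, and some
  frequency does at least as well as the mean.\<close>

lemma exists_separating_many: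
  fixes M :: "('a::euclidean_space \<times> real) measure"
  assumes M: "finite_measure M" "sets M = sets borel" "0 < measure M UNIV"
    and U: "finite U" "\<And>v w. (v, w) \<in> U \<Longrightarrow> \<delta> * measure M UNIV \<le> measure M (sep v w)"
  shows "\<exists>\<xi>. real (card {(v, w) \<in> U. \<xi> \<notin> sep v w}) \<le> (1 - \<delta>) * real (card U)"
proof (rule ccontr)
  interpret finite_measure M by fact
  have sp: "space M = UNIV" using sets_eq_imp_space_eq[OF M(2)] by simp
  note M(2)[measurable_cong]
  assume "\<not> ?thesis"
  then have lt: "(1 - \<delta>) * real (card U) < real (card {(v, w) \<in> U. \<xi> \<notin> sep v w})" for \<xi>
    unfolding not_ex not_le by blast
  have card: "real (card {(v, w) \<in> U. \<xi> \<notin> sep v w}) = (\<Sum>p\<in>U. indicator (- sep (fst p) (snd p)) \<xi>)" for \<xi>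
  proof -
    have "{(v, w) \<in> U. \<xi> \<notin> sep v w} = U \<inter> {p. \<xi> \<in> - sep (fst p) (snd p)}" by auto
    then show ?thesis using U(1) by (simp add: indicator_def sum.If_cases of_bool_def)
  qed
  have int: "integrable M (\<lambda>\<xi>. \<Sum>p\<in>U. indicator (- sep (fst p) (snd p)) \<xi> :: real)"
    by (intro Bochner_Integration.integrable_sum integrable_real_indicator)
       (auto simp: less_top[symmetric])
  have "(1 - \<delta>) * real (card U) * measure M UNIV = (\<integral>\<xi>. (1 - \<delta>) * real (card U) \<partial>M)"
    by (simp add: sp)
  also have "\<dots> < (\<integral>\<xi>. (\<Sum>p\<in>U. indicator (- sep (fst p) (snd p)) \<xi>) \<partial>M)"
    by (rule integral_less_AE_space)
       (use int lt M(3) in \<open>auto simp: card sp emeasure_eq_measure\<close>)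
  also have "\<dots> = (\<Sum>p\<in>U. measure M (- sep (fst p) (snd p)))"
    by (subst Bochner_Integration.integral_sum)
       (auto simp: sp less_top[symmetric] intro!: integrable_real_indicator)
  also have "\<dots> = (\<Sum>p\<in>U. measure M UNIV - measure M (sep (fst p) (snd p)))"
    by (intro sum.cong refl) (simp add: finite_measure_compl[of "sep _ _", unfolded sp] Compl_eq_Diff_UNIV)
  also have "\<dots> \<le> (\<Sum>p\<in>U. (1 - \<delta>) * measure M UNIV)"
    using U(2) by (intro sum_mono) (force simp: algebra_simps)
  finally show False by (simp add: algebra_simps)
qed

text \<open>Greedy choice instead of independent sampling: each new frequency is selected for the
  pairs that the earlier ones left unseparated, which keeps the argument on the single measure
  \<open>M\<close>.\<close>

lemma exists_separating_sequence:
  fixes M :: "('a::euclidean_space \<times> real) measure"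
  assumes M: "finite_measure M" "sets M = sets borel" "0 < measure M UNIV"
    and U: "finite U" "\<And>v w. (v, w) \<in> U \<Longrightarrow> \<delta> * measure M UNIV \<le> measure M (sep v w)"
    and "\<delta> \<le> 1"
  shows "\<exists>\<xi>. real (card {(v, w) \<in> U. \<forall>j<m. \<xi> j \<notin> sep v w}) \<le> (1 - \<delta>) ^ m * real (card U)"
proof (induction m)
  case 0
  have "{(v, w) \<in> U. \<forall>j<0::nat. \<xi> j \<notin> sep v w} = U" for \<xi> by auto
  then show ?case by simp
next
  case (Suc m)
  then obtain \<xi> where \<xi>: "real (card {(v, w) \<in> U. \<forall>j<m. \<xi> j \<notin> sep v w}) \<le> (1 - \<delta>) ^ m * real (card U)"
    by blast
  let ?U = "{(v, w) \<in> U. \<forall>j<m. \<xi> j \<notin> sep v w}"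
  have "finite ?U" using U(1) by (rule rev_finite_subset) auto
  then obtain \<eta> where \<eta>: "real (card {(v, w) \<in> ?U. \<eta> \<notin> sep v w}) \<le> (1 - \<delta>) * real (card ?U)"
    using exists_separating_many[OF M, of ?U \<delta>] U(2) by auto
  have "{(v, w) \<in> U. \<forall>j<Suc m. (\<xi>(m := \<eta>)) j \<notin> sep v w} = {(v, w) \<in> ?U. \<eta> \<notin> sep v w}"
    by (auto simp: less_Suc_eq)
  then have "real (card {(v, w) \<in> U. \<forall>j<Suc m. (\<xi>(m := \<eta>)) j \<notin> sep v w}) \<le> (1 - \<delta>) * real (card ?U)"
    using \<eta> by simp
  also have "\<dots> \<le> (1 - \<delta>) * ((1 - \<delta>) ^ m * real (card U))"
    using \<xi> \<open>\<delta> \<le> 1\<close> by (intro mult_left_mono) auto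
  finally show ?case by (intro exI[of _ "\<xi>(m := \<eta>)"]) (simp add: mult.assoc)
qed

lemma exists_close_pair:
  fixes M :: "('a::euclidean_space \<times> real) measure" and V :: "'a set"
  assumes M: "finite_measure M" "sets M = sets borel" and V: "finite V" "2 \<le> card V"
  shows "\<exists>v\<in>V. \<exists>w\<in>V. v \<noteq> w \<and> measure M (sep v w)
           \<le> (2 * ln (card V) + 2) * real (card V) powr (- 1 / DIM('a)) * measure M UNIV"
proof (rule ccontr)
  interpret finite_measure M by fact
  have sp: "space M = UNIV" using sets_eq_imp_space_eq[OF M(2)] by simp
  define T where "T = measure M UNIV"
  define N where "N = real (card V)"
  \<comment> \<open>Chosen so that \<open>(2 * ln N + 2) / \<delta>\<close> is exactly
    \<open>N powr (1 / DIM('a))\<close>: the upper bound for \<open>m + 1\<close> then meets the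
    lower bound that the cell count imposes.\<close>
  define \<delta> where "\<delta> = (2 * ln N + 2) * N powr (- 1 / DIM('a))"
  have N: "2 \<le> N" using V by (simp add: N_def)
  assume "\<not> ?thesis"
  then have far: "\<delta> * T < measure M (sep v w)" if "v \<in> V" "w \<in> V" "v \<noteq> w" for v w
    using that by (auto simp: \<delta>_def T_def N_def not_le)
  have "\<not> card V \<le> Suc 0" using V by simp
  then obtain v0 w0 where vw: "v0 \<in> V" "w0 \<in> V" "v0 \<noteq> w0"
    using V(1) card_le_Suc0_iff_eq by blast
  have le: "measure M A \<le> T" for A unfolding T_def
    using bounded_measure[of A] by (simp add: sp)
  have \<delta>0: "0 < \<delta>" using N unfolding \<delta>_def by (intro mult_pos_pos add_nonneg_pos) auto
  \<comment> \<open>There are two distinct points in \<open>V\<close>, and no set has mass above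
    \<open>T\<close>; so the negated claim forces \<open>\<delta> < 1\<close> and
    \<open>T > 0\<close>.\<close>
  have "\<delta> * T < T" using far[OF vw] le[of "sep v0 w0"] by linarith
  moreover have "0 \<le> T" by (simp add: T_def)
  ultimately have T: "0 < T" and \<delta>1: "\<delta> < 1" using \<delta>0 by (auto simp: order_le_less)
  \<comment> \<open>More than \<open>2 * ln N / \<delta>\<close> frequencies push
    \<open>(1 - \<delta>) ^ m\<close> below \<open>1 / N ^ 2\<close>, while there are at most
    \<open>N ^ 2\<close> ordered pairs: less than one pair remains unseparated.\<close>
  define m where "m = nat \<lfloor>2 * ln N / \<delta>\<rfloor> + 1"
  have q0: "0 \<le> 2 * ln N / \<delta>" using N \<delta>0 by simp
  then have m: "2 * ln N / \<delta> < real m" "real m \<le> 2 * ln N / \<delta> + 1"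
    unfolding m_def by (auto simp: of_nat_nat) linarith+
  define U where "U = {(v, w). v \<in> V \<and> w \<in> V \<and> v \<noteq> w}"
  have US: "U \<subseteq> V \<times> V" by (auto simp: U_def)
  have Ufin: "finite U" using US V(1) by (metis finite_SigmaI finite_subset)
  have "card U \<le> card V * card V" using card_mono[OF _ US] V(1) by (simp add: card_cartesian_product)
  then have cU: "real (card U) \<le> N ^ 2"
    unfolding N_def by (metis of_nat_le_iff of_nat_mult power2_eq_square)
  have "\<exists>\<xi>. real (card {(v, w) \<in> U. \<forall>j<m. \<xi> j \<notin> sep v w}) \<le> (1 - \<delta>) ^ m * real (card U)"
    by (rule exists_separating_sequence[OF M])
       (use Ufin far T \<delta>1 in \<open>auto simp: T_def U_def intro: less_imp_le\<close>)
  then obtain \<xi> where \<xi>: "real (card {(v, w) \<in> U. \<forall>j<m. \<xi> j \<notin> sep v w}) \<le> (1 - \<delta>) ^ m * real (card U)" ..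
  have "(1 - \<delta>) ^ m \<le> exp (- \<delta>) ^ m" using \<delta>1 exp_ge_add_one_self[of "- \<delta>"] by (intro power_mono) auto
  also have "\<dots> = exp (- (\<delta> * real m))" by (simp add: exp_of_nat_mult[symmetric] mult.commute)
  also have "\<dots> < exp (- (2 * ln N))" using m(1) \<delta>0 by (simp add: field_simps)
  also have "\<dots> = 1 / N ^ 2" using N by (simp add: exp_minus exp_of_nat_mult[of 2 "ln N", simplified] inverse_eq_divide)
  finally have "(1 - \<delta>) ^ m * N ^ 2 < 1" using N by (simp add: field_simps)
  moreover have "(1 - \<delta>) ^ m * real (card U) \<le> (1 - \<delta>) ^ m * N ^ 2"
    using cU \<delta>1 by (intro mult_left_mono) auto
  ultimately have "(1 - \<delta>) ^ m * real (card U) < 1" by linarith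
  then have "card {(v, w) \<in> U. \<forall>j<m. \<xi> j \<notin> sep v w} = 0" using \<xi> by auto
  moreover have "finite {(v, w) \<in> U. \<forall>j<m. \<xi> j \<notin> sep v w}" using Ufin by (rule rev_finite_subset) auto
  ultimately have empty: "{(v, w) \<in> U. \<forall>j<m. \<xi> j \<notin> sep v w} = {}" by simp
  have "inj_on (sign_pattern \<xi> m) V"
  proof (rule inj_onI, rule ccontr)
    fix v w assume "v \<in> V" "w \<in> V" and eq: "sign_pattern \<xi> m v = sign_pattern \<xi> m w" and "v \<noteq> w"
    then have "(v, w) \<in> U" by (simp add: U_def)
    then obtain j where "j < m" "\<xi> j \<in> sep v w" using empty by blast
    then show False using eq by (auto simp: sep_def sign_pattern_def set_eq_iff)
  qed
  then have "card V = card (sign_pattern \<xi> m ` V)" by (simp add: card_image)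
  also have "\<dots> \<le> card (sign_pattern \<xi> m ` UNIV)"
    by (intro card_mono finite_sign_pattern_image) auto
  also have "\<dots> \<le> (m + 1) ^ DIM('a)" by (rule card_sign_pattern_le) auto
  finally have "N \<le> (real m + 1) ^ DIM('a)"
    unfolding N_def by (metis of_nat_1 of_nat_add of_nat_le_iff of_nat_power)
  then have "N powr (1 / DIM('a)) \<le> ((real m + 1) ^ DIM('a)) powr (1 / DIM('a))"
    using N by (intro powr_mono2) auto
  also have "\<dots> = real m + 1" by (simp add: powr_realpow[symmetric] powr_powr)
  also have "\<dots> \<le> 2 * ln N / \<delta> + 2" using m by simp
  \<comment> \<open>Strict because \<open>2 < 2 / \<delta>\<close>; this is where
    \<open>\<delta> < 1\<close> and the summand 2 beside the logarithm are spent.\<close>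
  also have "\<dots> < (2 * ln N + 2) / \<delta>" using \<delta>0 \<delta>1 by (simp add: field_simps)
  also have "\<dots> = N powr (1 / DIM('a))"
  proof -
    have "0 \<le> ln N" using N by simp
    then have "2 * ln N + 2 \<noteq> 0" by linarith
    then show ?thesis using N by (simp add: \<delta>_def powr_minus divide_simps)
  qed
  finally show False by simp
qed

section \<open>Halving nets and chaining\<close>

lemma nn_integral_power2_add_le:
  fixes F G :: "'b \<Rightarrow> real"
  assumes [measurable]: "F \<in> borel_measurable M" "G \<in> borel_measurable M"
    and F: "(\<integral>\<^sup>+x. ennreal ((F x)\<^sup>2) \<partial>M) \<le> ennreal (a\<^sup>2)"
    and G: "(\<integral>\<^sup>+x. ennreal ((G x)\<^sup>2) \<partial>M) \<le> ennreal (b\<^sup>2)"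
    and "0 \<le> a" "0 \<le> b"
  shows "(\<integral>\<^sup>+x. ennreal ((F x + G x)\<^sup>2) \<partial>M) \<le> ennreal ((a + b)\<^sup>2)"
proof -
  have null: "AE x in M. H x = 0" if [measurable]: "H \<in> borel_measurable M"
    and "(\<integral>\<^sup>+x. ennreal ((H x)\<^sup>2) \<partial>M) \<le> ennreal (0\<^sup>2)" for H :: "'b \<Rightarrow> real"
  proof -
    have "(\<integral>\<^sup>+x. ennreal ((H x)\<^sup>2) \<partial>M) = 0" using that by simp
    then have "AE x in M. ennreal ((H x)\<^sup>2) = 0" by (subst (asm) nn_integral_0_iff_AE) auto
    then show ?thesis by eventually_elim simp
  qed
  consider "a = 0" | "b = 0" | "0 < a" "0 < b" using assms by fastforce
  then show ?thesis
  proof cases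
    case 1
    then have "AE x in M. F x = 0" using F by (intro null) auto
    then have "(\<integral>\<^sup>+x. ennreal ((F x + G x)\<^sup>2) \<partial>M) = (\<integral>\<^sup>+x. ennreal ((G x)\<^sup>2) \<partial>M)"
      by (intro nn_integral_cong_AE) auto
    then show ?thesis using G 1 by simp
  next
    case 2
    then have "AE x in M. G x = 0" using G by (intro null) auto
    then have "(\<integral>\<^sup>+x. ennreal ((F x + G x)\<^sup>2) \<partial>M) = (\<integral>\<^sup>+x. ennreal ((F x)\<^sup>2) \<partial>M)"
      by (intro nn_integral_cong_AE) auto
    then show ?thesis using F 2 by simp
  next
    case 3
    \<comment> \<open>Young's inequality with the weights that turn the bounds
      \<open>a\<^sup>2\<close> and \<open>b\<^sup>2\<close> into exactly
      \<open>(a + b)\<^sup>2\<close>, that is, Minkowski's inequality with its sharp constant. The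
      weights require positive \<open>a\<close> and \<open>b\<close>, hence the separate null
      cases.\<close>
    have pt: "(x + y)\<^sup>2 \<le> (1 + b / a) * x\<^sup>2 + (1 + a / b) * y\<^sup>2" for x y :: real
    proof -
      have "0 \<le> (b * x - a * y)\<^sup>2 / (a * b)" using 3 by simp
      also have "\<dots> = (1 + b / a) * x\<^sup>2 + (1 + a / b) * y\<^sup>2 - (x + y)\<^sup>2"
        using 3 by (simp add: field_simps power2_eq_square)
      finally show ?thesis by simp
    qed
    have "(\<integral>\<^sup>+x. ennreal ((F x + G x)\<^sup>2) \<partial>M)
        \<le> (\<integral>\<^sup>+x. ennreal (1 + b / a) * ennreal ((F x)\<^sup>2) + ennreal (1 + a / b) * ennreal ((G x)\<^sup>2) \<partial>M)"
      using 3 pt by (intro nn_integral_mono) (simp add: ennreal_mult[symmetric] ennreal_plus[symmetric] del: ennreal_plus)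
    also have "\<dots> = ennreal (1 + b / a) * (\<integral>\<^sup>+x. ennreal ((F x)\<^sup>2) \<partial>M)
        + ennreal (1 + a / b) * (\<integral>\<^sup>+x. ennreal ((G x)\<^sup>2) \<partial>M)"
      by (simp add: nn_integral_add nn_integral_cmult)
    also have "\<dots> \<le> ennreal (1 + b / a) * ennreal (a\<^sup>2) + ennreal (1 + a / b) * ennreal (b\<^sup>2)"
      using F G by (intro add_mono mult_left_mono) auto
    also have "\<dots> = ennreal ((a + b)\<^sup>2)"
      using 3 by (simp add: ennreal_mult[symmetric] ennreal_plus[symmetric] del: ennreal_plus)
        (simp add: field_simps power2_eq_square)
    finally show ?thesis .
  qed
qed

text \<open>The cost of one halving against the target. The factor \<open>1 / \<epsilon> + 2\<close>
  comes from \<open>ln N \<le> N powr (2 * \<epsilon>) / (2 * \<epsilon>)\<close>, the 8 from the 4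
  times \<open>2 powr (1 / d) \<le> 2\<close> (the price of \<open>N / 2\<close> inside the power),
  and \<open>1 - 1 / d + 2 * \<epsilon>\<close> is twice the final exponent.\<close>

lemma powr_exponent_bound:
  fixes N \<epsilon> d :: real
  assumes "2 \<le> N" "0 < \<epsilon>" "1 \<le> d"
  shows "N * (4 * ((2 * ln N + 2) * (N / 2) powr (- 1 / d)))
    \<le> (sqrt (8 * (1 / \<epsilon> + 2)) * N powr ((d - 1) / (2 * d) + \<epsilon>))\<^sup>2"
proof -
  have "ln N \<le> N powr (2 * \<epsilon>) / (2 * \<epsilon>)"
    using ln_powr_bound[of N "2 * \<epsilon>"] assms by simp
  moreover have "1 \<le> N powr (2 * \<epsilon>)" using assms by (simp add: ge_one_powr_ge_zero)
  ultimately have 1: "2 * ln N + 2 \<le> (1 / \<epsilon> + 2) * N powr (2 * \<epsilon>)"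
  proof -
    have "2 * ln N \<le> 1 / \<epsilon> * N powr (2 * \<epsilon>)"
      using \<open>ln N \<le> _\<close> assms by (simp add: field_simps)
    then show ?thesis using \<open>1 \<le> N powr _\<close> by (simp add: algebra_simps)
  qed
  have "(N / 2) powr (- 1 / d) = N powr (- 1 / d) * 2 powr (1 / d)"
    using assms by (simp add: powr_divide powr_minus field_simps)
  moreover have "N powr (- 1 / d) * 2 powr (1 / d) \<le> N powr (- 1 / d) * (2::real) powr 1"
    using assms by (intro mult_left_mono powr_mono) auto
  ultimately have 2: "(N / 2) powr (- 1 / d) \<le> 2 * N powr (- 1 / d)"
    by (simp add: mult.commute)
  have "N * (4 * ((2 * ln N + 2) * (N / 2) powr (- 1 / d)))
      \<le> N * (4 * (((1 / \<epsilon> + 2) * N powr (2 * \<epsilon>)) * (2 * N powr (- 1 / d))))"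
    using 1 2 assms by (intro mult_left_mono mult_mono) auto
  also have "\<dots> = 8 * (1 / \<epsilon> + 2) * (N powr 1 * N powr (2 * \<epsilon>) * N powr (- 1 / d))"
    using assms by simp
  also have "N powr 1 * N powr (2 * \<epsilon>) * N powr (- 1 / d) = N powr (2 * ((d - 1) / (2 * d) + \<epsilon>))"
  proof -
    have "1 + 2 * \<epsilon> + - 1 / d = 2 * ((d - 1) / (2 * d) + \<epsilon>)" using assms by (simp add: field_simps)
    then show ?thesis by (simp only: powr_add[symmetric])
  qed
  also have "\<dots> = (N powr ((d - 1) / (2 * d) + \<epsilon>))\<^sup>2"
    using assms by (simp add: powr_power algebra_simps)
  finally show ?thesis using assms by (simp add: power_mult_distrib)
qed

text \<open>The largest difference is replaced by the root of the sum of squares, because the latter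
  has additive energy. This crude step costs the factor \<open>card \<Omega>\<close>.\<close>

lemma Max_norm_le_chain:
  fixes h :: "'a \<Rightarrow> 'c::real_normed_vector"
  assumes "finite \<Omega>" "\<Omega> \<noteq> {}" "\<Omega>' \<subseteq> \<Omega>" "\<And>v. v \<in> \<Omega> \<Longrightarrow> \<pi> v \<in> \<Omega>'"
  shows "Max ((\<lambda>v. norm (h v)) ` \<Omega>)
    \<le> Max ((\<lambda>v. norm (h v)) ` \<Omega>') + sqrt (\<Sum>v\<in>\<Omega>. (norm (h v - h (\<pi> v)))\<^sup>2)"
proof -
  have fin: "finite \<Omega>'" using assms finite_subset by blast
  have "norm (h v) \<le> Max ((\<lambda>v. norm (h v)) ` \<Omega>') + sqrt (\<Sum>v\<in>\<Omega>. (norm (h v - h (\<pi> v)))\<^sup>2)"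
    if v: "v \<in> \<Omega>" for v
  proof -
    have "norm (h v) \<le> norm (h (\<pi> v)) + norm (h v - h (\<pi> v))" by (metis norm_triangle_sub)
    also have "norm (h (\<pi> v)) \<le> Max ((\<lambda>v. norm (h v)) ` \<Omega>')"
      using fin assms(4)[OF v] by (intro Max_ge) auto
    also have "norm (h v - h (\<pi> v)) = sqrt ((norm (h v - h (\<pi> v)))\<^sup>2)" by simp
    also have "\<dots> \<le> sqrt (\<Sum>v\<in>\<Omega>. (norm (h v - h (\<pi> v)))\<^sup>2)"
      using assms(1) v by (intro real_sqrt_le_mono member_le_sum) auto
    finally show ?thesis by simp
  qed
  then show ?thesis using assms by simp
qed

lemma exists_maximal_subset:
  assumes "finite A" "P {}"
  obtains B where "B \<subseteq> A" "P B" "\<And>a. a \<in> A - B \<Longrightarrow> \<not> P (insert a B)"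
proof -
  have "finite {B. B \<subseteq> A \<and> P B}" "{B. B \<subseteq> A \<and> P B} \<noteq> {}" using assms by auto
  from finite_has_maximal[OF this] obtain B where B: "B \<in> {B. B \<subseteq> A \<and> P B}"
    and max: "\<forall>C\<in>{B. B \<subseteq> A \<and> P B}. B \<subseteq> C \<longrightarrow> B = C" ..
  have "\<not> P (insert a B)" if "a \<in> A - B" for a
  proof
    assume "P (insert a B)"
    then have "insert a B \<in> {B. B \<subseteq> A \<and> P B}" using B that by simp
    then have "B = insert a B" using max by (metis subset_insertI)
    then show False using that by blast
  qed
  then show ?thesis using that[of B] B by simp
qed

lemma halving_net:
  fixes M :: "('a::euclidean_space \<times> real) measure" and \<Omega> :: "'a set"
  assumes M: "finite_measure M" "sets M = sets borel" and \<Omega>: "finite \<Omega>" "2 \<le> card \<Omega>"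
  defines "\<delta> \<equiv> (2 * ln (card \<Omega>) + 2) * (real (card \<Omega>) / 2) powr (- 1 / DIM('a))"
  obtains \<Omega>' \<pi> where "\<Omega>' \<subseteq> \<Omega>" "\<Omega>' \<noteq> {}" "2 * card \<Omega>' \<le> card \<Omega>"
    "\<And>v. v \<in> \<Omega> \<Longrightarrow> \<pi> v \<in> \<Omega>'" "\<And>v. v \<in> \<Omega> \<Longrightarrow> measure M (sep v (\<pi> v)) \<le> \<delta> * measure M UNIV"
proof -
  define T where "T = measure M UNIV"
  define N where "N = real (card \<Omega>)"
  have N: "2 \<le> N" using \<Omega> by (simp add: N_def)
  have \<delta>0: "0 \<le> \<delta> * T" using N unfolding \<delta>_def T_def N_def by (intro mult_nonneg_nonneg add_nonneg_nonneg) auto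
  \<comment> \<open>Separation is strict, so that failure of \<open>P (insert v B)\<close> produces
    a point of \<open>B\<close> within the nonstrict bound.\<close>
  define P where "P B \<longleftrightarrow> (\<forall>v\<in>B. \<forall>w\<in>B. v \<noteq> w \<longrightarrow> \<delta> * T < measure M (sep v w))" for B
  have sym: "sep v w = sep w v" for v w :: 'a by (auto simp: sep_def)
  obtain B where B: "B \<subseteq> \<Omega>" "P B" "\<And>a. a \<in> \<Omega> - B \<Longrightarrow> \<not> P (insert a B)"
    using exists_maximal_subset[OF \<Omega>(1), of P] by (auto simp: P_def)
  have ex: "\<exists>w\<in>B. measure M (sep v w) \<le> \<delta> * T" if "v \<in> \<Omega>" for v
  proof (cases "v \<in> B")
    case True
    then show ?thesis using \<delta>0 by (intro bexI[of _ v]) (auto simp: sep_def)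
  next
    case False
    then have "\<not> P (insert v B)" using B(3) that by simp
    show ?thesis
    proof (rule ccontr)
      assume "\<not> ?thesis"
      then have far: "\<delta> * T < measure M (sep v w)" if "w \<in> B" for w using that by (auto simp: not_le)
      have "P (insert v B)" unfolding P_def
      proof (intro ballI impI)
        fix a b assume "a \<in> insert v B" "b \<in> insert v B" "a \<noteq> b"
        then consider "a = v" "b \<in> B" | "b = v" "a \<in> B" | "a \<in> B" "b \<in> B" by blast
        then show "\<delta> * T < measure M (sep a b)"
        proof cases
          case 1 then show ?thesis using far by simp
        next
          case 2 then show ?thesis using far[OF 2(2)] by (simp only: sym[of a v])
        next
          case 3 then show ?thesis using B(2) \<open>a \<noteq> b\<close> by (simp add: P_def)
        qed
      qed
      then show False using \<open>\<not> P (insert v B)\<close> by simp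
    qed
  qed
  have "\<Omega> \<noteq> {}" using \<Omega> by auto
  then have ne: "B \<noteq> {}" using ex by blast
  have "2 * card B \<le> card \<Omega>"
  proof (rule ccontr)
    assume "\<not> ?thesis"
    then have big: "card \<Omega> < 2 * card B" by simp
    have finB: "finite B" using B(1) \<Omega>(1) finite_subset by blast
    have "card B \<le> card \<Omega>" using B(1) \<Omega>(1) by (simp add: card_mono)
    obtain v w where vw: "v \<in> B" "w \<in> B" "v \<noteq> w"
      "measure M (sep v w) \<le> (2 * ln (card B) + 2) * real (card B) powr (- 1 / DIM('a)) * measure M UNIV"
    proof -
      have "2 \<le> card B" using big \<Omega>(2) by linarith
      from exists_close_pair[OF M finB this] show ?thesis using that by blast
    qed
    note vw(4)
    \<comment> \<open>For \<open>card \<Omega> / 2 < card B \<le> card \<Omega>\<close> the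
      logarithm is largest at \<open>card \<Omega>\<close> and the decreasing power at
      \<open>card \<Omega> / 2\<close>; \<delta> combines the two.\<close>
    also have "(2 * ln (card B) + 2) * real (card B) powr (- 1 / DIM('a)) * measure M UNIV \<le> \<delta> * T"
      unfolding \<delta>_def T_def
      using big \<open>card B \<le> card \<Omega>\<close> \<Omega>(2)
      by (intro mult_right_mono mult_mono powr_mono2') auto
    finally have "measure M (sep v w) \<le> \<delta> * T" .
    moreover have "\<delta> * T < measure M (sep v w)" using B(2) vw(1-3) unfolding P_def by blast
    ultimately show False by simp
  qed
  moreover obtain \<pi> where "\<And>v. v \<in> \<Omega> \<Longrightarrow> \<pi> v \<in> B \<and> measure M (sep v (\<pi> v)) \<le> \<delta> * T"
    using ex by metis
  ultimately show ?thesis using that[of B \<pi>] B ne by (auto simp: T_def)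
qed

text \<open>An abstract family \<open>h\<close> whose energies are controlled by a measure isolates
  the two facts about Hilbert transforms on which the chaining rests. \<open>C\<close> is fixed
  before \<open>M\<close>, \<open>h\<close> and \<Omega>, which permits the nets to depend on
  \<open>M\<close>.\<close>

lemma chaining_bound:
  fixes \<epsilon> :: real
  assumes "0 < \<epsilon>"
  shows "\<exists>C>0. \<forall>(M :: ('a::euclidean_space \<times> real) measure) (L :: 'b measure)
      (h :: 'a \<Rightarrow> 'b \<Rightarrow> complex) \<Omega>.
    finite_measure M \<longrightarrow> sets M = sets borel \<longrightarrow> (\<forall>v. h v \<in> borel_measurable L) \<longrightarrow>
    (\<forall>v. L2_energy L (h v) \<le> ennreal (4 * measure M UNIV)) \<longrightarrow>
    (\<forall>v w. L2_energy L (\<lambda>x. h v x - h w x) \<le> ennreal (4 * measure M (sep v w))) \<longrightarrow>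
    finite \<Omega> \<longrightarrow> \<Omega> \<noteq> {} \<longrightarrow>
    (\<integral>\<^sup>+x. ennreal ((Max ((\<lambda>v. norm (h v x)) ` \<Omega>))\<^sup>2) \<partial>L)
      \<le> ennreal ((C * card \<Omega> powr ((real DIM('a) - 1) / (2 * DIM('a)) + \<epsilon>) * sqrt (measure M UNIV))\<^sup>2)"
proof -
  define d where "d = real DIM('a)"
  have d: "1 \<le> d" using DIM_positive[where 'a='a] unfolding d_def by linarith
  define \<kappa> where "\<kappa> = (d - 1) / (2 * d) + \<epsilon>"
  have \<kappa>: "0 < \<kappa>" using d assms by (simp add: \<kappa>_def add_nonneg_pos)
  define K where "K = sqrt (8 * (1 / \<epsilon> + 2))"
  have K: "0 \<le> K" using assms by (simp add: K_def)
  define q where "q = (2::real) powr (- \<kappa>)"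
  have q: "0 < q" "q < 1" using \<kappa> unfolding q_def by (auto simp: powr_less_one)
  \<comment> \<open>With \<open>q\<close> the factor by which \<open>N powr \<kappa>\<close> shrinks
    under halving, the recursion asks for \<open>C * q + K \<le> C\<close>, which
    \<open>K / (1 - q)\<close> solves. The added 2 covers a single point, whose energy is at most
    \<open>(2 * sqrt T)\<^sup>2\<close>.\<close>
  define C where "C = 2 + K / (1 - q)"
  have C: "2 \<le> C" "C * q + K \<le> C"
  proof -
    show "2 \<le> C" using q K by (simp add: C_def)
    have "C * (1 - q) = 2 * (1 - q) + K" using q by (simp add: C_def field_simps)
    then show "C * q + K \<le> C" using q by (simp add: algebra_simps)
  qed
  have "(\<integral>\<^sup>+x. ennreal ((Max ((\<lambda>v. norm (h v x)) ` \<Omega>))\<^sup>2) \<partial>L)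
      \<le> ennreal ((C * card \<Omega> powr \<kappa> * sqrt (measure M UNIV))\<^sup>2)"
    if M: "finite_measure M" "sets M = sets borel" and [measurable]: "\<And>v. h v \<in> borel_measurable L"
      and h1: "\<And>v. L2_energy L (h v) \<le> ennreal (4 * measure M UNIV)"
      and h2: "\<And>v w. L2_energy L (\<lambda>x. h v x - h w x) \<le> ennreal (4 * measure M (sep v w))"
      and \<Omega>: "finite \<Omega>" "\<Omega> \<noteq> {}"
    for M :: "('a \<times> real) measure" and L :: "'b measure" and h :: "'a \<Rightarrow> 'b \<Rightarrow> complex" and \<Omega>
    using \<Omega>
  proof (induction "card \<Omega>" arbitrary: \<Omega> rule: less_induct)
    case less
    define T where "T = measure M UNIV"
    have T: "0 \<le> T" by (simp add: T_def)
    define N where "N = real (card \<Omega>)"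
    show ?case
    proof (cases "card \<Omega> = 1")
      case True
      then obtain v where v: "\<Omega> = {v}" by (auto simp: card_Suc_eq)
      have "(\<integral>\<^sup>+x. ennreal ((Max ((\<lambda>v. norm (h v x)) ` \<Omega>))\<^sup>2) \<partial>L) \<le> ennreal (4 * T)"
        using h1[of v] by (simp add: v T_def)
      also have "4 * T \<le> (C * card \<Omega> powr \<kappa> * sqrt T)\<^sup>2"
      proof -
        have "2\<^sup>2 \<le> C\<^sup>2" using C by (intro power_mono) auto
        then show ?thesis using T True by (simp add: power_mult_distrib mult_right_mono)
      qed
      finally show ?thesis by (simp add: T_def ennreal_leI)
    next
      case False
      moreover have "card \<Omega> \<noteq> 0" using less.prems by simp
      ultimately have c2: "2 \<le> card \<Omega>" by linarith
      then have N: "2 \<le> N" by (simp add: N_def)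
      define \<delta> where "\<delta> = (2 * ln N + 2) * (N / 2) powr (- 1 / d)"
      have \<delta>: "0 \<le> \<delta>" using N by (simp add: \<delta>_def)
      obtain \<Omega>' \<pi> where net: "\<Omega>' \<subseteq> \<Omega>" "\<Omega>' \<noteq> {}" "2 * card \<Omega>' \<le> card \<Omega>"
        "\<And>v. v \<in> \<Omega> \<Longrightarrow> \<pi> v \<in> \<Omega>'" "\<And>v. v \<in> \<Omega> \<Longrightarrow> measure M (sep v (\<pi> v)) \<le> \<delta> * T"
        using halving_net[OF M less.prems(1) c2] unfolding \<delta>_def N_def d_def T_def by metis
      have fin': "finite \<Omega>'" using net(1) less.prems(1) finite_subset by blast
      let ?R = "\<lambda>x. sqrt (\<Sum>v\<in>\<Omega>. (norm (h v x - h (\<pi> v) x))\<^sup>2)"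
      let ?m = "\<lambda>\<Omega> x. Max ((\<lambda>v. norm (h v x)) ` \<Omega>)"
      have mm: "?m A \<in> borel_measurable L" if "finite A" for A
        using that by (intro borel_measurable_Max) auto
      have "(\<integral>\<^sup>+x. ennreal ((?m \<Omega>' x)\<^sup>2) \<partial>L) \<le> ennreal ((C * card \<Omega>' powr \<kappa> * sqrt T)\<^sup>2)"
        unfolding T_def by (rule less.hyps) (use net c2 fin' in auto)
      also have "\<dots> \<le> ennreal ((C * q * N powr \<kappa> * sqrt T)\<^sup>2)"
      proof -
        have "real (card \<Omega>') powr \<kappa> \<le> (N / 2) powr \<kappa>"
          using net(3) \<kappa> unfolding N_def by (intro powr_mono2) auto
        also have "\<dots> = q * N powr \<kappa>"
          using N by (simp add: q_def powr_divide powr_minus field_simps)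
        finally show ?thesis using C T
          by (intro ennreal_leI power_mono mult_right_mono) (auto simp: mult.assoc)
      qed
      finally have 1: "(\<integral>\<^sup>+x. ennreal ((?m \<Omega>' x)\<^sup>2) \<partial>L) \<le> ennreal ((C * q * N powr \<kappa> * sqrt T)\<^sup>2)" .
      have "(\<integral>\<^sup>+x. ennreal ((?R x)\<^sup>2) \<partial>L) = (\<integral>\<^sup>+x. (\<Sum>v\<in>\<Omega>. ennreal ((norm (h v x - h (\<pi> v) x))\<^sup>2)) \<partial>L)"
        by (simp add: sum_nonneg)
      also have "\<dots> = (\<Sum>v\<in>\<Omega>. \<integral>\<^sup>+x. ennreal ((norm (h v x - h (\<pi> v) x))\<^sup>2) \<partial>L)"
        by (rule nn_integral_sum) simp
      also have "\<dots> \<le> (\<Sum>v\<in>\<Omega>. ennreal (4 * (\<delta> * T)))"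
        using net(5) by (intro sum_mono order.trans[OF h2] ennreal_leI) auto
      also have "\<dots> = ennreal (N * (4 * \<delta>) * T)"
        using \<delta> T by (simp add: N_def ennreal_of_nat_eq_real_of_nat ennreal_mult[symmetric] mult.assoc)
      also have "\<dots> \<le> ennreal ((K * N powr \<kappa> * sqrt T)\<^sup>2)"
        using powr_exponent_bound[OF N assms d] T
        unfolding \<delta>_def K_def \<kappa>_def by (intro ennreal_leI) (simp add: power_mult_distrib mult_right_mono)
      finally have 2: "(\<integral>\<^sup>+x. ennreal ((?R x)\<^sup>2) \<partial>L) \<le> ennreal ((K * N powr \<kappa> * sqrt T)\<^sup>2)" .
      have "(\<integral>\<^sup>+x. ennreal ((?m \<Omega> x)\<^sup>2) \<partial>L) \<le> (\<integral>\<^sup>+x. ennreal ((?m \<Omega>' x + ?R x)\<^sup>2) \<partial>L)"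
      proof (intro nn_integral_mono ennreal_leI power_mono)
        fix x
        show "?m \<Omega> x \<le> ?m \<Omega>' x + ?R x"
          by (rule Max_norm_le_chain) (use less.prems net in auto)
        obtain v where "v \<in> \<Omega>" using less.prems by blast
        then have "norm (h v x) \<le> ?m \<Omega> x" using less.prems by (intro Max_ge) auto
        then show "0 \<le> ?m \<Omega> x" by (rule order.trans[OF norm_ge_zero])
      qed
      also have "\<dots> \<le> ennreal ((C * q * N powr \<kappa> * sqrt T + K * N powr \<kappa> * sqrt T)\<^sup>2)"
        by (rule nn_integral_power2_add_le) (use 1 2 mm fin' C q K T in auto)
      also have "\<dots> \<le> ennreal ((C * N powr \<kappa> * sqrt T)\<^sup>2)"
      proof (intro ennreal_leI power_mono)
        have "(C * q + K) * (N powr \<kappa> * sqrt T) \<le> C * (N powr \<kappa> * sqrt T)"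
          using C T by (intro mult_right_mono) auto
        then show "C * q * N powr \<kappa> * sqrt T + K * N powr \<kappa> * sqrt T \<le> C * N powr \<kappa> * sqrt T"
          by (simp add: algebra_simps)
      qed (use C q K T in auto)
      finally show ?thesis by (simp add: N_def T_def)
    qed
  qed
  then show ?thesis
    using C(1) unfolding \<kappa>_def d_def by (intro exI[of _ C]) auto
qed

section \<open>The Cauchy transform on the line\<close>

text \<open>The function \<open>1 / (u + t * \<i>)\<close> of complex analysis at signed height
  \<open>t\<close>. For \<open>t > 0\<close> its imaginary part is \<open>- pi\<close> times the
  Poisson kernel, and its real part tends to the Hilbert kernel \<open>1 / u\<close> as
  \<open>t\<close> tends to 0; this ties the principal value to Poisson extensions.\<close>

definition cauchy_kernel :: "real \<Rightarrow> real \<Rightarrow> complex" where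
  "cauchy_kernel t u = 1 / Complex u t"

lemma norm_cauchy_kernel: "norm (cauchy_kernel t u) = 1 / sqrt (u\<^sup>2 + t\<^sup>2)"
  by (simp add: cauchy_kernel_def norm_divide complex_norm)

lemma norm_cauchy_kernel_power2: "(norm (cauchy_kernel t u))\<^sup>2 = 1 / (u\<^sup>2 + t\<^sup>2)"
  by (simp add: norm_cauchy_kernel power_divide)

lemma norm_cauchy_kernel_le: "t \<noteq> 0 \<Longrightarrow> norm (cauchy_kernel t u) \<le> 1 / \<bar>t\<bar>"
proof -
  assume "t \<noteq> 0"
  moreover have "\<bar>t\<bar> \<le> sqrt (u\<^sup>2 + t\<^sup>2)" using real_sqrt_le_mono[of "t\<^sup>2" "u\<^sup>2 + t\<^sup>2"] by simp
  ultimately show ?thesis unfolding norm_cauchy_kernel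
    by (intro divide_left_mono mult_pos_pos) (auto simp: add_nonneg_pos)
qed

lemma cauchy_kernel_eq:
  "cauchy_kernel t u = Complex (u / (u\<^sup>2 + t\<^sup>2)) (- t / (u\<^sup>2 + t\<^sup>2))"
  unfolding cauchy_kernel_def by (simp add: complex_eq_iff Re_divide Im_divide)

lemma cnj_cauchy_kernel: "cnj (cauchy_kernel t u) = cauchy_kernel (- t) u"
  by (simp add: cauchy_kernel_eq complex_eq_iff)

lemma cauchy_kernel_uminus: "cauchy_kernel (- t) u = - cauchy_kernel t (- u)"
  by (simp add: cauchy_kernel_eq complex_eq_iff)

lemma continuous_on_cauchy_kernel: "t \<noteq> 0 \<Longrightarrow> continuous_on UNIV (cauchy_kernel t)"
  unfolding cauchy_kernel_eq[abs_def] Complex_eq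
  by (intro continuous_intros) (auto simp: add_nonneg_eq_0_iff)

lemma measurable_cauchy_kernel[measurable]: "cauchy_kernel t \<in> borel_measurable borel"
  unfolding cauchy_kernel_eq[abs_def] Complex_eq by measurable

lemma integrable_inverse_1_plus_power2: "integrable lborel (\<lambda>x::real. 1 / (1 + x\<^sup>2))"
  and integral_inverse_1_plus_power2: "(\<integral>x. 1 / (1 + (x::real)\<^sup>2) \<partial>lborel) = pi"
  using integrable_inverse_1_plus_square LBINT_inverse_1_plus_square
  by (simp_all add: set_integrable_def interval_lebesgue_integral_def set_lebesgue_integral_def inverse_eq_divide)

lemma integrable_inverse_power2_plus:
  "t \<noteq> 0 \<Longrightarrow> integrable lborel (\<lambda>x::real. 1 / (x\<^sup>2 + t\<^sup>2))" (is "_ \<Longrightarrow> ?I")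
  and integral_inverse_power2_plus:
  "t \<noteq> 0 \<Longrightarrow> (\<integral>x. 1 / ((x::real)\<^sup>2 + t\<^sup>2) \<partial>lborel) = pi / \<bar>t\<bar>" (is "_ \<Longrightarrow> ?V")
proof -
  assume t: "t \<noteq> 0"
  have eq: "1 / ((t * x)\<^sup>2 + t\<^sup>2) = (1 / t\<^sup>2) * (1 / (1 + x\<^sup>2))" for x :: real
    using t by (simp add: field_simps power_mult_distrib add_nonneg_eq_0_iff)
  have "integrable lborel (\<lambda>x. 1 / ((0 + t * x)\<^sup>2 + t\<^sup>2))"
    unfolding add_0 eq by (intro integrable_mult_right integrable_inverse_1_plus_power2)
  then show ?I using lborel_integrable_real_affine_iff[of t "\<lambda>x. 1 / (x\<^sup>2 + t\<^sup>2)" 0] t by simp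
  have "(\<integral>x. 1 / (x\<^sup>2 + t\<^sup>2) \<partial>lborel) = \<bar>t\<bar> * (\<integral>x. 1 / ((0 + t * x)\<^sup>2 + t\<^sup>2) \<partial>lborel)"
    using lborel_integral_real_affine[of t "\<lambda>x. 1 / (x\<^sup>2 + t\<^sup>2)" 0] t by simp
  also have "\<dots> = \<bar>t\<bar> * ((1 / t\<^sup>2) * pi)"
    unfolding add_0 eq integral_mult_right_zero integral_inverse_1_plus_power2 ..
  also have "\<dots> = pi / \<bar>t\<bar>" using t by (simp add: power2_eq_square abs_if)
  finally show ?V .
qed

lemma integrable_cauchy_kernel_power2:
  "t \<noteq> 0 \<Longrightarrow> integrable lborel (\<lambda>x. (norm (cauchy_kernel t (x - a)))\<^sup>2)"
  and integral_cauchy_kernel_power2: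
  "t \<noteq> 0 \<Longrightarrow> (\<integral>x. (norm (cauchy_kernel t (x - a)))\<^sup>2 \<partial>lborel) = pi / \<bar>t\<bar>"
  unfolding norm_cauchy_kernel_power2
  using lborel_integrable_real_affine_iff[of 1 "\<lambda>x. 1 / (x\<^sup>2 + t\<^sup>2)" "- a"]
    lborel_integral_real_affine[of 1 "\<lambda>x. 1 / (x\<^sup>2 + t\<^sup>2)" "- a"]
  by (simp_all add: integrable_inverse_power2_plus integral_inverse_power2_plus)

text \<open>The inequality \<open>2 * (p * q) \<le> p\<^sup>2 + q\<^sup>2\<close> separates the two
  kernels and gives a bound free of \<open>a\<close> and \<open>b\<close>, as
  \<open>integral_kernel_sesquilinear\<close> requires.\<close>

lemma cauchy_kernel_mult_bound:
  assumes s: "s \<noteq> 0" and t: "t \<noteq> 0"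
  shows cauchy_kernel_mult_integrable:
      "integrable lborel (\<lambda>x. cauchy_kernel s (x - a) * cauchy_kernel t (x - b))"
    and cauchy_kernel_mult_integral_le:
      "(\<integral>x. norm (cauchy_kernel s (x - a) * cauchy_kernel t (x - b)) \<partial>lborel) \<le> pi / \<bar>s\<bar> + pi / \<bar>t\<bar>"
proof -
  let ?D = "\<lambda>x. (norm (cauchy_kernel s (x - a)))\<^sup>2 + (norm (cauchy_kernel t (x - b)))\<^sup>2"
  have D: "integrable lborel ?D"
    by (intro Bochner_Integration.integrable_add integrable_cauchy_kernel_power2 s t)
  have le: "norm (cauchy_kernel s (x - a) * cauchy_kernel t (x - b)) \<le> ?D x" for x
  proof -
    have "2 * (p * q) \<le> p\<^sup>2 + q\<^sup>2" for p q :: real using sum_squares_bound[of p q] by simp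
    then have "2 * (norm (cauchy_kernel s (x - a)) * norm (cauchy_kernel t (x - b))) \<le> ?D x" .
    moreover have "0 \<le> norm (cauchy_kernel s (x - a)) * norm (cauchy_kernel t (x - b))" by simp
    ultimately show ?thesis unfolding norm_mult by linarith
  qed
  show int: "integrable lborel (\<lambda>x. cauchy_kernel s (x - a) * cauchy_kernel t (x - b))"
  proof (rule Bochner_Integration.integrable_bound[OF D])
    show "(\<lambda>x. cauchy_kernel s (x - a) * cauchy_kernel t (x - b)) \<in> borel_measurable lborel" by measurable
    show "AE x in lborel. norm (cauchy_kernel s (x - a) * cauchy_kernel t (x - b)) \<le> norm (?D x)"
      using le abs_ge_self[of "?D _"] unfolding real_norm_def by (intro AE_I2) (rule order.trans)
  qed
  have "(\<integral>x. norm (cauchy_kernel s (x - a) * cauchy_kernel t (x - b)) \<partial>lborel) \<le> (\<integral>x. ?D x \<partial>lborel)"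
    by (rule integral_mono[OF integrable_norm[OF int] D le])
  also have "\<dots> = pi / \<bar>s\<bar> + pi / \<bar>t\<bar>"
    by (simp add: Bochner_Integration.integral_add integrable_cauchy_kernel_power2
        integral_cauchy_kernel_power2 s t)
  finally show "(\<integral>x. norm (cauchy_kernel s (x - a) * cauchy_kernel t (x - b)) \<partial>lborel) \<le> pi / \<bar>s\<bar> + pi / \<bar>t\<bar>" .
qed

lemma has_vector_derivative_Complex:
  assumes "(f has_real_derivative f') (at x)" "(g has_real_derivative g') (at x)"
  shows "((\<lambda>x. Complex (f x) (g x)) has_vector_derivative Complex f' g') (at x)"
proof -
  have "((\<lambda>x. f x *\<^sub>R 1 + g x *\<^sub>R \<i>) has_vector_derivative f' *\<^sub>R 1 + g' *\<^sub>R \<i>) (at x)"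
    using assms
    by (intro has_vector_derivative_add has_vector_derivative_scaleR[THEN has_vector_derivative_eq_rhs])
       (auto intro: has_vector_derivative_const)
  then show ?thesis by (simp add: Complex_eq scaleR_conv_of_real mult.commute)
qed

text \<open>Partial fractions: the product of the two kernels is \<open>1 / (x + (s + t) \<i>)\<close> times the sum of
  two kernels whose primitives combine to a function with limits at both ends.\<close>

lemma integral_cauchy_kernel_convolution:
  assumes s: "s \<noteq> 0" and t: "0 < t" and z: "Complex x (s + t) \<noteq> 0"
  shows "(\<integral>y. cauchy_kernel s y * cauchy_kernel t (x - y) \<partial>lborel)
    = (if 0 < s then - 2 * pi * \<i> else 0) * cauchy_kernel (s + t) x"
proof -
  define G where "G y = cauchy_kernel (s + t) x *
    Complex (ln (y\<^sup>2 + s\<^sup>2) / 2 - ln ((x - y)\<^sup>2 + t\<^sup>2) / 2) (arctan ((x - y) / t) - arctan (y / s))" for y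
  \<comment> \<open>The logarithms in \<open>G\<close> cancel at both ends, so only the limits of
    the two arcus tangents remain, and those of \<open>arctan (y / s)\<close> depend on the sign of
    \<open>s\<close>. For \<open>s < 0\<close> they cancel as well: both poles of the integrand then
    lie in the upper half-plane.\<close>
  define \<sigma> where "\<sigma> = (if 0 < s then 1 else -1 :: real)"
  have pos: "0 < y\<^sup>2 + s\<^sup>2" "0 < (x - y)\<^sup>2 + t\<^sup>2" for y
    using s t by (auto intro: add_nonneg_pos)
  have deriv: "(G has_vector_derivative cauchy_kernel s y * cauchy_kernel t (x - y)) (at y)" for y
  proof -
    have "((\<lambda>y. ln (y\<^sup>2 + s\<^sup>2)) has_real_derivative 2 * y / (y\<^sup>2 + s\<^sup>2)) (at y)"
      using pos(1)[of y] by (auto intro!: derivative_eq_intros)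
    moreover have "((\<lambda>y. ln ((x - y)\<^sup>2 + t\<^sup>2)) has_real_derivative - (2 * (x - y)) / ((x - y)\<^sup>2 + t\<^sup>2)) (at y)"
      using pos(2)[of y] by (auto intro!: derivative_eq_intros)
    ultimately have "((\<lambda>y. ln (y\<^sup>2 + s\<^sup>2) / 2 - ln ((x - y)\<^sup>2 + t\<^sup>2) / 2) has_real_derivative
        2 * y / (y\<^sup>2 + s\<^sup>2) / 2 - - (2 * (x - y)) / ((x - y)\<^sup>2 + t\<^sup>2) / 2) (at y)"
      by (intro DERIV_diff DERIV_cdivide)
    then have "((\<lambda>y. ln (y\<^sup>2 + s\<^sup>2) / 2 - ln ((x - y)\<^sup>2 + t\<^sup>2) / 2) has_real_derivative
        y / (y\<^sup>2 + s\<^sup>2) + (x - y) / ((x - y)\<^sup>2 + t\<^sup>2)) (at y)"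
    proof (rule DERIV_cong)
      have "2 * a / b / 2 - - (2 * c) / d / 2 = a / b + c / d" for a b c d :: real by simp
      then show "2 * y / (y\<^sup>2 + s\<^sup>2) / 2 - - (2 * (x - y)) / ((x - y)\<^sup>2 + t\<^sup>2) / 2
        = y / (y\<^sup>2 + s\<^sup>2) + (x - y) / ((x - y)\<^sup>2 + t\<^sup>2)" .
    qed
    moreover have "((\<lambda>y. arctan ((x - y) / t) - arctan (y / s)) has_real_derivative
        - t / ((x - y)\<^sup>2 + t\<^sup>2) - s / (y\<^sup>2 + s\<^sup>2)) (at y)"
    proof -
      have "((\<lambda>y. x - y) has_real_derivative -1) (at y)" "((\<lambda>y. y) has_real_derivative 1) (at y)"
        by (auto intro!: derivative_eq_intros)
      from DERIV_diff[OF DERIV_chain2[OF DERIV_arctan DERIV_cdivide[OF this(1), of t]]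
          DERIV_chain2[OF DERIV_arctan DERIV_cdivide[OF this(2), of s]]]
      have "((\<lambda>y. arctan ((x - y) / t) - arctan (y / s)) has_real_derivative
        inverse (1 + ((x - y) / t)\<^sup>2) * (-1 / t) - inverse (1 + (y / s)\<^sup>2) * (1 / s)) (at y)" .
      moreover have "inverse (1 + (w / r)\<^sup>2) * (1 / r) = r / (w\<^sup>2 + r\<^sup>2)" if "r \<noteq> 0" for w r :: real
      proof -
        have "1 + (w / r)\<^sup>2 = (w\<^sup>2 + r\<^sup>2) / r\<^sup>2" using that by (simp add: power_divide add_divide_distrib)
        then show ?thesis using that by (simp add: power2_eq_square)
      qed
      ultimately show ?thesis using s t by simp
    qed
    ultimately have D: "((\<lambda>y. Complex (ln (y\<^sup>2 + s\<^sup>2) / 2 - ln ((x - y)\<^sup>2 + t\<^sup>2) / 2) (arctan ((x - y) / t) - arctan (y / s)))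
        has_vector_derivative Complex (y / (y\<^sup>2 + s\<^sup>2) + (x - y) / ((x - y)\<^sup>2 + t\<^sup>2))
          (- t / ((x - y)\<^sup>2 + t\<^sup>2) - s / (y\<^sup>2 + s\<^sup>2))) (at y)"
      by (rule has_vector_derivative_Complex)
    have E1: "Complex (y / (y\<^sup>2 + s\<^sup>2) + (x - y) / ((x - y)\<^sup>2 + t\<^sup>2))
          (- t / ((x - y)\<^sup>2 + t\<^sup>2) - s / (y\<^sup>2 + s\<^sup>2)) = cauchy_kernel s y + cauchy_kernel t (x - y)"
      by (simp add: cauchy_kernel_eq complex_eq_iff)
    have E2: "cauchy_kernel s y * cauchy_kernel t (x - y)
        = cauchy_kernel (s + t) x * (cauchy_kernel s y + cauchy_kernel t (x - y))"
    proof -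
      have "Complex y s + Complex (x - y) t = Complex x (s + t)" by (simp add: complex_eq_iff)
      moreover have "Complex y s \<noteq> 0" "Complex (x - y) t \<noteq> 0" using s t by (auto simp: complex_eq_iff)
      ultimately show ?thesis using z unfolding cauchy_kernel_def
        by (simp add: divide_simps) (simp add: add.commute)
    qed
    show ?thesis unfolding G_def E2 E1[symmetric] by (rule has_vector_derivative_mult_right[OF D])
  qed
  have cont: "isCont (\<lambda>y. cauchy_kernel s y * cauchy_kernel t (x - y)) y" for y
  proof -
    have "continuous_on UNIV (\<lambda>y. cauchy_kernel s y * cauchy_kernel t (x - y))"
      using continuous_on_cauchy_kernel[OF s] continuous_on_cauchy_kernel[of t] t
      by (intro continuous_on_mult continuous_on_compose2[of UNIV "cauchy_kernel t" UNIV "\<lambda>y. x - y"] continuous_intros) auto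
    then show ?thesis by (simp add: continuous_on_eq_continuous_at)
  qed
  have int: "integrable lborel (\<lambda>y. cauchy_kernel s y * cauchy_kernel t (x - y))"
  proof -
    have "integrable lborel (\<lambda>y. cauchy_kernel s (y - 0) * (- cauchy_kernel (- t) (y - x)))"
      using cauchy_kernel_mult_integrable[of s "- t" 0 x] s t by simp
    then show ?thesis by (simp add: cauchy_kernel_uminus)
  qed
  have lim_Complex: "((\<lambda>y. cauchy_kernel (s + t) x * Complex (f y) (g y)) \<longlongrightarrow> cauchy_kernel (s + t) x * Complex a b) F"
    if "(f \<longlongrightarrow> a) F" "(g \<longlongrightarrow> b) F" for f g a b and F :: "real filter"
    by (intro tendsto_mult tendsto_const tendsto_Complex that)
  have at_top: "(G \<longlongrightarrow> cauchy_kernel (s + t) x * Complex 0 (- pi / 2 - \<sigma> * pi / 2)) at_top"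
    unfolding G_def
  proof (rule lim_Complex)
    show "((\<lambda>y. ln (y\<^sup>2 + s\<^sup>2) / 2 - ln ((x - y)\<^sup>2 + t\<^sup>2) / 2) \<longlongrightarrow> 0) at_top"
      by real_asymp
    show "((\<lambda>y. arctan ((x - y) / t) - arctan (y / s)) \<longlongrightarrow> - pi / 2 - \<sigma> * pi / 2) at_top"
    proof (cases "0 < s")
      case True
      then show ?thesis using t unfolding \<sigma>_def by real_asymp
    next
      case False
      then have "s < 0" using s by simp
      then show ?thesis using t unfolding \<sigma>_def by real_asymp
    qed
  qed
  have at_bot: "(G \<longlongrightarrow> cauchy_kernel (s + t) x * Complex 0 (pi / 2 + \<sigma> * pi / 2)) at_bot"
    unfolding G_def
  proof (rule lim_Complex)
    show "((\<lambda>y. ln (y\<^sup>2 + s\<^sup>2) / 2 - ln ((x - y)\<^sup>2 + t\<^sup>2) / 2) \<longlongrightarrow> 0) at_bot"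
      by real_asymp
    show "((\<lambda>y. arctan ((x - y) / t) - arctan (y / s)) \<longlongrightarrow> pi / 2 + \<sigma> * pi / 2) at_bot"
    proof (cases "0 < s")
      case True
      then show ?thesis using t unfolding \<sigma>_def by real_asymp
    next
      case False
      then have "s < 0" using s by simp
      then show ?thesis using t unfolding \<sigma>_def by real_asymp
    qed
  qed
  have "(\<integral>y. cauchy_kernel s y * cauchy_kernel t (x - y) \<partial>lborel)
      = (LBINT y=-\<infinity>..\<infinity>. cauchy_kernel s y * cauchy_kernel t (x - y))"
    by (simp add: interval_lebesgue_integral_def set_lebesgue_integral_def)
  also have "(LBINT y=-\<infinity>..\<infinity>. cauchy_kernel s y * cauchy_kernel t (x - y))
      = cauchy_kernel (s + t) x * Complex 0 (- pi / 2 - \<sigma> * pi / 2)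
        - cauchy_kernel (s + t) x * Complex 0 (pi / 2 + \<sigma> * pi / 2)"
  proof (rule interval_integral_FTC_integrable)
    show "set_integrable lborel (einterval (- \<infinity>) \<infinity>) (\<lambda>y. cauchy_kernel s y * cauchy_kernel t (x - y))"
      using int by (simp add: set_integrable_def)
    show "((G \<circ> real_of_ereal) \<longlongrightarrow> cauchy_kernel (s + t) x * Complex 0 (pi / 2 + \<sigma> * pi / 2)) (at_right (- \<infinity>))"
      using at_bot by (simp add: ereal_tendsto_simps)
    show "((G \<circ> real_of_ereal) \<longlongrightarrow> cauchy_kernel (s + t) x * Complex 0 (- pi / 2 - \<sigma> * pi / 2)) (at_left \<infinity>)"
      using at_top by (simp add: ereal_tendsto_simps)
  qed (simp_all only: deriv cont, simp)
  finally have "(\<integral>y. cauchy_kernel s y * cauchy_kernel t (x - y) \<partial>lborel)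
      = cauchy_kernel (s + t) x *
        (Complex 0 (- pi / 2 - \<sigma> * pi / 2) - Complex 0 (pi / 2 + \<sigma> * pi / 2))"
    by (simp only: right_diff_distrib)
  also have "Complex 0 (- pi / 2 - \<sigma> * pi / 2) - Complex 0 (pi / 2 + \<sigma> * pi / 2)
      = (if 0 < s then - 2 * pi * \<i> else 0)"
    by (auto simp: \<sigma>_def complex_eq_iff)
  finally show ?thesis by (simp only: mult.commute)
qed

text \<open>Jensen's inequality for a kernel of mass at most one, in the form of Cauchy-Schwarz with
  \<open>k\<close> split into two square roots, followed by Tonelli's theorem.\<close>

lemma nn_integral_convolution_power2_le:
  fixes k :: "real \<Rightarrow> real" and h :: "real \<Rightarrow> complex"
  assumes k[measurable]: "k \<in> borel_measurable borel" and k0: "\<And>x. 0 \<le> k x"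
    and k1: "(\<integral>\<^sup>+x. ennreal (k x) \<partial>lborel) \<le> 1"
    and h[measurable]: "h \<in> borel_measurable borel"
  shows "L2_energy lborel (\<lambda>x. \<integral>y. of_real (k (x - y)) * h y \<partial>lborel)
    \<le> L2_energy lborel h"
proof -
  have pt: "ennreal ((norm (\<integral>y. of_real (k (x - y)) * h y \<partial>lborel))\<^sup>2)
      \<le> (\<integral>\<^sup>+y. ennreal (k (x - y)) * ennreal ((norm (h y))\<^sup>2) \<partial>lborel)" for x
  proof (cases "integrable lborel (\<lambda>y. of_real (k (x - y)) * h y)")
    case True
    have "ennreal ((norm (\<integral>y. of_real (k (x - y)) * h y \<partial>lborel))\<^sup>2)
        = (ennreal (norm (\<integral>y. of_real (k (x - y)) * h y \<partial>lborel)))\<^sup>2"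
      by (simp add: ennreal_power)
    also have "\<dots> \<le> (\<integral>\<^sup>+y. ennreal (norm (of_real (k (x - y)) * h y)) \<partial>lborel)\<^sup>2"
      by (intro power_mono integral_norm_bound_ennreal True) simp
    also have "\<dots> = (\<integral>\<^sup>+y. ennreal (sqrt (k (x - y))) * ennreal (sqrt (k (x - y)) * norm (h y)) \<partial>lborel)\<^sup>2"
      using k0 by (simp add: norm_mult ennreal_mult[symmetric] mult.assoc[symmetric])
    also have "\<dots> \<le> (\<integral>\<^sup>+y. (ennreal (sqrt (k (x - y))))\<^sup>2 \<partial>lborel)
        * (\<integral>\<^sup>+y. (ennreal (sqrt (k (x - y)) * norm (h y)))\<^sup>2 \<partial>lborel)"
      by (rule Cauchy_Schwarz_nn_integral) measurable
    also have "(\<integral>\<^sup>+y. (ennreal (sqrt (k (x - y))))\<^sup>2 \<partial>lborel) = (\<integral>\<^sup>+y. ennreal (k (x - y)) \<partial>lborel)"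
      using k0 by (simp add: ennreal_power)
    also have "\<dots> = (\<integral>\<^sup>+y. ennreal (k y) \<partial>lborel)" by (rule nn_integral_real_reflect) measurable
    also have "(\<integral>\<^sup>+y. (ennreal (sqrt (k (x - y)) * norm (h y)))\<^sup>2 \<partial>lborel)
        = (\<integral>\<^sup>+y. ennreal (k (x - y)) * ennreal ((norm (h y))\<^sup>2) \<partial>lborel)"
      using k0 by (simp add: ennreal_power power_mult_distrib ennreal_mult)
    also have "(\<integral>\<^sup>+y. ennreal (k y) \<partial>lborel)
        * (\<integral>\<^sup>+y. ennreal (k (x - y)) * ennreal ((norm (h y))\<^sup>2) \<partial>lborel)
        \<le> 1 * (\<integral>\<^sup>+y. ennreal (k (x - y)) * ennreal ((norm (h y))\<^sup>2) \<partial>lborel)"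
      using k1 by (rule mult_right_mono) simp
    finally show ?thesis by simp
  \<comment> \<open>Where the integral does not exist, its default value 0 satisfies the
    bound.\<close>
  qed (simp add: not_integrable_integral_eq)
  have "L2_energy lborel (\<lambda>x. \<integral>y. of_real (k (x - y)) * h y \<partial>lborel)
      \<le> (\<integral>\<^sup>+x. (\<integral>\<^sup>+y. ennreal (k (x - y)) * ennreal ((norm (h y))\<^sup>2) \<partial>lborel) \<partial>lborel)"
    by (intro nn_integral_mono pt)
  also have "\<dots> = (\<integral>\<^sup>+y. (\<integral>\<^sup>+x. ennreal (k (x - y)) * ennreal ((norm (h y))\<^sup>2) \<partial>lborel) \<partial>lborel)"
    by (rule lborel_pair.Fubini') measurable
  also have "\<dots> = (\<integral>\<^sup>+y. (\<integral>\<^sup>+x. ennreal (k x) \<partial>lborel) * ennreal ((norm (h y))\<^sup>2) \<partial>lborel)"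
    using nn_integral_lborel_translate[of "\<lambda>x. ennreal (k x)" "- _"] by (simp add: nn_integral_multc)
  also have "\<dots> \<le> (\<integral>\<^sup>+y. 1 * ennreal ((norm (h y))\<^sup>2) \<partial>lborel)"
    using k1 by (intro nn_integral_mono mult_right_mono) auto
  finally show ?thesis by simp
qed

section \<open>The Poisson kernel\<close>

definition poisson_kernel :: "real \<Rightarrow> real \<Rightarrow> real" where
  "poisson_kernel s u = s / (pi * (u\<^sup>2 + s\<^sup>2))"

lemma measurable_poisson_kernel[measurable]: "poisson_kernel s \<in> borel_measurable borel"
  unfolding poisson_kernel_def by measurable

lemma poisson_kernel_nonneg: "0 < s \<Longrightarrow> 0 \<le> poisson_kernel s u"
  by (simp add: poisson_kernel_def)

lemma poisson_kernel_alt: "poisson_kernel s u = (s / pi) * (1 / (u\<^sup>2 + s\<^sup>2))"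
  by (simp add: poisson_kernel_def)

lemma integrable_poisson_kernel: "0 < s \<Longrightarrow> integrable lborel (poisson_kernel s)"
  unfolding poisson_kernel_alt[abs_def] by (intro integrable_mult_right integrable_inverse_power2_plus) simp

lemma integral_poisson_kernel: "0 < s \<Longrightarrow> (\<integral>x. poisson_kernel s x \<partial>lborel) = 1"
  unfolding poisson_kernel_alt[abs_def] integral_mult_right_zero
  by (subst integral_inverse_power2_plus) auto

lemma nn_integral_poisson_kernel: "0 < s \<Longrightarrow> (\<integral>\<^sup>+x. ennreal (poisson_kernel s x) \<partial>lborel) = 1"
  by (subst nn_integral_eq_integral)
     (auto simp: integrable_poisson_kernel integral_poisson_kernel poisson_kernel_nonneg)

lemma poisson_kernel_eq_cauchy_kernel:
  "of_real (poisson_kernel s u) = (cauchy_kernel (- s) u - cauchy_kernel s u) / (2 * pi * \<i>)"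
proof -
  have "cauchy_kernel (- s) u - cauchy_kernel s u = Complex 0 (2 * (s / (u\<^sup>2 + s\<^sup>2)))"
    by (simp add: cauchy_kernel_eq complex_eq_iff)
  also have "\<dots> = of_real (poisson_kernel s u) * (2 * pi * \<i>)"
    by (simp add: complex_eq_iff poisson_kernel_def)
  finally show ?thesis by simp
qed

text \<open>The Poisson kernel is a difference of Cauchy kernels at heights \<open>- s\<close> and
  \<open>s\<close>. Against a kernel of height \<open>t > 0\<close> the first integrates to 0 and
  the second to a multiple of the kernel at the sum of heights. The condition on \<open>x\<close>
  keeps the denominator \<open>x + (t - s) * \<i>\<close> nonzero also for
  \<open>s = t\<close>.\<close>

lemma integral_poisson_kernel_cauchy_kernel:
  assumes s: "0 < s" and t: "0 < t" and x: "x \<noteq> 0"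
  shows "(\<integral>y. of_real (poisson_kernel s y) * cauchy_kernel t (x - y) \<partial>lborel) = cauchy_kernel (s + t) x"
proof -
  have int: "integrable lborel (\<lambda>y. cauchy_kernel r y * cauchy_kernel t (x - y))" if "r \<noteq> 0" for r
  proof -
    have "integrable lborel (\<lambda>y. - (cauchy_kernel r (y - 0) * cauchy_kernel (- t) (y - x)))"
      using cauchy_kernel_mult_integrable[of r "- t" 0 x] that t by (intro integrable_minus) auto
    then show ?thesis by (simp add: cauchy_kernel_uminus)
  qed
  have 1: "(\<integral>y. cauchy_kernel (- s) y * cauchy_kernel t (x - y) \<partial>lborel) = 0"
    using integral_cauchy_kernel_convolution[of "- s" t x] s t x by (simp add: complex_eq_iff)
  have 2: "(\<integral>y. cauchy_kernel s y * cauchy_kernel t (x - y) \<partial>lborel) = - 2 * pi * \<i> * cauchy_kernel (s + t) x"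
    using integral_cauchy_kernel_convolution[of s t x] s t x by (simp add: complex_eq_iff)
  have "(\<integral>y. of_real (poisson_kernel s y) * cauchy_kernel t (x - y) \<partial>lborel)
      = (\<integral>y. (cauchy_kernel (- s) y * cauchy_kernel t (x - y) - cauchy_kernel s y * cauchy_kernel t (x - y))
          / (2 * pi * \<i>) \<partial>lborel)"
    unfolding poisson_kernel_eq_cauchy_kernel by (simp add: left_diff_distrib)
  also have "\<dots> = ((\<integral>y. cauchy_kernel (- s) y * cauchy_kernel t (x - y) \<partial>lborel)
      - (\<integral>y. cauchy_kernel s y * cauchy_kernel t (x - y) \<partial>lborel)) / (2 * pi * \<i>)"
    using int[of s] int[of "- s"] s by (simp add: Bochner_Integration.integral_diff)
  also have "\<dots> = cauchy_kernel (s + t) x" unfolding 1 2 by simp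
  finally show ?thesis .
qed

section \<open>Cauchy transforms and their energy\<close>

definition cauchy_transform :: "(real \<Rightarrow> complex) \<Rightarrow> real \<Rightarrow> real \<Rightarrow> complex" where
  "cauchy_transform g t x = (\<integral>a. g a * cauchy_kernel t (x - a) \<partial>lborel)"

lemma measurable_cauchy_transform[measurable]:
  assumes [measurable]: "g \<in> borel_measurable borel"
  shows "cauchy_transform g t \<in> borel_measurable borel"
  unfolding cauchy_transform_def by measurable

context
  fixes g :: "real \<Rightarrow> complex"
  assumes g_int: "integrable lborel g"
begin

lemma g_borel[measurable]: "g \<in> borel_measurable borel"
  using borel_measurable_integrable[OF g_int] by simp

text \<open>Fubini's theorem reduces the semigroup law to the identity for kernels, which is
  available except at the null set \<open>a = x\<close>.\<close>

lemma poisson_cauchy_transform: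
  assumes s: "0 < s" and t: "0 < t"
  shows "(\<integral>y. of_real (poisson_kernel s (x - y)) * cauchy_transform g t y \<partial>lborel) = cauchy_transform g (s + t) x"
proof -
  have p: "integrable lborel (\<lambda>y. of_real (poisson_kernel s (x - y)) :: complex)"
    using integrable_poisson_kernel[OF s] integrable_real_reflect[of "poisson_kernel s" x] by simp
  have "integrable (lborel \<Otimes>\<^sub>M lborel) (\<lambda>(y, a). of_real (poisson_kernel s (x - y)) * g a)"
    by (rule integrable_lborel_product[OF p g_int])
  then have "integrable (lborel \<Otimes>\<^sub>M lborel)
      (\<lambda>q. (case q of (y, a) \<Rightarrow> of_real (poisson_kernel s (x - y)) * g a) * cauchy_kernel t (fst q - snd q))"
    by (rule integrable_mult_bounded[of _ _ _ "1 / \<bar>t\<bar>"]) (use t norm_cauchy_kernel_le[of t] in auto)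
  then have int: "integrable (lborel \<Otimes>\<^sub>M lborel)
      (\<lambda>(y, a). of_real (poisson_kernel s (x - y)) * (g a * cauchy_kernel t (y - a)))"
    by (simp add: case_prod_beta' mult.assoc)
  have "(\<integral>y. of_real (poisson_kernel s (x - y)) * cauchy_transform g t y \<partial>lborel)
      = (\<integral>y. (\<integral>a. of_real (poisson_kernel s (x - y)) * (g a * cauchy_kernel t (y - a)) \<partial>lborel) \<partial>lborel)"
    unfolding cauchy_transform_def by simp
  also have "\<dots> = (\<integral>a. (\<integral>y. of_real (poisson_kernel s (x - y)) * (g a * cauchy_kernel t (y - a)) \<partial>lborel) \<partial>lborel)"
    using lborel_pair.Fubini_integral[OF int] by simp
  also have "\<dots> = (\<integral>a. g a * cauchy_kernel (s + t) (x - a) \<partial>lborel)"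
  proof (rule integral_cong_AE)
    show "AE a in lborel. (\<integral>y. of_real (poisson_kernel s (x - y)) * (g a * cauchy_kernel t (y - a)) \<partial>lborel)
        = g a * cauchy_kernel (s + t) (x - a)"
      using AE_lborel_singleton[of x]
    proof eventually_elim
      case (elim a)
      have "(\<integral>y. of_real (poisson_kernel s (x - y)) * (g a * cauchy_kernel t (y - a)) \<partial>lborel)
          = g a * (\<integral>y. of_real (poisson_kernel s (x - y)) * cauchy_kernel t (y - a) \<partial>lborel)"
        by (simp add: mult.left_commute)
      also have "(\<integral>y. of_real (poisson_kernel s (x - y)) * cauchy_kernel t (y - a) \<partial>lborel)
          = (\<integral>y. of_real (poisson_kernel s y) * cauchy_kernel t ((x - a) - y) \<partial>lborel)"
        using integral_real_reflect[of "\<lambda>y. of_real (poisson_kernel s y) * cauchy_kernel t ((x - a) - y)" x]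
        by (simp add: algebra_simps)
      also have "\<dots> = cauchy_kernel (s + t) (x - a)"
        by (rule integral_poisson_kernel_cauchy_kernel[OF s t]) (use elim in simp)
      finally show ?case .
    qed
  qed measurable
  finally show ?thesis by (simp add: cauchy_transform_def)
qed

text \<open>Inner products of transforms at heights \<open>t\<close> and \<open>s\<close> depend on
  \<open>t + s\<close> only, so this function of one variable records all of them.\<close>

definition cauchy_form :: "real \<Rightarrow> complex" where
  "cauchy_form r = (\<integral>p. g (fst p) * cnj (g (snd p)) * cauchy_kernel r (snd p - fst p) \<partial>lborel)"

lemma inner_cauchy_kernel:
  assumes s: "0 < s" and t: "0 < t"
  shows "(\<integral>x. cauchy_kernel t (x - a) * cnj (cauchy_kernel s (x - b)) \<partial>lborel)
    = 2 * pi * \<i> * cauchy_kernel (t + s) (b - a)"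
proof -
  have "(\<integral>x. cauchy_kernel t (x - a) * cnj (cauchy_kernel s (x - b)) \<partial>lborel)
      = (\<integral>x. - (cauchy_kernel t (x - a) * cauchy_kernel s ((b - a) - (x - a))) \<partial>lborel)"
    unfolding cnj_cauchy_kernel by (simp add: cauchy_kernel_uminus)
  also have "\<dots> = - (\<integral>x. cauchy_kernel t x * cauchy_kernel s ((b - a) - x) \<partial>lborel)"
    using lborel_integral_translate[of "\<lambda>x. cauchy_kernel t x * cauchy_kernel s ((b - a) - x)" "- a"] by simp
  also have "\<dots> = 2 * pi * \<i> * cauchy_kernel (t + s) (b - a)"
    using integral_cauchy_kernel_convolution[of t s "b - a"] s t by (simp add: complex_eq_iff)
  finally show ?thesis .
qed

lemma inner_cauchy_transform:
  assumes s: "0 < s" and t: "0 < t"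
  shows "integrable lborel (\<lambda>x. cauchy_transform g t x * cnj (cauchy_transform g s x))"
    "(\<integral>x. cauchy_transform g t x * cnj (cauchy_transform g s x) \<partial>lborel) = 2 * pi * \<i> * cauchy_form (t + s)"
    "integrable lborel (\<lambda>p. g (fst p) * cnj (g (snd p)) * cauchy_kernel (t + s) (snd p - fst p))"
proof -
  define B where "B = max (1 / \<bar>t\<bar>) (1 / \<bar>s\<bar>)"
  have m: "(\<lambda>(a, x). cauchy_kernel t (x - a)) \<in> borel_measurable (borel \<Otimes>\<^sub>M borel)" for t
    by measurable
  have b: "norm (cauchy_kernel t (x - a)) \<le> B" "norm (cauchy_kernel s (x - a)) \<le> B" for a x
    using norm_cauchy_kernel_le[of t "x - a"] norm_cauchy_kernel_le[of s "x - a"] s t unfolding B_def by linarith+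
  have i: "integrable lborel (\<lambda>x. cauchy_kernel t (x - a) * cnj (cauchy_kernel s (x - b)))" for a b
    unfolding cnj_cauchy_kernel using s t by (intro cauchy_kernel_mult_integrable) auto
  have l: "(\<integral>x. norm (cauchy_kernel t (x - a) * cnj (cauchy_kernel s (x - b))) \<partial>lborel) \<le> pi / \<bar>t\<bar> + pi / \<bar>- s\<bar>" for a b
    unfolding cnj_cauchy_kernel using s t by (intro cauchy_kernel_mult_integral_le) auto
  note K = integral_kernel_sesquilinear[OF g_int m m b i l, unfolded inner_cauchy_kernel[OF s t]]
  show "integrable lborel (\<lambda>x. cauchy_transform g t x * cnj (cauchy_transform g s x))"
    unfolding cauchy_transform_def by (rule K(1))
  have eq: "g (fst p) * cnj (g (snd p)) * (2 * pi * \<i> * cauchy_kernel (t + s) (snd p - fst p))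
      = 2 * pi * \<i> * (g (fst p) * cnj (g (snd p)) * cauchy_kernel (t + s) (snd p - fst p))" for p
    by (simp add: mult_ac)
  show "(\<integral>x. cauchy_transform g t x * cnj (cauchy_transform g s x) \<partial>lborel) = 2 * pi * \<i> * cauchy_form (t + s)"
    unfolding cauchy_transform_def K(2) cauchy_form_def eq by (simp only: integral_mult_right_zero)
  have "integrable lborel (\<lambda>p. 1 / (2 * pi * \<i>) * (2 * pi * \<i> * (g (fst p) * cnj (g (snd p)) * cauchy_kernel (t + s) (snd p - fst p))))"
    using K(3) unfolding eq by (rule integrable_mult_right)
  then show "integrable lborel (\<lambda>p. g (fst p) * cnj (g (snd p)) * cauchy_kernel (t + s) (snd p - fst p))"
    by simp
qed

lemma cauchy_form_eq:
  assumes r: "0 < r"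
  shows "cauchy_form r = (\<integral>b. cnj (g b) * cauchy_transform g r b \<partial>lborel)"
proof -
  have "integrable lborel (\<lambda>p. g (fst p) * cnj (g (snd p)) * cauchy_kernel r (snd p - fst p))"
    using inner_cauchy_transform(3)[of "r / 2" "r / 2"] r by simp
  then have "integrable (lborel \<Otimes>\<^sub>M lborel) (\<lambda>(a, b). g a * cnj (g b) * cauchy_kernel r (b - a))"
    by (simp only: lborel_prod case_prod_beta')
  from lborel_pair.integral_snd[OF this]
  have "cauchy_form r = (\<integral>b. (\<integral>a. g a * cnj (g b) * cauchy_kernel r (b - a) \<partial>lborel) \<partial>lborel)"
    by (simp only: cauchy_form_def lborel_prod case_prod_beta')
  also have "\<dots> = (\<integral>b. cnj (g b) * cauchy_transform g r b \<partial>lborel)"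
    unfolding cauchy_transform_def
    by (simp add: mult_ac flip: integral_mult_right_zero)
  finally show ?thesis .
qed

text \<open>Indexed by sums of heights: at \<open>r = 2 * t\<close> it is the squared norm of the
  transform at height \<open>t\<close>, at \<open>r = t + s\<close> the real part of a mixed inner
  product.\<close>

definition cauchy_energy :: "real \<Rightarrow> real" where
  "cauchy_energy r = Re (2 * pi * \<i> * cauchy_form r)"

lemma cauchy_transform_norm_diff:
  assumes s: "0 < s" and t: "0 < t"
  shows "L2_energy lborel (\<lambda>x. cauchy_transform g t x - cauchy_transform g s x)
    = ennreal (cauchy_energy (2 * t) + cauchy_energy (2 * s) - 2 * cauchy_energy (t + s))"
proof -
  let ?c = "cauchy_transform g"
  have eq: "(norm (?c t x - ?c s x))\<^sup>2
      = Re (?c t x * cnj (?c t x)) + Re (?c s x * cnj (?c s x)) - 2 * Re (?c t x * cnj (?c s x))" for x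
    by (simp only: cmod_power2) (simp add: power2_eq_square algebra_simps)
  note I = inner_cauchy_transform(1)[THEN integrable_Re] 
  have V: "(\<integral>x. Re (?c t x * cnj (?c s x)) \<partial>lborel) = cauchy_energy (t + s)" if "0 < s" "0 < t" for s t
    using inner_cauchy_transform(1,2)[OF that] unfolding cauchy_energy_def
    by (subst integral_Re) (simp_all only:)
  have "L2_energy lborel (\<lambda>x. ?c t x - ?c s x)
      = ennreal (\<integral>x. (norm (?c t x - ?c s x))\<^sup>2 \<partial>lborel)"
    unfolding eq
    by (rule nn_integral_eq_integral)
       (intro Bochner_Integration.integrable_add Bochner_Integration.integrable_diff integrable_mult_right I s t,
        simp only: eq[symmetric] zero_le_power2 AE_I2)
  also have "(\<integral>x. (norm (?c t x - ?c s x))\<^sup>2 \<partial>lborel)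
      = cauchy_energy (2 * t) + cauchy_energy (2 * s) - 2 * cauchy_energy (t + s)"
    unfolding eq
    using V[OF s t] V[OF s s] V[OF t t] I[OF s t] I[OF s s] I[OF t t]
    by (simp only: Bochner_Integration.integral_diff Bochner_Integration.integral_add
        Bochner_Integration.integrable_add integrable_mult_right integral_mult_right_zero mult_2)
  finally show ?thesis .
qed

lemma cauchy_transform_norm:
  assumes t: "0 < t"
  shows "L2_energy lborel (cauchy_transform g t) = ennreal (cauchy_energy (2 * t))"
    "0 \<le> cauchy_energy (2 * t)"
proof -
  let ?c = "cauchy_transform g"
  have eq: "(norm (?c t x))\<^sup>2 = Re (?c t x * cnj (?c t x))" for x
    by (simp only: cmod_power2) (simp add: power2_eq_square)
  note I = inner_cauchy_transform(1)[OF t t, THEN integrable_Re]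
  have V: "(\<integral>x. Re (?c t x * cnj (?c t x)) \<partial>lborel) = cauchy_energy (2 * t)"
    using inner_cauchy_transform(1,2)[OF t t] unfolding cauchy_energy_def
    by (subst integral_Re) (simp_all only: mult_2)
  show "L2_energy lborel (?c t) = ennreal (cauchy_energy (2 * t))"
    unfolding eq V[symmetric]
    by (rule nn_integral_eq_integral[OF I]) (simp only: eq[symmetric] zero_le_power2 AE_I2)
  show "0 \<le> cauchy_energy (2 * t)"
    unfolding V[symmetric] by (rule Bochner_Integration.integral_nonneg) (simp only: eq[symmetric] zero_le_power2)
qed

lemma cauchy_energy_nonneg: "0 < r \<Longrightarrow> 0 \<le> cauchy_energy r"
  using cauchy_transform_norm(2)[of "r / 2"] by simp

text \<open>Raising the height is convolution with a Poisson kernel, a contraction of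
  \<open>L2\<close>.\<close>

lemma cauchy_energy_antimono:
  assumes "0 < r" "r \<le> r'"
  shows "cauchy_energy r' \<le> cauchy_energy r"
proof (cases "r = r'")
  case False
  define t where "t = r / 2"
  define s where "s = (r' - r) / 2"
  have st: "0 < s" "0 < t" "s + t = r' / 2" using assms False by (auto simp: s_def t_def field_simps)
  have "ennreal (cauchy_energy (2 * (s + t))) = L2_energy lborel (\<lambda>x. cauchy_transform g (s + t) x)"
    using st by (simp add: cauchy_transform_norm)
  also have "\<dots> \<le> L2_energy lborel (cauchy_transform g t)"
    unfolding poisson_cauchy_transform[OF st(1,2), symmetric]
    by (rule nn_integral_convolution_power2_le)
       (use st in \<open>auto simp: poisson_kernel_nonneg nn_integral_poisson_kernel\<close>)
  also have "\<dots> = ennreal (cauchy_energy (2 * t))" using st by (simp add: cauchy_transform_norm)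
  finally have "cauchy_energy (2 * (s + t)) \<le> cauchy_energy (2 * t)"
    using cauchy_transform_norm(2)[OF st(2)] by (simp add: ennreal_le_iff)
  moreover have "2 * (s + t) = r'" "2 * t = r" using st by (auto simp: t_def)
  ultimately show ?thesis by (simp only:)
qed simp

text \<open>A self-improving estimate. Pairing \<open>g\<close> with its transform at height
  \<open>r\<close> bounds the energy at \<open>r\<close> by \<open>2 * pi * G\<close> times the root
  of the energy at \<open>2 * r\<close>, which by monotonicity is at most the root of the energy at
  \<open>r\<close>; that root is finite and cancels. The resulting bound is uniform in
  \<open>r\<close>.\<close>

lemma cauchy_energy_le:
  assumes r: "0 < r" and G: "L2_energy lborel g \<le> ennreal (G\<^sup>2)" "0 \<le> G"
  shows "cauchy_energy r \<le> (2 * pi * G)\<^sup>2"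
proof -
  define E where "E = sqrt (cauchy_energy r)"
  have E: "0 \<le> E" "cauchy_energy r = E\<^sup>2" using cauchy_energy_nonneg[OF r] by (auto simp: E_def)
  have "L2_energy lborel (cauchy_transform g r) = ennreal (cauchy_energy (2 * r))"
    using r by (rule cauchy_transform_norm)
  also have "\<dots> \<le> ennreal (E\<^sup>2)"
    unfolding E(2)[symmetric] using r by (intro ennreal_leI cauchy_energy_antimono) auto
  finally have "norm (\<integral>b. cnj (g b) * cauchy_transform g r b \<partial>lborel) \<le> G * E"
    using G E by (intro cauchy_schwarz_integral) auto
  then have "norm (cauchy_form r) \<le> G * E" by (simp add: cauchy_form_eq[OF r])
  then have "2 * pi * norm (cauchy_form r) \<le> 2 * pi * (G * E)" by (intro mult_left_mono) auto
  moreover have "E\<^sup>2 \<le> 2 * pi * norm (cauchy_form r)"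
    using complex_Re_le_cmod[of "2 * pi * \<i> * cauchy_form r"]
    by (simp add: E(2)[symmetric] cauchy_energy_def norm_mult)
  ultimately have "E\<^sup>2 \<le> 2 * pi * (G * E)" by (rule order.trans[rotated])
  then have "E * E \<le> (2 * pi * G) * E" by (simp add: power2_eq_square mult.assoc)
  then have "E \<le> 2 * pi * G" using E(1) G(2) by (cases "E = 0") auto
  then show ?thesis unfolding E(2) using E(1) by (rule power_mono)
qed

text \<open>The transforms are Cauchy in \<open>L2\<close> as \<open>t \<rightarrow> 0\<close> because their squared norms form a bounded
  antimonotone function of \<open>t\<close>; the Poisson semigroup carries the limit back to every \<open>t > 0\<close>.\<close>

lemma cauchy_transform_boundary:
  assumes G: "L2_energy lborel g < \<infinity>"
  obtains h where "h \<in> borel_measurable borel" "L2_energy lborel h < \<infinity>"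
    "\<And>s x. 0 < s \<Longrightarrow> cauchy_transform g s x = (\<integral>y. of_real (poisson_kernel s (x - y)) * h y \<partial>lborel)"
proof -
  obtain G2 where G2: "L2_energy lborel g = ennreal G2" "0 \<le> G2"
    using G by (cases "L2_energy lborel g") auto
  define L where "L = (SUP r\<in>{0<..}. cauchy_energy r)"
  have bdd: "bdd_above (cauchy_energy ` {0<..})"
    using cauchy_energy_le[of _ "sqrt G2"] G2 by (intro bdd_aboveI2[of _ _ "(2 * pi * sqrt G2)\<^sup>2"]) auto
  have le_L: "cauchy_energy r \<le> L" if "0 < r" for r
    unfolding L_def using bdd that by (intro cSUP_upper) auto
  have near: "\<exists>r>0. \<forall>r'. 0 < r' \<longrightarrow> r' \<le> r \<longrightarrow> L - e \<le> cauchy_energy r'" if "0 < e" for e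
  proof -
    have "\<exists>r\<in>{0<..}. L - e < cauchy_energy r"
      using less_cSUP_iff[OF _ bdd, of "L - e"] that unfolding L_def by auto
    then obtain r where "0 < r" "L - e < cauchy_energy r" by auto
    then show ?thesis using cauchy_energy_antimono by (intro exI[of _ r]) fastforce
  qed
  define \<tau> where "\<tau> n = 1 / real (Suc n)" for n
  have \<tau>: "0 < \<tau> n" for n by (simp add: \<tau>_def)
  have \<tau>0: "\<tau> \<longlonglongrightarrow> 0" unfolding \<tau>_def by real_asymp
  define F where "F n = cauchy_transform g (\<tau> n)" for n
  have Fm[measurable]: "F n \<in> borel_measurable lborel" for n unfolding F_def by measurable
  have Cauchy: "\<exists>K. \<forall>m\<ge>K. \<forall>n\<ge>K. L2_energy lborel (\<lambda>x. F m x - F n x) \<le> ennreal e" if e: "0 < e" for e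
  proof -
    obtain r where r: "0 < r" "\<And>r'. 0 < r' \<Longrightarrow> r' \<le> r \<Longrightarrow> L - e / 2 \<le> cauchy_energy r'"
      using near[of "e / 2"] e by auto
    have "eventually (\<lambda>n. \<tau> n < r / 2) sequentially"
      using \<tau>0 r(1) by (intro order_tendstoD(2)[of \<tau> 0]) auto
    then obtain K where K: "\<And>n. K \<le> n \<Longrightarrow> \<tau> n < r / 2" by (auto simp: eventually_sequentially)
    have "L2_energy lborel (\<lambda>x. F m x - F n x) \<le> ennreal e" if "K \<le> m" "K \<le> n" for m n
    proof -
      \<comment> \<open>By the formula for the norm of a difference, the squared distance is at most
        \<open>L + L - 2 * (L - e / 2) = e\<close>.\<close>
      have "cauchy_energy (2 * \<tau> m) \<le> L" "cauchy_energy (2 * \<tau> n) \<le> L"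
        using \<tau>[of m] \<tau>[of n] by (auto intro: le_L)
      moreover have "L - e / 2 \<le> cauchy_energy (\<tau> m + \<tau> n)"
        using K[OF that(1)] K[OF that(2)] \<tau>[of m] \<tau>[of n] by (intro r(2)) auto
      ultimately show ?thesis
        unfolding F_def cauchy_transform_norm_diff[OF \<tau> \<tau>] by (intro ennreal_leI) linarith
    qed
    then show ?thesis by blast
  qed
  obtain h where h0: "h \<in> borel_measurable lborel" and
    h: "\<And>e. 0 < e \<Longrightarrow> \<exists>K. \<forall>n\<ge>K. L2_energy lborel (\<lambda>x. F n x - h x) \<le> ennreal e"
    by (rule L2_Cauchy_imp_convergent[of F lborel, OF Fm Cauchy]) (assumption, rule that)
  have [measurable]: "h \<in> borel_measurable borel" using h0 by simp
  have FL: "L2_energy lborel (F n) \<le> ennreal ((sqrt L)\<^sup>2)" for n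
    unfolding F_def cauchy_transform_norm(1)[OF \<tau>]
    using \<tau>[of n] le_L[of "2 * \<tau> n"] cauchy_transform_norm(2)[OF \<tau>[of n]] by (intro ennreal_leI) simp
  have L0: "0 \<le> L" using le_L[of 1] cauchy_energy_nonneg[of 1] by simp
  obtain n0 where n0: "L2_energy lborel (\<lambda>x. F n0 x - h x) \<le> ennreal 1"
    using h[of 1] by auto
  have "L2_energy lborel h
      \<le> (\<integral>\<^sup>+x. ennreal 2 * ennreal ((norm (F n0 x))\<^sup>2) + ennreal 2 * ennreal ((norm (F n0 x - h x))\<^sup>2) \<partial>lborel)"
  proof (rule nn_integral_mono)
    fix x
    have "norm (h x) \<le> norm (F n0 x) + norm (F n0 x - h x)"
      using norm_triangle_ineq4[of "F n0 x" "F n0 x - h x"] by simp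
    then have "(norm (h x))\<^sup>2 \<le> (norm (F n0 x) + norm (F n0 x - h x))\<^sup>2" by (intro power_mono) auto
    also have "\<dots> \<le> 2 * (norm (F n0 x))\<^sup>2 + 2 * (norm (F n0 x - h x))\<^sup>2"
      using sum_squares_bound[of "norm (F n0 x)" "norm (F n0 x - h x)"] by (simp add: power2_sum)
    finally have "ennreal ((norm (h x))\<^sup>2) \<le> ennreal (2 * (norm (F n0 x))\<^sup>2 + 2 * (norm (F n0 x - h x))\<^sup>2)"
      by (rule ennreal_leI)
    also have "\<dots> = ennreal 2 * ennreal ((norm (F n0 x))\<^sup>2) + ennreal 2 * ennreal ((norm (F n0 x - h x))\<^sup>2)"
      by (simp add: ennreal_mult)
    finally show "ennreal ((norm (h x))\<^sup>2) \<le> ennreal 2 * ennreal ((norm (F n0 x))\<^sup>2) + ennreal 2 * ennreal ((norm (F n0 x - h x))\<^sup>2)" .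
  qed
  also have "\<dots> = ennreal 2 * L2_energy lborel (F n0) + ennreal 2 * L2_energy lborel (\<lambda>x. F n0 x - h x)"
    by (simp add: nn_integral_add nn_integral_cmult)
  also have "\<dots> \<le> ennreal 2 * ennreal ((sqrt L)\<^sup>2) + ennreal 2 * ennreal 1"
    by (intro add_mono mult_left_mono FL n0) auto
  also have "\<dots> < \<infinity>" by (simp add: ennreal_mult_less_top)
  finally have hfin: "L2_energy lborel h < \<infinity>" .
  have "cauchy_transform g s x = (\<integral>y. of_real (poisson_kernel s (x - y)) * h y \<partial>lborel)" if s: "0 < s" for s x
  proof -
    let ?p = "\<lambda>y. of_real (poisson_kernel s (x - y)) :: complex"
    \<comment> \<open>The Poisson kernel is integrable and at most \<open>1 / (pi * s)\<close>,
      hence square integrable; its norm is the \<open>P\<close> of the Cauchy-Schwarz estimates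
      below.\<close>
    have "integrable lborel (\<lambda>y. (poisson_kernel s (x - y))\<^sup>2)"
    proof (rule Bochner_Integration.integrable_bound)
      show "integrable lborel (\<lambda>y. 1 / (pi * s) * poisson_kernel s (x - y))"
        using integrable_poisson_kernel[OF s] integrable_real_reflect[of "poisson_kernel s" x]
        by (intro integrable_mult_right) simp
      have "poisson_kernel s u \<le> 1 / (pi * s)" for u
      proof -
        have "pi * s\<^sup>2 \<le> pi * (u\<^sup>2 + s\<^sup>2)" by (intro mult_left_mono) auto
        then have "s / (pi * (u\<^sup>2 + s\<^sup>2)) \<le> s / (pi * s\<^sup>2)"
          using s by (intro divide_left_mono mult_pos_pos) (auto simp: add_nonneg_pos)
        then show ?thesis using s by (simp add: poisson_kernel_def power2_eq_square)
      qed
      then show "AE y in lborel. norm ((poisson_kernel s (x - y))\<^sup>2) \<le> norm (1 / (pi * s) * poisson_kernel s (x - y))"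
        using s by (intro AE_I2) (simp add: power2_eq_square poisson_kernel_nonneg abs_mult mult_right_mono del: times_divide_eq_left)
    qed measurable
    then have "L2_energy lborel ?p = ennreal (\<integral>y. (poisson_kernel s (x - y))\<^sup>2 \<partial>lborel)"
      by (simp add: nn_integral_eq_integral)
    then obtain P where P: "L2_energy lborel ?p \<le> ennreal (P\<^sup>2)" "0 \<le> P"
    proof -
      have "0 \<le> (\<integral>y. (poisson_kernel s (x - y))\<^sup>2 \<partial>lborel)" by simp
      then show ?thesis
        using that[of "sqrt (\<integral>y. (poisson_kernel s (x - y))\<^sup>2 \<partial>lborel)"]
          \<open>L2_energy lborel ?p = _\<close> by simp
    qed
    obtain H2 where H2: "L2_energy lborel h = ennreal H2" "0 \<le> H2"
      using hfin by (cases "L2_energy lborel h") auto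
    have ih: "integrable lborel (\<lambda>y. ?p y * h y)"
      by (rule cauchy_schwarz_integral(1)[OF _ _ P(1) _ P(2), of h "sqrt H2"]) (use H2 in auto)
    have iF: "integrable lborel (\<lambda>y. ?p y * F n y)" for n
      by (rule cauchy_schwarz_integral(1)[OF _ _ P(1) FL P(2)]) (use L0 in auto)
    \<comment> \<open>Both limits concern the integral of \<open>?p\<close> against
      \<open>F n\<close>. Norm convergence of \<open>F n\<close> gives the Poisson integral of
      \<open>h\<close>. By the semigroup law the same integral is the transform at height
      \<open>s + \<tau> n\<close>, which tends to that at height \<open>s\<close> by dominated
      convergence.\<close>
    have lim1: "(\<lambda>n. \<integral>y. ?p y * F n y \<partial>lborel) \<longlonglongrightarrow> (\<integral>y. ?p y * h y \<partial>lborel)"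
    proof (rule LIMSEQ_I)
      fix e :: real assume e: "0 < e"
      define d where "d = e / (2 * (P + 1))"
      have d0: "0 < d" using e P(2) by (simp add: d_def)
      have "c * (e / (2 * c)) = e / 2" if "c \<noteq> 0" for c :: real using that by simp
      from this[of "P + 1"] have "(P + 1) * d = e / 2" using P(2) by (simp add: d_def)
      then have d: "0 < d" "P * d < e" using d0 e by (auto simp: algebra_simps)
      obtain K where K: "\<And>n. K \<le> n \<Longrightarrow> L2_energy lborel (\<lambda>x. F n x - h x) \<le> ennreal (d\<^sup>2)"
        using h[of "d\<^sup>2"] d by auto
      have "norm ((\<integral>y. ?p y * F n y \<partial>lborel) - (\<integral>y. ?p y * h y \<partial>lborel)) < e" if "K \<le> n" for n
      proof -
        have "(\<integral>y. ?p y * F n y \<partial>lborel) - (\<integral>y. ?p y * h y \<partial>lborel) = (\<integral>y. ?p y * (F n y - h y) \<partial>lborel)"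
          using iF[of n] ih by (simp add: right_diff_distrib)
        also have "norm \<dots> \<le> P * d"
          by (rule cauchy_schwarz_integral(2)[OF _ _ P(1) K[OF that] P(2)]) (use d in auto)
        finally show ?thesis using d by simp
      qed
      then show "\<exists>K. \<forall>n\<ge>K. norm ((\<integral>y. ?p y * F n y \<partial>lborel) - (\<integral>y. ?p y * h y \<partial>lborel)) < e" by blast
    qed
    have lim2: "(\<lambda>n. \<integral>y. ?p y * F n y \<partial>lborel) \<longlonglongrightarrow> cauchy_transform g s x"
      unfolding F_def poisson_cauchy_transform[OF s \<tau>] unfolding cauchy_transform_def
    proof (rule integral_dominated_convergence[where w = "\<lambda>a. 1 / s * norm (g a)"])
      show "integrable lborel (\<lambda>a. 1 / s * norm (g a))" using g_int by simp
      show "AE a in lborel. (\<lambda>n. g a * cauchy_kernel (s + \<tau> n) (x - a)) \<longlonglongrightarrow> g a * cauchy_kernel s (x - a)"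
      proof (rule AE_I2)
        fix a
        have "(\<lambda>n. 1 / Complex (x - a) (s + \<tau> n)) \<longlonglongrightarrow> 1 / Complex (x - a) (s + 0)"
          using s by (intro tendsto_intros \<tau>0) (auto simp: complex_eq_iff)
        then show "(\<lambda>n. g a * cauchy_kernel (s + \<tau> n) (x - a)) \<longlonglongrightarrow> g a * cauchy_kernel s (x - a)"
          unfolding cauchy_kernel_def by (intro tendsto_mult tendsto_const) simp
      qed
      show "AE a in lborel. norm (g a * cauchy_kernel (s + \<tau> n) (x - a)) \<le> 1 / s * norm (g a)" for n
      proof (rule AE_I2)
        fix a
        have "norm (cauchy_kernel (s + \<tau> n) (x - a)) \<le> 1 / \<bar>s + \<tau> n\<bar>"
          using s \<tau>[of n] by (intro norm_cauchy_kernel_le) auto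
        also have "\<dots> \<le> 1 / s" using s \<tau>[of n] by (intro divide_left_mono) auto
        finally have "norm (g a) * norm (cauchy_kernel (s + \<tau> n) (x - a)) \<le> norm (g a) * (1 / s)"
          by (intro mult_left_mono) auto
        then show "norm (g a * cauchy_kernel (s + \<tau> n) (x - a)) \<le> 1 / s * norm (g a)"
          by (simp add: norm_mult)
      qed
    qed measurable
    show ?thesis by (rule LIMSEQ_unique[OF lim2 lim1])
  qed
  with \<open>h \<in> borel_measurable borel\<close> hfin show ?thesis by (rule that)
qed

end

section \<open>Lebesgue points\<close>

lemma le_power2_add_1: "a \<le> a\<^sup>2 + (1::real)"
proof -
  have "0 \<le> (a - 1 / 2)\<^sup>2" by simp
  then have "a \<le> a\<^sup>2 + (1 / 2)\<^sup>2" by (simp add: power2_diff)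
  also have "\<dots> \<le> a\<^sup>2 + 1" by (simp add: power_divide)
  finally show ?thesis .
qed

lemma integrable_on_interval_of_L2:
  fixes h :: "real \<Rightarrow> complex"
  assumes [measurable]: "h \<in> borel_measurable borel"
    and h2: "L2_energy lborel h < \<infinity>"
  shows "set_integrable lborel {a..b} h"
proof -
  have "(\<integral>\<^sup>+x. ennreal (norm (indicator {a..b} x *\<^sub>R h x)) \<partial>lborel)
      \<le> (\<integral>\<^sup>+x. ennreal ((norm (h x))\<^sup>2) + indicator {a..b} x \<partial>lborel)"
  proof (rule nn_integral_mono)
    fix x
    have "norm (h x) \<le> (norm (h x))\<^sup>2 + 1" by (rule le_power2_add_1)
    then have "ennreal (norm (h x)) \<le> ennreal ((norm (h x))\<^sup>2) + 1"
      by (simp add: ennreal_leI flip: ennreal_1 ennreal_plus)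
    then show "ennreal (norm (indicator {a..b} x *\<^sub>R h x)) \<le> ennreal ((norm (h x))\<^sup>2) + indicator {a..b} x"
      by (auto simp: indicator_def)
  qed
  also have "\<dots> = L2_energy lborel h + emeasure lborel {a..b}"
    by (subst nn_integral_add) auto
  also have "\<dots> < \<infinity>" using h2 by (simp add: emeasure_lborel_Icc_eq)
  finally show ?thesis unfolding set_integrable_def integrable_iff_bounded by simp
qed

text \<open>The differentiation theorem averages over cubes with lowest corner \<open>x\<close>,
  which on the line are right-sided intervals; the left-sided half comes later by
  reflection.\<close>

lemma lebesgue_point_right_real:
  fixes f :: "real \<Rightarrow> real"
  assumes f: "\<And>a b. set_integrable lborel {a..b} f" and f0: "\<And>x. 0 \<le> f x"
  shows "AE x in lborel. \<forall>e>0. \<exists>d>0. \<forall>r. 0 < r \<longrightarrow> r < d \<longrightarrow>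
    (\<integral>\<^sup>+y. ennreal (f y) * indicator {x..x + r} y \<partial>lborel) \<le> ennreal (r * (f x + e))"
proof -
  have "f integrable_on cbox a b" for a b
    using set_borel_integral_eq_integral(1)[OF f] by simp
  then obtain N where N: "negligible N" and
    lim: "\<And>x e. \<lbrakk>x \<notin> N; 0 < e\<rbrakk> \<Longrightarrow> \<exists>d>0. \<forall>r. 0 < r \<and> r < d \<longrightarrow>
        norm (integral (cbox x (x + r *\<^sub>R One)) f /\<^sub>R r ^ DIM(real) - f x) < e"
    using integrable_ccontinuous_explicit[of f] by blast
  have "AE x in lebesgue. x \<notin> N" using N by (simp add: negligible_iff_null_sets AE_not_in)
  then have "AE x in lborel. x \<notin> N" by (simp add: AE_completion_iff)
  then show ?thesis
  proof eventually_elim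
    case (elim x)
    show ?case
    proof (intro allI impI)
      fix e :: real assume "0 < e"
      from lim[OF elim this] obtain d where "0 < d" and
        lt: "\<forall>r. 0 < r \<and> r < d \<longrightarrow> norm (integral (cbox x (x + r *\<^sub>R One)) f /\<^sub>R r ^ DIM(real) - f x) < e"
        by blast
      have d: "0 < d" "\<And>r. 0 < r \<Longrightarrow> r < d \<Longrightarrow> \<bar>integral {x..x + r} f / r - f x\<bar> < e"
        using \<open>0 < d\<close> lt by (auto simp: divide_inverse mult.commute)
      have "(\<integral>\<^sup>+y. ennreal (f y) * indicator {x..x + r} y \<partial>lborel) \<le> ennreal (r * (f x + e))"
        if r: "0 < r" "r < d" for r
      proof -
        have "(\<integral>\<^sup>+y. ennreal (f y) * indicator {x..x + r} y \<partial>lborel)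
            = (\<integral>\<^sup>+y. ennreal (indicator {x..x + r} y *\<^sub>R f y) \<partial>lborel)"
          by (intro nn_integral_cong) (simp add: indicator_def)
        also have "\<dots> = ennreal (integral {x..x + r} f)"
          unfolding set_borel_integral_eq_integral(2)[OF f, symmetric] set_lebesgue_integral_def
          by (rule nn_integral_eq_integral) (use f[of x "x + r"] f0 in \<open>auto simp: set_integrable_def\<close>)
        also have "\<dots> \<le> ennreal (r * (f x + e))"
          using d(2)[OF r] r by (intro ennreal_leI) (simp add: abs_less_iff field_simps)
        finally show ?thesis .
      qed
      with d show "\<exists>d>0. \<forall>r. 0 < r \<longrightarrow> r < d \<longrightarrow>
        (\<integral>\<^sup>+y. ennreal (f y) * indicator {x..x + r} y \<partial>lborel) \<le> ennreal (r * (f x + e))" by blast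
    qed
  qed
qed

text \<open>Continuity of the averages of \<open>\<bar>h - q\<bar>\<close> is used for all \<open>q\<close> in a countable dense set at once.\<close>

lemma lebesgue_point_right:
  fixes h :: "real \<Rightarrow> complex"
  assumes hm[measurable]: "h \<in> borel_measurable borel" and h: "\<And>a b. set_integrable lborel {a..b} h"
  shows "AE x in lborel. \<forall>e>0. \<exists>d>0. \<forall>r. 0 < r \<longrightarrow> r < d \<longrightarrow>
    (\<integral>\<^sup>+y. ennreal (norm (h y - h x)) * indicator {x..x + r} y \<partial>lborel) \<le> ennreal (e * r)"
proof -
  obtain D :: "complex set" where D: "countable D" "\<And>X. open X \<Longrightarrow> X \<noteq> {} \<Longrightarrow> \<exists>d\<in>D. d \<in> X"
    using countable_dense_exists by blast
  have "AE x in lborel. \<forall>q\<in>D. \<forall>e>0. \<exists>d>0. \<forall>r. 0 < r \<longrightarrow> r < d \<longrightarrow>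
    (\<integral>\<^sup>+y. ennreal (norm (h y - q)) * indicator {x..x + r} y \<partial>lborel) \<le> ennreal (r * (norm (h x - q) + e))"
  proof (rule AE_ball_countable'[OF _ D(1)], rule lebesgue_point_right_real)
    show "set_integrable lborel {a..b} (\<lambda>x. norm (h x - q))" for q a b
    proof (intro set_integrable_norm set_integral_diff h)
      show "set_integrable lborel {a..b} (\<lambda>x. q)"
        unfolding set_integrable_def
        by (intro integrable_scaleR_left integrable_real_indicator) (auto simp: emeasure_lborel_Icc_eq)
    qed
  qed simp
  then show ?thesis
  proof eventually_elim
    case (elim x)
    show ?case
    proof (intro allI impI)
      fix e :: real assume e: "0 < e"
      \<comment> \<open>Three errors of \<open>e / 4\<close>: the distance from \<open>h x\<close>
        to \<open>q\<close>, which enters twice, and the deviation of the average of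
        \<open>norm (h y - q)\<close> from its limit.\<close>
      obtain q where q: "q \<in> D" "q \<in> ball (h x) (e / 4)" using D(2)[of "ball (h x) (e / 4)"] e by auto
      then have qe: "norm (h x - q) < e / 4" by (simp add: dist_norm)
      have "\<exists>d>0. \<forall>r. 0 < r \<longrightarrow> r < d \<longrightarrow>
        (\<integral>\<^sup>+y. ennreal (norm (h y - q)) * indicator {x..x + r} y \<partial>lborel) \<le> ennreal (r * (norm (h x - q) + e / 4))"
        using bspec[OF elim q(1), THEN spec, of "e / 4"] e by simp
      then obtain d where d: "0 < d" "\<And>r. 0 < r \<Longrightarrow> r < d \<Longrightarrow>
        (\<integral>\<^sup>+y. ennreal (norm (h y - q)) * indicator {x..x + r} y \<partial>lborel) \<le> ennreal (r * (norm (h x - q) + e / 4))"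
        by auto
      have "(\<integral>\<^sup>+y. ennreal (norm (h y - h x)) * indicator {x..x + r} y \<partial>lborel) \<le> ennreal (e * r)"
        if r: "0 < r" "r < d" for r
      proof -
        have "(\<integral>\<^sup>+y. ennreal (norm (h y - h x)) * indicator {x..x + r} y \<partial>lborel)
            \<le> (\<integral>\<^sup>+y. ennreal (norm (h y - q)) * indicator {x..x + r} y + ennreal (e / 4) * indicator {x..x + r} y \<partial>lborel)"
        proof (rule nn_integral_mono)
          fix y
          have "norm (h y - h x) \<le> norm (h y - q) + norm (h x - q)"
            using norm_triangle_ineq4[of "h y - q" "h x - q"] by simp
          also have "\<dots> \<le> norm (h y - q) + e / 4" using qe by simp
          finally have "ennreal (norm (h y - h x)) \<le> ennreal (norm (h y - q) + e / 4)" by (rule ennreal_leI)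
          then show "ennreal (norm (h y - h x)) * indicator {x..x + r} y
              \<le> ennreal (norm (h y - q)) * indicator {x..x + r} y + ennreal (e / 4) * indicator {x..x + r} y"
            using e by (simp add: indicator_def)
        qed
        also have "\<dots> = (\<integral>\<^sup>+y. ennreal (norm (h y - q)) * indicator {x..x + r} y \<partial>lborel) + ennreal (e / 4) * ennreal r"
          using r by (subst nn_integral_add) (auto simp: nn_integral_cmult_indicator)
        also have "\<dots> \<le> ennreal (r * (norm (h x - q) + e / 4)) + ennreal (e / 4) * ennreal r"
          by (intro add_right_mono d(2) r)
        also have "\<dots> = ennreal (r * (norm (h x - q) + e / 4) + e / 4 * r)"
        proof -
          have "ennreal (e / 4) * ennreal r = ennreal (e / 4 * r)"
            using e by (intro ennreal_mult'[symmetric]) simp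
          then show ?thesis using r e by (simp only:) (intro ennreal_plus[symmetric], auto)
        qed
        also have "\<dots> \<le> ennreal (e * r)"
        proof (rule ennreal_leI)
          have "r * (norm (h x - q) + e / 4) \<le> r * (e / 4 + e / 4)" using qe r by (intro mult_left_mono) auto
          then have "r * (norm (h x - q) + e / 4) + e / 4 * r \<le> r * (e / 4 + e / 4) + e / 4 * r"
            by (rule add_right_mono)
          also have "\<dots> = 3 / 4 * (e * r)" by (simp add: algebra_simps)
          also have "\<dots> \<le> e * r" using mult_pos_pos[OF e r(1)] by linarith
          finally show "r * (norm (h x - q) + e / 4) + e / 4 * r \<le> e * r" .
        qed
        finally show ?thesis .
      qed
      with d(1) show "\<exists>d>0. \<forall>r. 0 < r \<longrightarrow> r < d \<longrightarrow>
          (\<integral>\<^sup>+y. ennreal (norm (h y - h x)) * indicator {x..x + r} y \<partial>lborel) \<le> ennreal (e * r)" by blast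
    qed
  qed
qed

text \<open>Written with \<open>x - u\<close> over a symmetric window, the form in which
  convolutions meet it; the nonnegative integral gives the averages a meaning for every Borel
  function.\<close>

definition lebesgue_point :: "(real \<Rightarrow> complex) \<Rightarrow> real \<Rightarrow> bool" where
  "lebesgue_point h x \<longleftrightarrow> (\<forall>e>0. \<exists>d>0. \<forall>r. 0 < r \<longrightarrow> r < d \<longrightarrow>
    (\<integral>\<^sup>+u. ennreal (norm (h (x - u) - h x)) * indicator {-r..r} u \<partial>lborel) \<le> ennreal (e * r))"

lemma AE_lebesgue_point:
  fixes h :: "real \<Rightarrow> complex"
  assumes [measurable]: "h \<in> borel_measurable borel" and h: "\<And>a b. set_integrable lborel {a..b} h"
  shows "AE x in lborel. lebesgue_point h x"
proof -
  have h': "set_integrable lborel {a..b} (\<lambda>y. h (- y))" for a b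
  proof -
    have "(\<lambda>y. indicator {- b..- a} (- y) *\<^sub>R h (- y)) = (\<lambda>y. indicator {a..b} y *\<^sub>R h (- y))"
      by (auto simp: indicator_def fun_eq_iff)
    then show ?thesis
      using integrable_real_reflect[of "\<lambda>y. indicator {- b..- a} y *\<^sub>R h y" 0] h[of "- b" "- a"]
      by (simp add: set_integrable_def)
  qed
  \<comment> \<open>The right-sided statement for \<open>y \<mapsto> h (- y)\<close> at
    \<open>- x\<close> is the left-sided one for \<open>h\<close> at \<open>x\<close>, and
    reflection preserves null sets.\<close>
  have "AE x in distr lborel borel uminus. \<forall>e>0. \<exists>d>0. \<forall>r. 0 < r \<longrightarrow> r < d \<longrightarrow>
    (\<integral>\<^sup>+y. ennreal (norm (h (- y) - h (- x))) * indicator {x..x + r} y \<partial>lborel) \<le> ennreal (e * r)"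
    unfolding lborel_distr_uminus by (rule lebesgue_point_right[OF _ h']) simp
  then have left: "AE x in lborel. \<forall>e>0. \<exists>d>0. \<forall>r. 0 < r \<longrightarrow> r < d \<longrightarrow>
    (\<integral>\<^sup>+y. ennreal (norm (h (- y) - h (- (- x)))) * indicator {- x..- x + r} y \<partial>lborel) \<le> ennreal (e * r)"
    by (rule AE_distrD[rotated]) simp
  have right: "AE x in lborel. \<forall>e>0. \<exists>d>0. \<forall>r. 0 < r \<longrightarrow> r < d \<longrightarrow>
    (\<integral>\<^sup>+y. ennreal (norm (h y - h x)) * indicator {x..x + r} y \<partial>lborel) \<le> ennreal (e * r)"
    by (rule lebesgue_point_right[OF _ h]) simp
  from left right show ?thesis
  proof eventually_elim
    case (elim x)
    show ?case unfolding lebesgue_point_def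
    proof (intro allI impI)
      fix e :: real assume "0 < e"
      then have e: "0 < e / 2" by simp
      obtain d1 where d1: "0 < d1" "\<And>r. 0 < r \<Longrightarrow> r < d1 \<Longrightarrow>
        (\<integral>\<^sup>+y. ennreal (norm (h (- y) - h x)) * indicator {- x..- x + r} y \<partial>lborel) \<le> ennreal (e / 2 * r)"
        using elim(1)[rule_format, OF e] by auto
      obtain d2 where d2: "0 < d2" "\<And>r. 0 < r \<Longrightarrow> r < d2 \<Longrightarrow>
        (\<integral>\<^sup>+y. ennreal (norm (h y - h x)) * indicator {x..x + r} y \<partial>lborel) \<le> ennreal (e / 2 * r)"
        using elim(2)[rule_format, OF e] by auto
      have "(\<integral>\<^sup>+u. ennreal (norm (h (x - u) - h x)) * indicator {-r..r} u \<partial>lborel) \<le> ennreal (e * r)"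
        if r: "0 < r" "r < min d1 d2" for r
      proof -
        let ?n = "\<lambda>u. ennreal (norm (h (x - u) - h x))"
        have "(\<integral>\<^sup>+u. ?n u * indicator {-r..r} u \<partial>lborel)
            \<le> (\<integral>\<^sup>+u. ?n u * indicator {0..r} u + ?n u * indicator {-r..0} u \<partial>lborel)"
          by (intro nn_integral_mono) (auto simp: indicator_def)
        also have "\<dots> = (\<integral>\<^sup>+u. ?n u * indicator {0..r} u \<partial>lborel) + (\<integral>\<^sup>+u. ?n u * indicator {-r..0} u \<partial>lborel)"
          by (rule nn_integral_add) measurable
        also have "(\<integral>\<^sup>+u. ?n u * indicator {0..r} u \<partial>lborel)
            = (\<integral>\<^sup>+y. ennreal (norm (h (- y) - h x)) * indicator {- x..- x + r} y \<partial>lborel)"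
        proof -
          have "(\<integral>\<^sup>+y. ennreal (norm (h (- y) - h x)) * indicator {- x..- x + r} y \<partial>lborel)
            = (\<integral>\<^sup>+u. ennreal (norm (h (- (u + - x)) - h x)) * indicator {- x..- x + r} (u + - x) \<partial>lborel)"
            by (rule nn_integral_lborel_translate[symmetric]) measurable
          also have "\<dots> = (\<integral>\<^sup>+u. ?n u * indicator {0..r} u \<partial>lborel)"
            by (intro nn_integral_cong) (auto simp: indicator_def)
          finally show ?thesis ..
        qed
        also have "(\<integral>\<^sup>+u. ?n u * indicator {-r..0} u \<partial>lborel)
            = (\<integral>\<^sup>+y. ennreal (norm (h y - h x)) * indicator {x..x + r} y \<partial>lborel)"
        proof -
          have "(\<integral>\<^sup>+u. ennreal (norm (h (x - u) - h x)) * indicator {x..x + r} (x - u) \<partial>lborel)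
            = (\<integral>\<^sup>+y. ennreal (norm (h y - h x)) * indicator {x..x + r} y \<partial>lborel)"
            by (rule nn_integral_real_reflect) measurable
          moreover have "(\<integral>\<^sup>+u. ennreal (norm (h (x - u) - h x)) * indicator {x..x + r} (x - u) \<partial>lborel)
            = (\<integral>\<^sup>+u. ?n u * indicator {-r..0} u \<partial>lborel)"
            by (intro nn_integral_cong) (auto simp: indicator_def)
          ultimately show ?thesis by simp
        qed
        also have "(\<integral>\<^sup>+y. ennreal (norm (h (- y) - h x)) * indicator {- x..- x + r} y \<partial>lborel)
            + (\<integral>\<^sup>+y. ennreal (norm (h y - h x)) * indicator {x..x + r} y \<partial>lborel)
            \<le> ennreal (e / 2 * r) + ennreal (e / 2 * r)"
          using r by (intro add_mono d1(2) d2(2)) auto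
        also have "\<dots> = ennreal (e * r)" using e r by (simp flip: ennreal_plus)
        finally show ?thesis .
      qed
      then show "\<exists>d>0. \<forall>r. 0 < r \<longrightarrow> r < d \<longrightarrow>
        (\<integral>\<^sup>+u. ennreal (norm (h (x - u) - h x)) * indicator {-r..r} u \<partial>lborel) \<le> ennreal (e * r)"
        using d1(1) d2(1) by (intro exI[of _ "min d1 d2"]) auto
    qed
  qed
qed

text \<open>The term of the least \<open>k\<close> with
  \<open>\<bar>\<rho>\<bar> \<le> 2 ^ k\<close> suffices. For \<open>k > 0\<close> minimality gives
  \<open>1 + \<rho>\<^sup>2 \<ge> 4 ^ (k - 1)\<close>, and the factor 4 pays for the shift of the
  index.\<close>

lemma inverse_1_plus_power2_le_dyadic:
  "ennreal (1 / (1 + \<rho>\<^sup>2)) \<le> (\<Sum>k. ennreal (4 * (1/4) ^ k) * indicator {- (2 ^ k)..(2 ^ k)} \<rho>)"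
proof -
  obtain n where n: "\<bar>\<rho>\<bar> \<le> 2 ^ n" using real_arch_pow[of 2 "\<bar>\<rho>\<bar>"] by (auto intro: less_imp_le)
  define k where "k = (LEAST n. \<bar>\<rho>\<bar> \<le> 2 ^ n)"
  have k: "\<bar>\<rho>\<bar> \<le> 2 ^ k" unfolding k_def using n by (rule LeastI)
  have "1 / (1 + \<rho>\<^sup>2) \<le> 4 * (1/4) ^ k"
  proof (cases k)
    case 0
    have "1 / (1 + \<rho>\<^sup>2) \<le> 1" using frac_le[of 1 1 1 "1 + \<rho>\<^sup>2"] by simp
    then show ?thesis using 0 by simp
  next
    case (Suc j)
    then have "\<not> \<bar>\<rho>\<bar> \<le> 2 ^ j" unfolding k_def using not_less_Least[of j "\<lambda>n. \<bar>\<rho>\<bar> \<le> 2 ^ n"] by (simp add: k_def)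
    then have "(2 ^ j)\<^sup>2 \<le> \<bar>\<rho>\<bar>\<^sup>2" by (intro power_mono) auto
    moreover have "(2 ^ j)\<^sup>2 = (4::real) ^ j"
      by (simp add: power_mult[symmetric] mult.commute[of j]) (simp add: power_mult)
    ultimately have "4 ^ j \<le> 1 + \<rho>\<^sup>2" by simp
    then have "1 / (1 + \<rho>\<^sup>2) \<le> 1 / 4 ^ j" by (intro frac_le) auto
    then show ?thesis by (simp add: Suc power_divide)
  qed
  then have "ennreal (1 / (1 + \<rho>\<^sup>2)) \<le> ennreal (4 * (1/4) ^ k)" by (rule ennreal_leI)
  also have "\<dots> = ennreal (4 * (1/4) ^ k) * indicator {- (2 ^ k)..(2 ^ k)} \<rho>"
    using k by (simp add: indicator_def abs_le_iff)
  also have "\<dots> \<le> (\<Sum>k. ennreal (4 * (1/4) ^ k) * indicator {- (2 ^ k)..(2 ^ k)} \<rho>)"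
    by (rule ennreal_le_suminf)
  finally show ?thesis .
qed

text \<open>The dyadic means over \<open>{- 2 ^ k * \<delta>..2 ^ k * \<delta>}\<close> are bounded by \<open>e + B * sqrt (2 ^ k * \<delta>)\<close>, small for
  small radii and bounded for large ones; the square root keeps the resulting series summable.\<close>

lemma lebesgue_point_approximation:
  fixes h :: "real \<Rightarrow> complex"
  assumes hm[measurable]: "h \<in> borel_measurable borel"
    and h2: "L2_energy lborel h < \<infinity>"
    and x: "lebesgue_point h x" and e: "0 < e"
  shows "\<exists>d>0. \<forall>\<delta>. 0 < \<delta> \<longrightarrow> \<delta> < d \<longrightarrow>
    (\<integral>\<^sup>+\<rho>. ennreal (1 / (1 + \<rho>\<^sup>2)) * ennreal (norm (h (x - \<delta> * \<rho>) - h x)) \<partial>lborel) \<le> ennreal e"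
proof -
  define A where "A r = (\<integral>\<^sup>+u. ennreal (norm (h (x - u) - h x)) * indicator {-r..r} u \<partial>lborel)" for r
  obtain H where H: "L2_energy lborel h = ennreal H" "0 \<le> H"
    using h2 by (cases "L2_energy lborel h") auto
  \<comment> \<open>The dyadic series will contribute \<open>8 * e'\<close>, and the term with
    \<open>sqrt \<delta>\<close> at most one more \<open>e'\<close>.\<close>
  define e' where "e' = e / 16"
  have e': "0 < e'" using e by (simp add: e'_def)
  obtain d where d: "0 < d" "\<And>r. 0 < r \<Longrightarrow> r < d \<Longrightarrow> A r \<le> ennreal (e' * r)"
    using x e' unfolding lebesgue_point_def A_def by meson
  \<comment> \<open>For radii at least \<open>d\<close> the energy takes over:
    \<open>norm (h y) \<le> (norm (h y))\<^sup>2 + 1\<close> bounds the integral by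
    \<open>H + 2 * r * (1 + norm (h x))\<close>, and \<open>H \<le> H / d * r\<close>.\<close>
  define M where "M = H / d + 2 + 2 * norm (h x)"
  have M0: "0 \<le> M" using H d by (simp add: M_def)
  have A_large: "A r \<le> ennreal (M * r)" if r: "d \<le> r" for r
  proof -
    have r0: "0 < r" using r d by linarith
    have "A r \<le> (\<integral>\<^sup>+u. ennreal ((norm (h (x - u)))\<^sup>2) + ennreal (1 + norm (h x)) * indicator {-r..r} u \<partial>lborel)"
      unfolding A_def
    proof (rule nn_integral_mono)
      fix u
      have "norm (h (x - u) - h x) \<le> norm (h (x - u)) + norm (h x)" by (rule norm_triangle_ineq4)
      also have "norm (h (x - u)) \<le> (norm (h (x - u)))\<^sup>2 + 1"
        by (rule le_power2_add_1)
      finally have "ennreal (norm (h (x - u) - h x)) \<le> ennreal ((norm (h (x - u)))\<^sup>2 + (1 + norm (h x)))"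
        by (intro ennreal_leI) simp
      also have "\<dots> = ennreal ((norm (h (x - u)))\<^sup>2) + ennreal (1 + norm (h x))" by (rule ennreal_plus) auto
      finally show "ennreal (norm (h (x - u) - h x)) * indicator {-r..r} u
          \<le> ennreal ((norm (h (x - u)))\<^sup>2) + ennreal (1 + norm (h x)) * indicator {-r..r} u"
        by (simp add: indicator_def)
    qed
    also have "\<dots> = L2_energy lborel (\<lambda>u. h (x - u)) + ennreal (1 + norm (h x)) * emeasure lborel {-r..r}"
      by (subst nn_integral_add) (auto simp: nn_integral_cmult_indicator)
    also have "L2_energy lborel (\<lambda>u. h (x - u)) = ennreal H"
      unfolding H(1)[symmetric] by (rule nn_integral_real_reflect) measurable
    also have "emeasure lborel {-r..r} = ennreal (2 * r)" using r0 by (simp add: emeasure_lborel_Icc_eq)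
    also have "ennreal H + ennreal (1 + norm (h x)) * ennreal (2 * r) = ennreal (H + (1 + norm (h x)) * (2 * r))"
      using r0 H(2) by (subst ennreal_plus) (auto simp: ennreal_mult)
    also have "\<dots> \<le> ennreal (M * r)"
    proof (rule ennreal_leI)
      have "H \<le> H / d * r" using r d H(2) by (simp add: field_simps mult_left_mono)
      then show "H + (1 + norm (h x)) * (2 * r) \<le> M * r" by (simp add: M_def algebra_simps)
    qed
    finally show ?thesis .
  qed
  \<comment> \<open>Makes \<open>B * sqrt r\<close> at least \<open>M\<close> as soon as
    \<open>r \<ge> d\<close>, so that one formula covers all radii.\<close>
  define B where "B = M / sqrt d"
  have B0: "0 \<le> B" using M0 d by (simp add: B_def)
  have A_le: "A r \<le> ennreal ((e' + B * sqrt r) * r)" if r: "0 < r" for r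
  proof (cases "r < d")
    case True
    have "A r \<le> ennreal (e' * r)" by (rule d(2)[OF r True])
    also have "\<dots> \<le> ennreal ((e' + B * sqrt r) * r)"
      using r B0 by (intro ennreal_leI mult_right_mono) auto
    finally show ?thesis .
  next
    case False
    have "M = B * sqrt d" using d by (simp add: B_def)
    also have "\<dots> \<le> e' + B * sqrt r"
    proof -
      have "B * sqrt d \<le> B * sqrt r" using False B0 by (intro mult_left_mono) auto
      then show ?thesis using e' by linarith
    qed
    finally have "ennreal (M * r) \<le> ennreal ((e' + B * sqrt r) * r)"
      using r by (intro ennreal_leI mult_right_mono) auto
    moreover have "A r \<le> ennreal (M * r)" using A_large False by simp
    ultimately show ?thesis by (rule order.trans[rotated])
  qed
  \<comment> \<open>The ratio \<open>1/4 * 2 * sqrt 2\<close> between consecutive scales: the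
    weight, the length of the window and the square root of that length.\<close>
  define \<theta> :: real where "\<theta> = 1 / sqrt 2"
  have "1 < sqrt (2::real)" by simp
  then have \<theta>: "0 < \<theta>" "\<theta> < 1" by (auto simp: \<theta>_def)
  define S where "S = 1 / (1 - \<theta>)"
  have S: "0 < S" using \<theta> by (simp add: S_def)
  have bound: "(\<integral>\<^sup>+\<rho>. ennreal (1 / (1 + \<rho>\<^sup>2)) * ennreal (norm (h (x - \<delta> * \<rho>) - h x)) \<partial>lborel)
      \<le> ennreal (8 * e' + 4 * B * sqrt \<delta> * S)" if \<delta>: "0 < \<delta>" for \<delta>
  proof -
    let ?n = "\<lambda>\<rho>. ennreal (norm (h (x - \<delta> * \<rho>) - h x))"
    have scale: "(\<integral>\<^sup>+\<rho>. ?n \<rho> * indicator {- R..R} \<rho> \<partial>lborel) = ennreal (1 / \<delta>) * A (R * \<delta>)" for R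
    proof -
      have "A (R * \<delta>) = ennreal \<bar>\<delta>\<bar> * (\<integral>\<^sup>+\<rho>. ennreal (norm (h (x - (0 + \<delta> * \<rho>)) - h x)) * indicator {-(R * \<delta>)..R * \<delta>} (0 + \<delta> * \<rho>) \<partial>lborel)"
        unfolding A_def by (rule nn_integral_real_affine) (use \<delta> in \<open>auto\<close>)
      also have "(\<integral>\<^sup>+\<rho>. ennreal (norm (h (x - (0 + \<delta> * \<rho>)) - h x)) * indicator {-(R * \<delta>)..R * \<delta>} (0 + \<delta> * \<rho>) \<partial>lborel)
          = (\<integral>\<^sup>+\<rho>. ?n \<rho> * indicator {- R..R} \<rho> \<partial>lborel)"
      proof (intro nn_integral_cong)
        fix \<rho>
        have "(- (R * \<delta>) \<le> \<delta> * \<rho>) = (- R \<le> \<rho>)" "(\<delta> * \<rho> \<le> R * \<delta>) = (\<rho> \<le> R)"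
          using \<delta> mult_le_cancel_left_pos[OF \<delta>, of "- R" \<rho>] mult_le_cancel_left_pos[OF \<delta>, of \<rho> R]
          by (auto simp: mult.commute)
        then show "ennreal (norm (h (x - (0 + \<delta> * \<rho>)) - h x)) * indicator {-(R * \<delta>)..R * \<delta>} (0 + \<delta> * \<rho>)
            = ?n \<rho> * indicator {- R..R} \<rho>" by (simp add: indicator_def)
      qed
      finally have "ennreal (1 / \<delta>) * A (R * \<delta>) = (ennreal (1 / \<delta>) * ennreal \<delta>) * (\<integral>\<^sup>+\<rho>. ?n \<rho> * indicator {- R..R} \<rho> \<partial>lborel)"
        using \<delta> by (simp add: mult.assoc)
      also have "ennreal (1 / \<delta>) * ennreal \<delta> = 1" using \<delta> by (simp flip: ennreal_mult)
      finally show ?thesis by simp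
    qed
    have "(\<integral>\<^sup>+\<rho>. ennreal (1 / (1 + \<rho>\<^sup>2)) * ?n \<rho> \<partial>lborel)
        \<le> (\<integral>\<^sup>+\<rho>. (\<Sum>k. ennreal (4 * (1/4) ^ k) * (?n \<rho> * indicator {- (2 ^ k)..(2 ^ k)} \<rho>)) \<partial>lborel)"
    proof (rule nn_integral_mono)
      fix \<rho>
      have "ennreal (1 / (1 + \<rho>\<^sup>2)) * ?n \<rho> \<le> (\<Sum>k. ennreal (4 * (1/4) ^ k) * indicator {- (2 ^ k)..(2 ^ k)} \<rho>) * ?n \<rho>"
        by (intro mult_right_mono inverse_1_plus_power2_le_dyadic) simp
      also have "\<dots> = (\<Sum>k. ennreal (4 * (1/4) ^ k) * indicator {- (2 ^ k)..(2 ^ k)} \<rho> * ?n \<rho>)"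
        by (rule ennreal_suminf_multc[symmetric])
      finally show "ennreal (1 / (1 + \<rho>\<^sup>2)) * ?n \<rho>
          \<le> (\<Sum>k. ennreal (4 * (1/4) ^ k) * (?n \<rho> * indicator {- (2 ^ k)..(2 ^ k)} \<rho>))"
        by (simp only: mult_ac)
    qed
    also have "\<dots> = (\<Sum>k. \<integral>\<^sup>+\<rho>. ennreal (4 * (1/4) ^ k) * (?n \<rho> * indicator {- (2 ^ k)..(2 ^ k)} \<rho>) \<partial>lborel)"
      by (rule nn_integral_suminf) measurable
    also have "\<dots> = (\<Sum>k. ennreal (4 * (1/4) ^ k) * (ennreal (1 / \<delta>) * A (2 ^ k * \<delta>)))"
      by (subst nn_integral_cmult) (measurable, simp only: scale)
    also have "\<dots> \<le> (\<Sum>k. ennreal (4 * e' * (1/2) ^ k + 4 * B * sqrt \<delta> * \<theta> ^ k))"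
    proof (intro suminf_le allI summableI)
      fix k
      have "ennreal (4 * (1/4) ^ k) * (ennreal (1 / \<delta>) * A (2 ^ k * \<delta>))
          \<le> ennreal (4 * (1/4) ^ k) * (ennreal (1 / \<delta>) * ennreal ((e' + B * sqrt (2 ^ k * \<delta>)) * (2 ^ k * \<delta>)))"
        using \<delta> by (intro mult_left_mono A_le) auto
      also have "\<dots> = ennreal (4 * (1/4) ^ k * (1 / \<delta> * ((e' + B * sqrt (2 ^ k * \<delta>)) * (2 ^ k * \<delta>))))"
      proof -
        have "0 \<le> 4 * (1/4 :: real) ^ k" "0 \<le> 1 / \<delta>" using \<delta> by auto
        then show ?thesis by (simp only: ennreal_mult'[symmetric])
      qed
      also have "4 * (1/4) ^ k * (1 / \<delta> * ((e' + B * sqrt (2 ^ k * \<delta>)) * (2 ^ k * \<delta>)))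
          = 4 * e' * ((1/4) ^ k * 2 ^ k) + 4 * B * sqrt \<delta> * ((1/4) ^ k * 2 ^ k * sqrt (2 ^ k))"
        using \<delta> by (simp add: real_sqrt_mult field_simps)
      also have "(1/4) ^ k * 2 ^ k = (1/2 :: real) ^ k" by (simp flip: power_mult_distrib)
      also have "(1/2) ^ k * sqrt (2 ^ k) = \<theta> ^ k"
      proof -
        have "1 / 2 * sqrt 2 = \<theta>" unfolding \<theta>_def by (simp add: field_simps)
        moreover have "(1/2) ^ k * sqrt (2 ^ k) = (1/2 * sqrt 2) ^ k"
          unfolding power_mult_distrib real_sqrt_power ..
        ultimately show ?thesis by (simp only:)
      qed
      finally show "ennreal (4 * (1/4) ^ k) * (ennreal (1 / \<delta>) * A (2 ^ k * \<delta>))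
          \<le> ennreal (4 * e' * (1/2) ^ k + 4 * B * sqrt \<delta> * \<theta> ^ k)" .
    qed
    also have "\<dots> = ennreal (8 * e' + 4 * B * sqrt \<delta> * S)"
    proof (rule suminf_ennreal_eq)
      have "(\<lambda>k. 4 * e' * (1/2) ^ k) sums (4 * e' * (1 / (1 - 1/2)))"
        by (intro sums_mult geometric_sums) simp
      moreover have "(\<lambda>k. 4 * B * sqrt \<delta> * \<theta> ^ k) sums (4 * B * sqrt \<delta> * S)"
        unfolding S_def using \<theta> by (intro sums_mult geometric_sums) simp
      ultimately have "(\<lambda>k. 4 * e' * (1/2) ^ k + 4 * B * sqrt \<delta> * \<theta> ^ k) sums (4 * e' * (1 / (1 - 1/2)) + 4 * B * sqrt \<delta> * S)"
        by (rule sums_add)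
      then show "(\<lambda>k. 4 * e' * (1/2) ^ k + 4 * B * sqrt \<delta> * \<theta> ^ k) sums (8 * e' + 4 * B * sqrt \<delta> * S)" by simp
      show "0 \<le> 4 * e' * (1/2) ^ k + 4 * B * sqrt \<delta> * \<theta> ^ k" for k using e' B0 \<theta> \<delta> by simp
    qed
    finally show ?thesis .
  qed
  \<comment> \<open>Solves \<open>4 * (B + 1) * S * sqrt d' = e'\<close>; \<open>B + 1\<close>
    stands in for \<open>B\<close>, which may be 0.\<close>
  define d' where "d' = (e' / (4 * (B + 1) * S))\<^sup>2"
  have d': "0 < d'" using e' B0 S by (simp add: d'_def)
  have "(\<integral>\<^sup>+\<rho>. ennreal (1 / (1 + \<rho>\<^sup>2)) * ennreal (norm (h (x - \<delta> * \<rho>) - h x)) \<partial>lborel) \<le> ennreal e"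
    if \<delta>: "0 < \<delta>" "\<delta> < d'" for \<delta>
  proof -
    have "sqrt \<delta> \<le> sqrt d'" using \<delta> by simp
    also have "\<dots> = e' / (4 * (B + 1) * S)" using e' B0 S by (simp add: d'_def)
    finally have le: "sqrt \<delta> \<le> e' / (4 * (B + 1) * S)" .
    have "c * sqrt \<delta> \<le> e'" if "sqrt \<delta> \<le> e' / c" "0 < c" for c
      using that by (simp add: pos_le_divide_eq mult.commute)
    from this[OF le] have "4 * (B + 1) * S * sqrt \<delta> \<le> e'" using B0 S by simp
    moreover have "4 * B * sqrt \<delta> * S \<le> 4 * (B + 1) * S * sqrt \<delta>" using S \<delta> by (simp add: algebra_simps)
    ultimately have "8 * e' + 4 * B * sqrt \<delta> * S \<le> e" using e unfolding e'_def by linarith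
    then show ?thesis using bound[OF \<delta>(1)] by (rule order.trans[OF _ ennreal_leI, rotated])
  qed
  with d' show ?thesis by blast
qed

text \<open>Domination by \<open>C / (1 + \<rho>\<^sup>2)\<close> is the only condition on the
  kernel, so the same limit theorem serves the Poisson kernel and the complex remainder kernel.
  Subtracting \<open>h x\<close> reduces it to the preceding approximation.\<close>

lemma lebesgue_point_kernel_tendsto:
  fixes h K :: "real \<Rightarrow> complex"
  assumes hm[measurable]: "h \<in> borel_measurable borel"
    and h2: "L2_energy lborel h < \<infinity>"
    and x: "lebesgue_point h x"
    and K[measurable]: "K \<in> borel_measurable borel" and KC: "\<And>\<rho>. norm (K \<rho>) \<le> C / (1 + \<rho>\<^sup>2)"
  shows "((\<lambda>\<delta>. \<integral>\<rho>. K \<rho> * h (x - \<delta> * \<rho>) \<partial>lborel) \<longlongrightarrow> (\<integral>\<rho>. K \<rho> \<partial>lborel) * h x) (at_right 0)"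
proof (rule tendstoI)
  fix e :: real assume e: "0 < e"
  have C0: "0 \<le> C" using order.trans[OF norm_ge_zero KC[of 0]] by simp
  define e' where "e' = e / (2 * (C + 1))"
  have e': "0 < e'" "C * e' < e" using e C0 by (auto simp: e'_def field_simps add_nonneg_pos)
  have KI: "integrable lborel K"
  proof (rule Bochner_Integration.integrable_bound)
    show "integrable lborel (\<lambda>\<rho>. C * (1 / (1 + \<rho>\<^sup>2)))"
      by (intro integrable_mult_right integrable_inverse_1_plus_power2)
    show "AE \<rho> in lborel. norm (K \<rho>) \<le> norm (C * (1 / (1 + \<rho>\<^sup>2)))"
      using KC C0 by (intro AE_I2) (simp add: abs_of_nonneg)
  qed measurable
  obtain d where d: "0 < d" "\<And>\<delta>. 0 < \<delta> \<Longrightarrow> \<delta> < d \<Longrightarrow>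
    (\<integral>\<^sup>+\<rho>. ennreal (1 / (1 + \<rho>\<^sup>2)) * ennreal (norm (h (x - \<delta> * \<rho>) - h x)) \<partial>lborel) \<le> ennreal e'"
    using lebesgue_point_approximation[OF hm h2 x e'(1)] by blast
  have "dist (\<integral>\<rho>. K \<rho> * h (x - \<delta> * \<rho>) \<partial>lborel) ((\<integral>\<rho>. K \<rho> \<partial>lborel) * h x) < e" if \<delta>: "0 < \<delta>" "\<delta> < d" for \<delta>
  proof -
    have "(\<integral>\<^sup>+\<rho>. ennreal (norm (K \<rho> * (h (x - \<delta> * \<rho>) - h x))) \<partial>lborel)
        \<le> (\<integral>\<^sup>+\<rho>. ennreal C * (ennreal (1 / (1 + \<rho>\<^sup>2)) * ennreal (norm (h (x - \<delta> * \<rho>) - h x))) \<partial>lborel)"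
    proof (rule nn_integral_mono)
      fix \<rho>
      have "norm (K \<rho>) * norm (h (x - \<delta> * \<rho>) - h x) \<le> C * (1 / (1 + \<rho>\<^sup>2)) * norm (h (x - \<delta> * \<rho>) - h x)"
        using KC[of \<rho>] by (intro mult_right_mono) auto
      then have "ennreal (norm (K \<rho> * (h (x - \<delta> * \<rho>) - h x))) \<le> ennreal (C * (1 / (1 + \<rho>\<^sup>2)) * norm (h (x - \<delta> * \<rho>) - h x))"
        by (intro ennreal_leI) (simp add: norm_mult)
      also have "\<dots> = ennreal C * (ennreal (1 / (1 + \<rho>\<^sup>2)) * ennreal (norm (h (x - \<delta> * \<rho>) - h x)))"
      proof -
        have "0 \<le> 1 / (1 + \<rho>\<^sup>2)" by simp
        then show ?thesis using C0 by (simp only: ennreal_mult' mult.assoc)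
      qed
      finally show "ennreal (norm (K \<rho> * (h (x - \<delta> * \<rho>) - h x)))
        \<le> ennreal C * (ennreal (1 / (1 + \<rho>\<^sup>2)) * ennreal (norm (h (x - \<delta> * \<rho>) - h x)))" .
    qed
    also have "\<dots> = ennreal C * (\<integral>\<^sup>+\<rho>. ennreal (1 / (1 + \<rho>\<^sup>2)) * ennreal (norm (h (x - \<delta> * \<rho>) - h x)) \<partial>lborel)"
      by (rule nn_integral_cmult) measurable
    also have "\<dots> \<le> ennreal C * ennreal e'" by (intro mult_left_mono d(2) \<delta>) simp
    also have "\<dots> = ennreal (C * e')" using C0 e' by (simp add: ennreal_mult)
    finally have le: "(\<integral>\<^sup>+\<rho>. ennreal (norm (K \<rho> * (h (x - \<delta> * \<rho>) - h x))) \<partial>lborel) \<le> ennreal (C * e')" .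
    have int: "integrable lborel (\<lambda>\<rho>. K \<rho> * (h (x - \<delta> * \<rho>) - h x))"
      unfolding integrable_iff_bounded using le_less_trans[OF le ennreal_less_top] by simp
    have "integrable lborel (\<lambda>\<rho>. K \<rho> * (h (x - \<delta> * \<rho>) - h x) + K \<rho> * h x)"
      by (intro Bochner_Integration.integrable_add int integrable_mult_left KI)
    have "(\<integral>\<rho>. K \<rho> * h (x - \<delta> * \<rho>) \<partial>lborel) = (\<integral>\<rho>. K \<rho> * (h (x - \<delta> * \<rho>) - h x) + K \<rho> * h x \<partial>lborel)"
      by (simp add: algebra_simps)
    also have "\<dots> = (\<integral>\<rho>. K \<rho> * (h (x - \<delta> * \<rho>) - h x) \<partial>lborel) + (\<integral>\<rho>. K \<rho> \<partial>lborel) * h x"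
      using int KI by simp
    finally have "dist (\<integral>\<rho>. K \<rho> * h (x - \<delta> * \<rho>) \<partial>lborel) ((\<integral>\<rho>. K \<rho> \<partial>lborel) * h x)
        = norm (\<integral>\<rho>. K \<rho> * (h (x - \<delta> * \<rho>) - h x) \<partial>lborel)" by (simp add: dist_norm)
    also have "\<dots> \<le> C * e'"
    proof -
      have "ennreal (norm (\<integral>\<rho>. K \<rho> * (h (x - \<delta> * \<rho>) - h x) \<partial>lborel)) \<le> ennreal (C * e')"
        using integral_norm_bound_ennreal[OF int] le by (rule order.trans)
      then show ?thesis using C0 e' by (simp add: ennreal_le_iff)
    qed
    finally show ?thesis using e' by linarith
  qed
  then show "\<forall>\<^sub>F \<delta> in at_right 0. dist (\<integral>\<rho>. K \<rho> * h (x - \<delta> * \<rho>) \<partial>lborel) ((\<integral>\<rho>. K \<rho> \<partial>lborel) * h x) < e"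
    using d(1) by (auto simp: eventually_at_right_field)
qed

section \<open>Truncated Hilbert transforms on the line\<close>

definition truncated_hilbert :: "(real \<Rightarrow> complex) \<Rightarrow> real \<Rightarrow> real \<Rightarrow> complex" where
  "truncated_hilbert g \<delta> x = (\<integral>u. indicator {u. \<delta> < \<bar>u\<bar>} u *\<^sub>R (g (x - u) / of_real u) \<partial>lborel)"

text \<open>The truncated kernel and the Cauchy kernel at scale 1 both decay only like
  \<open>1 / \<rho>\<close>, which is not integrable, but their difference is. Both families scale
  by dilation, so this one fixed kernel compares them at every \<delta>.\<close>

definition hilbert_remainder :: "real \<Rightarrow> complex" where
  "hilbert_remainder \<rho> = (if 1 < \<bar>\<rho>\<bar> then 1 / of_real \<rho> else 0) - cauchy_kernel 1 \<rho>"

lemma measurable_hilbert_remainder[measurable]: "hilbert_remainder \<in> borel_measurable borel"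
  unfolding hilbert_remainder_def by measurable

lemma norm_hilbert_remainder: "norm (hilbert_remainder \<rho>) \<le> 2 / (1 + \<rho>\<^sup>2)"
proof -
  define q where "q = sqrt (1 + \<rho>\<^sup>2)"
  have q: "0 < q" "q * q = 1 + \<rho>\<^sup>2" unfolding q_def by (auto simp: add_pos_nonneg)
  have nq: "norm (cauchy_kernel 1 \<rho>) = 1 / q" by (simp add: norm_cauchy_kernel q_def add.commute)
  have "1 / (q * q) * q = 1 / q" using q(1) by simp
  show ?thesis
  proof (cases "1 < \<bar>\<rho>\<bar>")
    case True
    \<comment> \<open>\<open>1 / \<rho> - 1 / (\<rho> + \<i>) = \<i> / (\<rho> * (\<rho> +
      \<i>))\<close>: the cancellation gains one power of decay.\<close>
    have "hilbert_remainder \<rho> = \<i> / of_real \<rho> * cauchy_kernel 1 \<rho>"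
    proof -
      have "of_real \<rho> \<noteq> (0::complex)" "Complex \<rho> 1 \<noteq> 0" using True by (auto simp: complex_eq_iff)
      moreover have "Complex \<rho> 1 = of_real \<rho> + \<i>" by (simp add: complex_eq_iff)
      ultimately show ?thesis using True
        by (simp add: hilbert_remainder_def cauchy_kernel_def divide_simps)
    qed
    then have "norm (hilbert_remainder \<rho>) = 1 / (\<bar>\<rho>\<bar> * q)" by (simp add: norm_mult norm_divide nq)
    also have "\<dots> \<le> 2 / (q * q)"
    proof -
      have "1 \<le> \<rho>\<^sup>2" using True by (metis less_imp_le one_le_power power2_abs)
      then have "q \<le> sqrt ((2 * \<bar>\<rho>\<bar>)\<^sup>2)" unfolding q_def by (intro real_sqrt_le_mono) (simp add: power_mult_distrib)
      then have "q \<le> \<bar>2 * \<bar>\<rho>\<bar>\<bar>" by (simp only: real_sqrt_abs)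
      then have "q \<le> 2 * \<bar>\<rho>\<bar>" by simp
      then have "q * q \<le> 2 * (\<bar>\<rho>\<bar> * q)" using q(1) by (simp add: mult_right_mono)
      moreover have "0 < \<bar>\<rho>\<bar> * q" using True q(1) by simp
      ultimately show ?thesis using q(1) by (simp add: divide_le_eq le_divide_eq field_simps)
    qed
    finally show ?thesis by (simp add: q(2))
  next
    case False
    then have "norm (hilbert_remainder \<rho>) = 1 / q" by (simp add: hilbert_remainder_def nq)
    also have "\<dots> \<le> 2 / (q * q)"
    proof -
      have "\<rho>\<^sup>2 \<le> 1" using False by (metis abs_square_le_1 not_le)
      then have "q \<le> sqrt (2\<^sup>2)" unfolding q_def by (intro real_sqrt_le_mono) simp
      then have "q \<le> 2" by simp
      then show ?thesis using q(1) by (simp add: field_simps)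
    qed
    finally show ?thesis by (simp add: q(2))
  qed
qed

lemma truncated_hilbert_tendsto_integrable:
  fixes g :: "real \<Rightarrow> complex"
  assumes g: "integrable lborel g" and g2: "L2_energy lborel g < \<infinity>"
  shows "AE x in lborel. \<exists>l. ((\<lambda>\<delta>. truncated_hilbert g \<delta> x) \<longlongrightarrow> l) (at_right 0)"
proof -
  have [measurable]: "g \<in> borel_measurable borel" using borel_measurable_integrable[OF g] by simp
  obtain h where h[measurable]: "h \<in> borel_measurable borel" and h2: "L2_energy lborel h < \<infinity>"
    and gh: "\<And>s x. 0 < s \<Longrightarrow> cauchy_transform g s x = (\<integral>y. of_real (poisson_kernel s (x - y)) * h y \<partial>lborel)"
    by (rule cauchy_transform_boundary[OF g g2]) (rule that)
  have "AE x in lborel. lebesgue_point h x" "AE x in lborel. lebesgue_point g x"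
    using h2 g2 by (auto intro!: AE_lebesgue_point integrable_on_interval_of_L2)
  then show ?thesis
  proof eventually_elim
    case (elim x)
    have scale: "(\<integral>u. F u \<partial>lborel) = \<delta> *\<^sub>R (\<integral>\<rho>. F (\<delta> * \<rho>) \<partial>lborel)" if "0 < \<delta>" for F :: "real \<Rightarrow> complex" and \<delta>
      using lborel_integral_real_affine[of \<delta> F 0] that by simp
    have gx: "integrable lborel (\<lambda>\<rho>. g (x - \<delta> * \<rho>))" if "0 < \<delta>" for \<delta>
      using lborel_integrable_real_affine[OF g, of "- \<delta>" x] that by simp
    have pk: "((\<lambda>\<delta>. \<integral>\<rho>. of_real (poisson_kernel 1 \<rho>) * h (x - \<delta> * \<rho>) \<partial>lborel)
        \<longlongrightarrow> (\<integral>\<rho>. of_real (poisson_kernel 1 \<rho>) \<partial>lborel) * h x) (at_right 0)"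
    proof (rule lebesgue_point_kernel_tendsto[OF h h2 elim(1)])
      show "norm (of_real (poisson_kernel 1 \<rho>) :: complex) \<le> 1 / (1 + \<rho>\<^sup>2)" for \<rho>
      proof -
        have "1 / (pi * (\<rho>\<^sup>2 + 1)) \<le> 1 / (1 * (\<rho>\<^sup>2 + 1))"
          using pi_ge_two by (intro frac_le mult_right_mono) (auto intro: add_nonneg_pos)
        then have "poisson_kernel 1 \<rho> \<le> 1 / (1 + \<rho>\<^sup>2)" by (simp add: poisson_kernel_def add.commute)
        then show ?thesis unfolding norm_of_real using poisson_kernel_nonneg[of 1 \<rho>] by simp
      qed
    qed measurable
    have rk: "((\<lambda>\<delta>. \<integral>\<rho>. hilbert_remainder \<rho> * g (x - \<delta> * \<rho>) \<partial>lborel)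
        \<longlongrightarrow> (\<integral>\<rho>. hilbert_remainder \<rho> \<partial>lborel) * g x) (at_right 0)"
      by (rule lebesgue_point_kernel_tendsto[OF _ g2 elim(2)]) (auto intro: norm_hilbert_remainder)
    \<comment> \<open>The substitution \<open>u = \<delta> * \<rho>\<close> removes \<delta> from
      all three kernels and leaves it in the arguments of \<open>g\<close> and \<open>h\<close>, the
      form to which the limit theorem at Lebesgue points applies.\<close>
    have eq: "truncated_hilbert g \<delta> x = (\<integral>\<rho>. hilbert_remainder \<rho> * g (x - \<delta> * \<rho>) \<partial>lborel)
        + (\<integral>\<rho>. of_real (poisson_kernel 1 \<rho>) * h (x - \<delta> * \<rho>) \<partial>lborel)" if \<delta>: "0 < \<delta>" for \<delta>
    proof -
      let ?k = "\<lambda>\<rho>::real. (if 1 < \<bar>\<rho>\<bar> then 1 / of_real \<rho> else 0 :: complex)"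
      have 1: "truncated_hilbert g \<delta> x = (\<integral>\<rho>. g (x - \<delta> * \<rho>) * ?k \<rho> \<partial>lborel)"
      proof -
        have "truncated_hilbert g \<delta> x
            = \<delta> *\<^sub>R (\<integral>\<rho>. indicator {u. \<delta> < \<bar>u\<bar>} (\<delta> * \<rho>) *\<^sub>R (g (x - \<delta> * \<rho>) / of_real (\<delta> * \<rho>)) \<partial>lborel)"
          unfolding truncated_hilbert_def by (rule scale[OF \<delta>])
        also have "\<dots> = (\<integral>\<rho>. \<delta> *\<^sub>R (indicator {u. \<delta> < \<bar>u\<bar>} (\<delta> * \<rho>) *\<^sub>R (g (x - \<delta> * \<rho>) / of_real (\<delta> * \<rho>))) \<partial>lborel)"
          by (rule integral_scaleR_right[symmetric]) 
        also have "\<dots> = (\<integral>\<rho>. g (x - \<delta> * \<rho>) * ?k \<rho> \<partial>lborel)"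
        proof (rule Bochner_Integration.integral_cong[OF refl])
          fix \<rho>
          have "\<delta> < \<bar>\<delta> * \<rho>\<bar> \<longleftrightarrow> 1 < \<bar>\<rho>\<bar>" using \<delta> by (simp add: abs_mult)
          then show "\<delta> *\<^sub>R (indicator {u. \<delta> < \<bar>u\<bar>} (\<delta> * \<rho>) *\<^sub>R (g (x - \<delta> * \<rho>) / of_real (\<delta> * \<rho>))) = g (x - \<delta> * \<rho>) * ?k \<rho>"
            using \<delta> by (auto simp: indicator_def scaleR_conv_of_real)
        qed
        finally show ?thesis .
      qed
      have 2: "cauchy_transform g \<delta> x = (\<integral>\<rho>. g (x - \<delta> * \<rho>) * cauchy_kernel 1 \<rho> \<partial>lborel)"
      proof -
        have "cauchy_transform g \<delta> x = (\<integral>u. g (x - u) * cauchy_kernel \<delta> u \<partial>lborel)"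
          unfolding cauchy_transform_def
          using integral_real_reflect[of "\<lambda>a. g a * cauchy_kernel \<delta> (x - a)" x] by simp
        also have "\<dots> = \<delta> *\<^sub>R (\<integral>\<rho>. g (x - \<delta> * \<rho>) * cauchy_kernel \<delta> (\<delta> * \<rho>) \<partial>lborel)" by (rule scale[OF \<delta>])
        also have "\<dots> = (\<integral>\<rho>. \<delta> *\<^sub>R (g (x - \<delta> * \<rho>) * cauchy_kernel \<delta> (\<delta> * \<rho>)) \<partial>lborel)"
          by (rule integral_scaleR_right[symmetric])
        also have "\<dots> = (\<integral>\<rho>. g (x - \<delta> * \<rho>) * cauchy_kernel 1 \<rho> \<partial>lborel)"
        proof (rule Bochner_Integration.integral_cong[OF refl])
          fix \<rho>
          have "Complex (\<delta> * \<rho>) \<delta> = of_real \<delta> * Complex \<rho> 1" by (simp add: complex_eq_iff)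
          then show "\<delta> *\<^sub>R (g (x - \<delta> * \<rho>) * cauchy_kernel \<delta> (\<delta> * \<rho>)) = g (x - \<delta> * \<rho>) * cauchy_kernel 1 \<rho>"
            using \<delta> by (simp add: cauchy_kernel_def scaleR_conv_of_real)
        qed
        finally show ?thesis .
      qed
      have 3: "cauchy_transform g \<delta> x = (\<integral>\<rho>. of_real (poisson_kernel 1 \<rho>) * h (x - \<delta> * \<rho>) \<partial>lborel)"
      proof -
        have "cauchy_transform g \<delta> x = (\<integral>u. of_real (poisson_kernel \<delta> u) * h (x - u) \<partial>lborel)"
          unfolding gh[OF \<delta>]
          using integral_real_reflect[of "\<lambda>y. of_real (poisson_kernel \<delta> (x - y)) * h y" x] by simp
        also have "\<dots> = \<delta> *\<^sub>R (\<integral>\<rho>. of_real (poisson_kernel \<delta> (\<delta> * \<rho>)) * h (x - \<delta> * \<rho>) \<partial>lborel)" by (rule scale[OF \<delta>])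
        also have "\<dots> = (\<integral>\<rho>. \<delta> *\<^sub>R (of_real (poisson_kernel \<delta> (\<delta> * \<rho>)) * h (x - \<delta> * \<rho>)) \<partial>lborel)"
          by (rule integral_scaleR_right[symmetric])
        also have "\<dots> = (\<integral>\<rho>. of_real (poisson_kernel 1 \<rho>) * h (x - \<delta> * \<rho>) \<partial>lborel)"
        proof (rule Bochner_Integration.integral_cong[OF refl])
          fix \<rho>
          have "\<delta> * poisson_kernel \<delta> (\<delta> * \<rho>) = poisson_kernel 1 \<rho>"
          proof -
            have "(\<delta> * \<rho>)\<^sup>2 + \<delta>\<^sup>2 = \<delta> * \<delta> * (\<rho>\<^sup>2 + 1)" by (simp add: power2_eq_square algebra_simps)
            then show ?thesis using \<delta> by (simp add: poisson_kernel_def)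
          qed
          then show "\<delta> *\<^sub>R (of_real (poisson_kernel \<delta> (\<delta> * \<rho>)) * h (x - \<delta> * \<rho>)) = of_real (poisson_kernel 1 \<rho>) * h (x - \<delta> * \<rho>)"
            by (simp add: scaleR_conv_of_real mult.assoc[symmetric] flip: of_real_mult)
        qed
        finally show ?thesis .
      qed
      have b1: "norm (?k \<rho>) \<le> 1" for \<rho> by (simp add: norm_divide)
      have b2: "norm (cauchy_kernel 1 \<rho>) \<le> 1" for \<rho> using norm_cauchy_kernel_le[of 1 \<rho>] by simp
      have i1: "integrable lborel (\<lambda>\<rho>. g (x - \<delta> * \<rho>) * ?k \<rho>)"
        by (rule integrable_mult_bounded[OF gx[OF \<delta>] _ b1]) measurable
      have i2: "integrable lborel (\<lambda>\<rho>. g (x - \<delta> * \<rho>) * cauchy_kernel 1 \<rho>)"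
        by (rule integrable_mult_bounded[OF gx[OF \<delta>] _ b2]) measurable
      have "(\<integral>\<rho>. hilbert_remainder \<rho> * g (x - \<delta> * \<rho>) \<partial>lborel)
          = (\<integral>\<rho>. g (x - \<delta> * \<rho>) * ?k \<rho> - g (x - \<delta> * \<rho>) * cauchy_kernel 1 \<rho> \<partial>lborel)"
        by (intro Bochner_Integration.integral_cong refl, subst mult.commute)
           (simp only: hilbert_remainder_def right_diff_distrib)
      also have "\<dots> = truncated_hilbert g \<delta> x - cauchy_transform g \<delta> x"
        unfolding 1 2 by (rule Bochner_Integration.integral_diff[OF i1 i2])
      finally show ?thesis using 3 by simp
    qed
    have "((\<lambda>\<delta>. truncated_hilbert g \<delta> x) \<longlongrightarrow> (\<integral>\<rho>. hilbert_remainder \<rho> \<partial>lborel) * g x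
        + (\<integral>\<rho>. of_real (poisson_kernel 1 \<rho>) \<partial>lborel) * h x) (at_right 0)"
      by (rule Lim_transform_eventually[OF tendsto_add[OF rk pk]])
         (auto simp: eq eventually_at_right_field intro: exI[of _ 1])
    then show ?case by blast
  qed
qed

lemma integrable_truncated_inverse:
  fixes g :: "real \<Rightarrow> complex"
  assumes [measurable]: "g \<in> borel_measurable borel"
    and g2: "L2_energy lborel g < \<infinity>" and \<delta>: "0 < \<delta>"
  shows "integrable lborel (\<lambda>u. indicator {u. \<delta> < \<bar>u\<bar>} u *\<^sub>R (g (x - u) / of_real u))"
proof -
  let ?k = "\<lambda>u. indicator {u. \<delta> < \<bar>u\<bar>} u *\<^sub>R (1 / of_real u) :: complex"
  obtain G where G: "L2_energy lborel g = ennreal G" "0 \<le> G"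
    using g2 by (cases "L2_energy lborel g") auto
  \<comment> \<open>For \<open>\<bar>u\<bar> > \<delta>\<close> this gives
    \<open>1 + u\<^sup>2 \<le> C * u\<^sup>2\<close>; so the truncated kernel is square integrable,
    and Cauchy-Schwarz applies.\<close>
  define C where "C = 1 + 1 / \<delta>\<^sup>2"
  have C: "0 \<le> C" by (simp add: C_def)
  have "L2_energy lborel ?k \<le> (\<integral>\<^sup>+u. ennreal (C * (1 / (1 + u\<^sup>2))) \<partial>lborel)"
  proof (intro nn_integral_mono ennreal_leI)
    fix u :: real
    show "(norm (?k u))\<^sup>2 \<le> C * (1 / (1 + u\<^sup>2))"
    proof (cases "\<delta> < \<bar>u\<bar>")
      case True
      then have "\<delta>\<^sup>2 \<le> \<bar>u\<bar>\<^sup>2" using \<delta> by (intro power_mono) auto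
      then have "1 \<le> u\<^sup>2 / \<delta>\<^sup>2" using \<delta> by simp
      then have "1 + u\<^sup>2 \<le> C * u\<^sup>2" by (simp add: C_def algebra_simps)
      moreover have "0 < u\<^sup>2" using True \<delta> by auto
      ultimately have "1 / u\<^sup>2 \<le> C / (1 + u\<^sup>2)"
        by (simp add: divide_le_eq le_divide_eq add_pos_nonneg)
      then show ?thesis using True by (simp add: norm_divide power_divide)
    qed (use C in simp)
  qed
  also have "\<dots> = ennreal (\<integral>u. C * (1 / (1 + u\<^sup>2)) \<partial>lborel)"
    using C by (intro nn_integral_eq_integral integrable_mult_right integrable_inverse_1_plus_power2) auto
  also have "\<dots> = ennreal ((sqrt (C * pi))\<^sup>2)"
    using C by (simp only: integral_mult_right_zero integral_inverse_1_plus_power2) simp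
  finally have k: "L2_energy lborel ?k \<le> ennreal ((sqrt (C * pi))\<^sup>2)" .
  have "L2_energy lborel (\<lambda>u. g (x - u)) = ennreal G"
    unfolding G(1)[symmetric] by (rule nn_integral_real_reflect) measurable
  then have "integrable lborel (\<lambda>u. ?k u * g (x - u))"
    using G(2) C by (intro cauchy_schwarz_integral(1)[OF _ _ k, of _ "sqrt G"]) auto
  then show ?thesis by (simp add: scaleR_conv_of_real divide_inverse mult_ac)
qed

text \<open>Localisation: if \<open>\<bar>x\<bar> + 1 < n\<close>, then \<open>g\<close> agrees with
  its restriction to \<open>{- n..n}\<close> within distance 1 of \<open>x\<close>, so for
  \<open>\<delta> < 1\<close> the two truncated transforms differ by a quantity independent of
  \<delta>. Countably many restrictions produce one null set.\<close>

theorem truncated_hilbert_tendsto: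
  fixes g :: "real \<Rightarrow> complex"
  assumes g[measurable]: "g \<in> borel_measurable borel"
    and g2: "L2_energy lborel g < \<infinity>"
  shows "AE x in lborel. \<exists>l. ((\<lambda>\<delta>. truncated_hilbert g \<delta> x) \<longlongrightarrow> l) (at_right 0)"
proof -
  define gn where "gn n x = indicator {- real n..real n} x *\<^sub>R g x" for n :: nat and x
  have gn[measurable]: "gn n \<in> borel_measurable borel" for n unfolding gn_def by measurable
  have gn2: "L2_energy lborel (gn n) < \<infinity>" for n
    by (rule le_less_trans[OF _ g2], rule nn_integral_mono) (simp add: gn_def indicator_def)
  have "integrable lborel (gn n)" for n
    using integrable_on_interval_of_L2[OF g g2, of "- real n" "real n"]
    by (simp add: gn_def[abs_def] set_integrable_def)
  then have "AE x in lborel. \<exists>l. ((\<lambda>\<delta>. truncated_hilbert (gn n) \<delta> x) \<longlongrightarrow> l) (at_right 0)" for n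
    using gn2 by (rule truncated_hilbert_tendsto_integrable)
  then have "AE x in lborel. \<forall>n. \<exists>l. ((\<lambda>\<delta>. truncated_hilbert (gn n) \<delta> x) \<longlongrightarrow> l) (at_right 0)"
    by (simp add: AE_all_countable)
  then show ?thesis
  proof eventually_elim
    case (elim x)
    obtain n where n: "\<bar>x\<bar> + 1 < real n" using reals_Archimedean2 by blast
    obtain l where l: "((\<lambda>\<delta>. truncated_hilbert (gn n) \<delta> x) \<longlongrightarrow> l) (at_right 0)" using elim by blast
    define c where "c = truncated_hilbert g 1 x - truncated_hilbert (gn n) 1 x"
    have eq: "truncated_hilbert (gn n) \<delta> x + c = truncated_hilbert g \<delta> x" if \<delta>: "0 < \<delta>" "\<delta> < 1" for \<delta>
    proof -
      have "truncated_hilbert g \<delta> x - truncated_hilbert (gn n) \<delta> x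
          = (\<integral>u. indicator {u. \<delta> < \<bar>u\<bar>} u *\<^sub>R (g (x - u) / of_real u)
            - indicator {u. \<delta> < \<bar>u\<bar>} u *\<^sub>R (gn n (x - u) / of_real u) \<partial>lborel)"
        unfolding truncated_hilbert_def
        by (rule Bochner_Integration.integral_diff[symmetric])
           (rule integrable_truncated_inverse[OF g g2 \<delta>(1)] integrable_truncated_inverse[OF gn gn2 \<delta>(1)])+
      also have "\<dots> = (\<integral>u. indicator {u. 1 < \<bar>u\<bar>} u *\<^sub>R (g (x - u) / of_real u)
            - indicator {u. 1 < \<bar>u\<bar>} u *\<^sub>R (gn n (x - u) / of_real u) \<partial>lborel)"
      proof (rule Bochner_Integration.integral_cong[OF refl])
        fix u
        show "indicator {u. \<delta> < \<bar>u\<bar>} u *\<^sub>R (g (x - u) / of_real u) - indicator {u. \<delta> < \<bar>u\<bar>} u *\<^sub>R (gn n (x - u) / of_real u)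
          = indicator {u. 1 < \<bar>u\<bar>} u *\<^sub>R (g (x - u) / of_real u) - indicator {u. 1 < \<bar>u\<bar>} u *\<^sub>R (gn n (x - u) / of_real u)"
        proof (cases "1 < \<bar>u\<bar>")
          case True
          then show ?thesis using \<delta> by (simp add: indicator_def)
        next
          case False
          then have "gn n (x - u) = g (x - u)" using n by (auto simp: gn_def indicator_def)
          then show ?thesis by simp
        qed
      qed
      also have "\<dots> = c"
        unfolding c_def truncated_hilbert_def
        by (rule Bochner_Integration.integral_diff)
           (rule integrable_truncated_inverse[OF g g2] integrable_truncated_inverse[OF gn gn2], simp)+
      finally show ?thesis by (simp add: algebra_simps)
    qed
    have "((\<lambda>\<delta>. truncated_hilbert g \<delta> x) \<longlongrightarrow> l + c) (at_right 0)"
      by (rule Lim_transform_eventually[OF tendsto_add[OF l tendsto_const]])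
         (auto simp: eq eventually_at_right_field intro: exI[of _ 1])
    then show ?case by blast
  qed
qed

section \<open>Plancherel's theorem\<close>

lemma lborel_integral_prod_Basis:
  fixes f :: "'a::euclidean_space \<Rightarrow> real \<Rightarrow> complex"
  assumes f: "\<And>b. b \<in> Basis \<Longrightarrow> integrable lborel (f b)"
  shows lborel_integral_prod: "(\<integral>x. (\<Prod>b\<in>Basis. f b (x \<bullet> b)) \<partial>lborel) = (\<Prod>b\<in>Basis. \<integral>t. f b t \<partial>lborel)"
    and lborel_integrable_prod: "integrable lborel (\<lambda>x. \<Prod>b\<in>Basis. f b (x \<bullet> b))"
proof -
  interpret product_sigma_finite "\<lambda>_::'a. lborel :: real measure" ..
  let ?T = "\<lambda>g. \<Sum>b\<in>Basis. g b *\<^sub>R b :: 'a"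
  have fm: "f b \<in> borel_measurable borel" if "b \<in> Basis" for b
    using borel_measurable_integrable[OF f[OF that]] by simp
  have T: "?T \<in> measurable (Pi\<^sub>M Basis (\<lambda>_. lborel)) borel" by measurable
  have meas: "(\<lambda>x. \<Prod>b\<in>Basis. f b (x \<bullet> b)) \<in> borel_measurable borel"
    by (intro borel_measurable_prod measurable_compose[OF _ fm] borel_measurable_inner) auto
  have eq: "(\<Prod>b\<in>Basis. f b (?T g \<bullet> b)) = (\<Prod>b\<in>Basis. f b (g b))" for g
    by (intro prod.cong refl) (simp add: inner_sum_left inner_Basis if_distrib cong: if_cong)
  have "(\<integral>x. (\<Prod>b\<in>Basis. f b (x \<bullet> b)) \<partial>lborel) = (\<integral>g. (\<Prod>b\<in>Basis. f b (?T g \<bullet> b)) \<partial>Pi\<^sub>M Basis (\<lambda>_. lborel))"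
    by (subst lborel_eq) (rule integral_distr[OF T meas])
  also have "\<dots> = (\<Prod>b\<in>Basis. \<integral>t. f b t \<partial>lborel)"
    unfolding eq by (rule product_integral_prod) (use f in auto)
  finally show "(\<integral>x. (\<Prod>b\<in>Basis. f b (x \<bullet> b)) \<partial>lborel) = (\<Prod>b\<in>Basis. \<integral>t. f b t \<partial>lborel)" .
  have "integrable (Pi\<^sub>M Basis (\<lambda>_. lborel)) (\<lambda>g. \<Prod>b\<in>Basis. f b (?T g \<bullet> b))"
    unfolding eq by (rule product_integrable_prod) (use f in auto)
  then show "integrable lborel (\<lambda>x. \<Prod>b\<in>Basis. f b (x \<bullet> b))"
    by (subst lborel_eq) (subst integrable_distr_eq[OF T meas])
qed

section \<open>Gaussian integrals\<close>

lemma gaussian_1d: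
  fixes s w :: real
  assumes s: "0 < s"
  shows integrable_gaussian_1d: "integrable lborel (\<lambda>t. exp (of_real (- (s\<^sup>2 * t\<^sup>2 / 2)) + \<i> * of_real (t * w)) :: complex)"
    and integral_gaussian_1d: "(\<integral>t. exp (of_real (- (s\<^sup>2 * t\<^sup>2 / 2)) + \<i> * of_real (t * w)) \<partial>lborel)
      = (of_real (sqrt (2 * pi) / s * exp (- (w\<^sup>2 / (2 * s\<^sup>2)))) :: complex)"
proof -
  let ?f = "\<lambda>w x. of_real (std_normal_density x) * iexp (w * x) :: complex"
  have int: "integrable lborel (?f w)" for w
    by (rule Bochner_Integration.integrable_bound[OF integrable_normal_density[of 1 0]]) (auto simp: norm_mult)
  have val: "(\<integral>x. ?f w x \<partial>lborel) = of_real (exp (- w\<^sup>2 / 2))" for w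
  proof -
    \<comment> \<open>The integral of a Gaussian against a character is the characteristic function
      of the standard normal law; the rest is scaling by \<open>s\<close>.\<close>
    have "char std_normal_distribution w = (\<integral>x. std_normal_density x *\<^sub>R iexp (w * x) \<partial>lborel)"
      unfolding char_def by (rule integral_density) (auto simp: normal_density_nonneg)
    then show ?thesis by (simp add: char_std_normal_distribution scaleR_conv_of_real)
  qed
  have eq: "exp (of_real (- (s\<^sup>2 * t\<^sup>2 / 2)) + \<i> * of_real (t * w)) = of_real (sqrt (2 * pi)) * ?f (w / s) (0 + s * t)" for t
  proof -
    have "of_real (std_normal_density (s * t)) * of_real (sqrt (2 * pi)) = (of_real (exp (- (s\<^sup>2 * t\<^sup>2 / 2))) :: complex)"
      unfolding of_real_mult[symmetric] by (simp add: std_normal_density_def power_mult_distrib)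
    moreover have "w / s * (s * t) = t * w" using s by simp
    moreover have "of_real (sqrt (2 * pi)) * ?f (w / s) (0 + s * t)
        = of_real (std_normal_density (s * t)) * of_real (sqrt (2 * pi)) * iexp (w / s * (s * t))"
      by (simp only: add_0 mult_ac)
    ultimately show ?thesis by (simp only: exp_add exp_of_real)
  qed
  show "integrable lborel (\<lambda>t. exp (of_real (- (s\<^sup>2 * t\<^sup>2 / 2)) + \<i> * of_real (t * w)) :: complex)"
    unfolding eq using s by (intro integrable_mult_right lborel_integrable_real_affine int) auto
  have "(\<integral>x. ?f (w / s) x \<partial>lborel) = s *\<^sub>R (\<integral>t. ?f (w / s) (0 + s * t) \<partial>lborel)"
    using lborel_integral_real_affine[of s "?f (w / s)" 0] s by simp
  then have "(\<integral>t. ?f (w / s) (0 + s * t) \<partial>lborel) = of_real (exp (- (w / s)\<^sup>2 / 2)) / of_real s"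
    using s unfolding val by (simp add: scaleR_conv_of_real field_simps)
  then show "(\<integral>t. exp (of_real (- (s\<^sup>2 * t\<^sup>2 / 2)) + \<i> * of_real (t * w)) \<partial>lborel)
      = (of_real (sqrt (2 * pi) / s * exp (- (w\<^sup>2 / (2 * s\<^sup>2)))) :: complex)"
    unfolding eq integral_mult_right_zero using s by (simp add: power_divide mult.commute)
qed

definition gauss :: "real \<Rightarrow> 'a::euclidean_space \<Rightarrow> real" where
  "gauss s x = exp (- (s\<^sup>2 * (x \<bullet> x) / 2))"

lemma measurable_gauss[measurable]: "gauss s \<in> borel_measurable borel"
  unfolding gauss_def by measurable

lemma gauss_pos: "0 < gauss s x" and gauss_le_1: "gauss s x \<le> 1"
  by (auto simp: gauss_def)

lemma gauss_eq_prod: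
  fixes x u :: "'a::euclidean_space"
  shows "of_real (gauss s x) * cis (x \<bullet> u)
    = (\<Prod>b\<in>Basis. exp (of_real (- (s\<^sup>2 * (x \<bullet> b)\<^sup>2 / 2)) + \<i> * of_real ((x \<bullet> b) * (u \<bullet> b))))"
proof -
  have "(\<Prod>b\<in>Basis. exp (of_real (- (s\<^sup>2 * (x \<bullet> b)\<^sup>2 / 2)) + \<i> * of_real ((x \<bullet> b) * (u \<bullet> b))))
      = exp (\<Sum>b\<in>Basis. of_real (- (s\<^sup>2 * (x \<bullet> b)\<^sup>2 / 2)) + \<i> * of_real ((x \<bullet> b) * (u \<bullet> b)))"
    by (simp only: exp_sum[OF finite_Basis])
  also have "(\<Sum>b\<in>Basis. of_real (- (s\<^sup>2 * (x \<bullet> b)\<^sup>2 / 2)) + \<i> * of_real ((x \<bullet> b) * (u \<bullet> b)))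
      = of_real (- (s\<^sup>2 * (x \<bullet> x) / 2)) + \<i> * of_real (x \<bullet> u)"
    unfolding sum.distrib euclidean_inner[of x x] euclidean_inner[of x u]
    by (simp add: sum_distrib_left sum_negf sum_divide_distrib power2_eq_square)
  finally show ?thesis unfolding gauss_def cis_conv_exp exp_add exp_of_real by (rule sym)
qed

text \<open>The total mass of \<open>gauss s\<close>; the type argument supplies the
  dimension.\<close>

definition gauss_const :: "'a::euclidean_space itself \<Rightarrow> real \<Rightarrow> real" where
  "gauss_const _ s = (sqrt (2 * pi) / s) ^ DIM('a)"

lemma integrable_gauss_cis:
  fixes u :: "'a::euclidean_space"
  assumes s: "0 < s"
  shows "integrable lborel (\<lambda>x. of_real (gauss s x) * cis (x \<bullet> u))"
  unfolding gauss_eq_prod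
  by (rule lborel_integrable_prod[of "\<lambda>b t. exp (of_real (- (s\<^sup>2 * t\<^sup>2 / 2)) + \<i> * of_real (t * (u \<bullet> b)))"])
     (rule integrable_gaussian_1d[OF s])

lemma integral_gauss_cis:
  fixes u :: "'a::euclidean_space"
  assumes s: "0 < s"
  shows "(\<integral>x. of_real (gauss s x) * cis (x \<bullet> u) \<partial>lborel) = of_real (gauss_const TYPE('a) s * gauss (1 / s) u)"
proof -
  have "(\<integral>x. of_real (gauss s x) * cis (x \<bullet> u) \<partial>lborel)
      = (\<Prod>b\<in>Basis. \<integral>t. exp (of_real (- (s\<^sup>2 * t\<^sup>2 / 2)) + \<i> * of_real (t * (u \<bullet> b))) \<partial>lborel)"
    unfolding gauss_eq_prod
    by (rule lborel_integral_prod[of "\<lambda>b t. exp (of_real (- (s\<^sup>2 * t\<^sup>2 / 2)) + \<i> * of_real (t * (u \<bullet> b)))"])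
       (rule integrable_gaussian_1d[OF s])
  also have "\<dots> = of_real (\<Prod>b\<in>Basis. sqrt (2 * pi) / s * exp (- ((u \<bullet> b)\<^sup>2 / (2 * s\<^sup>2))))"
    unfolding integral_gaussian_1d[OF s] by (rule of_real_prod[symmetric])
  also have "(\<Prod>b\<in>Basis. sqrt (2 * pi) / s * exp (- ((u \<bullet> b)\<^sup>2 / (2 * s\<^sup>2))))
      = gauss_const TYPE('a) s * (\<Prod>b\<in>Basis. exp (- ((u \<bullet> b)\<^sup>2 / (2 * s\<^sup>2))))"
    unfolding prod.distrib by (simp add: gauss_const_def)
  also have "(\<Prod>b\<in>Basis. exp (- ((u \<bullet> b)\<^sup>2 / (2 * s\<^sup>2)))) = gauss (1 / s) u"
    unfolding exp_sum[OF finite_Basis, symmetric] gauss_def euclidean_inner[of u u]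
    by (simp add: sum_negf sum_divide_distrib power2_eq_square mult_ac)
  finally show ?thesis .
qed

lemma gauss_integral:
  assumes s: "0 < s"
  shows integrable_gauss: "integrable lborel (gauss s :: 'a::euclidean_space \<Rightarrow> real)"
    and integral_gauss: "(\<integral>x. gauss s (x::'a) \<partial>lborel) = gauss_const TYPE('a) s"
proof -
  have "integrable lborel (\<lambda>x::'a. of_real (gauss s x) :: complex)"
    using integrable_gauss_cis[OF s, of 0] by (simp add: cis_zero)
  from integrable_Re[OF this] show i: "integrable lborel (gauss s :: 'a \<Rightarrow> real)" by simp
  have "(\<integral>x. of_real (gauss s (x::'a)) \<partial>lborel) = (of_real (gauss_const TYPE('a) s) :: complex)"
    using integral_gauss_cis[OF s, of "0::'a"] by (simp add: cis_zero gauss_def)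
  then show "(\<integral>x. gauss s (x::'a) \<partial>lborel) = gauss_const TYPE('a) s" by simp
qed

lemma gauss_const_mult: "0 < s \<Longrightarrow> gauss_const TYPE('a::euclidean_space) s * gauss_const TYPE('a) (1 / s) = (2 * pi) ^ DIM('a)"
proof -
  assume "0 < s"
  then have "sqrt (2 * pi) / s * (sqrt (2 * pi) / (1 / s)) = 2 * pi" by simp
  then show ?thesis by (simp only: gauss_const_def power_mult_distrib[symmetric])
qed

lemma gauss_const_pos: "0 < s \<Longrightarrow> 0 < gauss_const TYPE('a::euclidean_space) s"
  by (simp add: gauss_const_def)

text \<open>This kernel is the Fourier transform of \<open>gauss s\<close>. It concentrates at
  \<open>a\<close> as \<open>s\<close> tends to 0 while its mass stays fixed, and that mass is the
  constant in Plancherel's theorem.\<close>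

lemma nn_integral_gauss_kernel:
  fixes a :: "'a::euclidean_space"
  assumes s: "0 < s"
  shows "(\<integral>\<^sup>+u. ennreal (gauss_const TYPE('a) s * gauss (1 / s) (u - a)) \<partial>lborel) = ennreal ((2 * pi) ^ DIM('a))"
proof -
  have "(\<integral>\<^sup>+u. ennreal (gauss_const TYPE('a) s * gauss (1 / s) (u - a)) \<partial>lborel)
      = (\<integral>\<^sup>+u. ennreal (gauss_const TYPE('a) s * gauss (1 / s) (u::'a)) \<partial>lborel)"
    using nn_integral_lborel_translate[of "\<lambda>u::'a. ennreal (gauss_const TYPE('a) s * gauss (1 / s) u)" "- a"] by simp
  also have "\<dots> = ennreal (\<integral>u. gauss_const TYPE('a) s * gauss (1 / s) (u::'a) \<partial>lborel)"
    using s gauss_const_pos[OF s, where 'a='a]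
    by (intro nn_integral_eq_integral integrable_mult_right integrable_gauss) (auto intro!: mult_nonneg_nonneg less_imp_le[OF gauss_pos])
  also have "(\<integral>u. gauss_const TYPE('a) s * gauss (1 / s) (u::'a) \<partial>lborel) = (2 * pi) ^ DIM('a)"
    using s by (simp add: integral_gauss gauss_const_mult)
  finally show ?thesis .
qed

section \<open>The Fourier transform and Gaussian summation\<close>

definition fourier :: "('a::euclidean_space \<Rightarrow> complex) \<Rightarrow> 'a \<Rightarrow> complex" where
  "fourier F \<xi> = (\<integral>x. F x * cis (- (\<xi> \<bullet> x)) \<partial>lborel)"

lemma borel_measurable_cis_comp[measurable (raw)]:
  "f \<in> borel_measurable M \<Longrightarrow> (\<lambda>x. cis (f x)) \<in> borel_measurable M"
  by (rule borel_measurable_continuous_on[of cis]) (auto intro: continuous_intros)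

lemma measurable_fourier[measurable]:
  assumes [measurable]: "F \<in> borel_measurable borel"
  shows "fourier F \<in> borel_measurable borel"
  unfolding fourier_def by measurable

context
  fixes F :: "'a::euclidean_space \<Rightarrow> complex"
  assumes F_int: "integrable lborel F"
begin

lemma fourier_F_borel[measurable]: "F \<in> borel_measurable borel"
  using borel_measurable_integrable[OF F_int] by simp

text \<open>The transform of an integrable function need not be square integrable. The weight
  \<open>gauss s\<close> makes all integrals absolutely convergent, and both halves of Plancherel's
  theorem follow from this identity as \<open>s\<close> tends to 0.\<close>

lemma fourier_gauss_form:
  assumes s: "0 < s"
  defines "\<Gamma> \<equiv> \<lambda>u::'a. gauss_const TYPE('a) s * gauss (1 / s) u"
  shows "(\<integral>\<^sup>+\<xi>. ennreal ((norm (fourier F \<xi>))\<^sup>2 * gauss s \<xi>) \<partial>lborel)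
      = ennreal (Re (\<integral>p. F (fst p) * cnj (F (snd p)) * of_real (\<Gamma> (snd p - fst p)) \<partial>lborel))"
    "integrable lborel (\<lambda>p. F (fst p) * cnj (F (snd p)) * of_real (\<Gamma> (snd p - fst p)))"
proof -
  \<comment> \<open>The weight is shared as a square root between the two factors, which makes the
    identity an instance of \<open>integral_kernel_sesquilinear\<close> with equal kernels.\<close>
  define k where "k a \<xi> = of_real (sqrt (gauss s \<xi>)) * cis (- (\<xi> \<bullet> a))" for a \<xi> :: 'a
  have kk: "k a \<xi> * cnj (k b \<xi>) = of_real (gauss s \<xi>) * cis (\<xi> \<bullet> (b - a))" for a b \<xi>
  proof -
    have "of_real (sqrt (gauss s \<xi>)) * of_real (sqrt (gauss s \<xi>)) = (of_real (gauss s \<xi>) :: complex)"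
      using gauss_pos[of s \<xi>] by (simp flip: of_real_mult)
    then have "k a \<xi> * cnj (k b \<xi>) = of_real (gauss s \<xi>) * (cis (- (\<xi> \<bullet> a)) * cis (\<xi> \<bullet> b))"
      by (simp add: k_def cis_cnj mult_ac)
    also have "cis (- (\<xi> \<bullet> a)) * cis (\<xi> \<bullet> b) = cis (\<xi> \<bullet> (b - a))"
      by (simp add: cis_mult inner_diff_right)
    finally show ?thesis .
  qed
  have m: "(\<lambda>(a, \<xi>). k a \<xi>) \<in> borel_measurable (borel \<Otimes>\<^sub>M borel)" unfolding k_def by measurable
  have b: "norm (k a \<xi>) \<le> 1" for a \<xi>
    using gauss_pos[of s \<xi>] gauss_le_1[of s \<xi>] by (simp add: k_def norm_mult)
  have i: "integrable lborel (\<lambda>\<xi>. k a \<xi> * cnj (k b \<xi>))" for a b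
    unfolding kk by (rule integrable_gauss_cis[OF s])
  have l: "(\<integral>\<xi>. norm (k a \<xi> * cnj (k b \<xi>)) \<partial>lborel) \<le> gauss_const TYPE('a) s" for a b
    unfolding kk by (simp add: norm_mult integral_gauss[OF s] abs_of_pos[OF gauss_pos])
  have v: "(\<integral>\<xi>. k a \<xi> * cnj (k b \<xi>) \<partial>lborel) = of_real (\<Gamma> (b - a))" for a b
    unfolding kk \<Gamma>_def by (rule integral_gauss_cis[OF s])
  note K = integral_kernel_sesquilinear[OF F_int m m b b i l, unfolded v]
  show "integrable lborel (\<lambda>p. F (fst p) * cnj (F (snd p)) * of_real (\<Gamma> (snd p - fst p)))"
    by (rule K(3))
  have tr: "(\<integral>a. F a * k a \<xi> \<partial>lborel) = of_real (sqrt (gauss s \<xi>)) * fourier F \<xi>" for \<xi>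
    unfolding fourier_def k_def
    by (simp only: mult.left_commute[where a = "of_real (sqrt (gauss s \<xi>))"] integral_mult_right_zero)
  have eq: "(\<integral>a. F a * k a \<xi> \<partial>lborel) * cnj (\<integral>a. F a * k a \<xi> \<partial>lborel)
      = of_real ((norm (fourier F \<xi>))\<^sup>2 * gauss s \<xi>)" for \<xi>
  proof -
    have "(\<integral>a. F a * k a \<xi> \<partial>lborel) * cnj (\<integral>a. F a * k a \<xi> \<partial>lborel)
      = of_real ((norm (of_real (sqrt (gauss s \<xi>)) * fourier F \<xi>))\<^sup>2)"
      unfolding tr by (rule complex_norm_square[symmetric])
    then show ?thesis using gauss_pos[of s \<xi>] by (simp add: norm_mult power_mult_distrib mult.commute)
  qed
  have int: "integrable lborel (\<lambda>\<xi>. (norm (fourier F \<xi>))\<^sup>2 * gauss s \<xi>)"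
    using K(1)[THEN integrable_Re] unfolding eq by simp
  have "(\<integral>\<^sup>+\<xi>. ennreal ((norm (fourier F \<xi>))\<^sup>2 * gauss s \<xi>) \<partial>lborel)
      = ennreal (\<integral>\<xi>. (norm (fourier F \<xi>))\<^sup>2 * gauss s \<xi> \<partial>lborel)"
    by (rule nn_integral_eq_integral[OF int]) (auto intro!: mult_nonneg_nonneg less_imp_le[OF gauss_pos])
  also have "(\<integral>\<xi>. (norm (fourier F \<xi>))\<^sup>2 * gauss s \<xi> \<partial>lborel)
      = Re (\<integral>p. F (fst p) * cnj (F (snd p)) * of_real (\<Gamma> (snd p - fst p)) \<partial>lborel)"
    using arg_cong[OF K(2), of Re] unfolding eq integral_complex_of_real Re_complex_of_real .
  finally show "(\<integral>\<^sup>+\<xi>. ennreal ((norm (fourier F \<xi>))\<^sup>2 * gauss s \<xi>) \<partial>lborel)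
      = ennreal (Re (\<integral>p. F (fst p) * cnj (F (snd p)) * of_real (\<Gamma> (snd p - fst p)) \<partial>lborel))" .
qed

lemma gauss_tendsto_1: "(\<lambda>n. gauss (1 / real (Suc n)) \<xi>) \<longlonglongrightarrow> 1"
proof -
  have "(\<lambda>n. 1 / real (Suc n)) \<longlonglongrightarrow> 0" by (rule LIMSEQ_inverse_real_of_nat[unfolded inverse_eq_divide])
  then have "(\<lambda>n. exp (- ((1 / real (Suc n))\<^sup>2 * (\<xi> \<bullet> \<xi>) / 2))) \<longlonglongrightarrow> exp (- (0\<^sup>2 * (\<xi> \<bullet> \<xi>) / 2))"
    by (intro tendsto_intros) auto
  then show ?thesis by (simp add: gauss_def)
qed

text \<open>Schur's test: \<open>norm (F a) * norm (F b)\<close> is at most the mean of the two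
  squares, and the Gaussian kernel has the same mass in either variable. Fatou's lemma then removes
  the weight.\<close>

lemma nn_integral_fourier_le:
  "L2_energy lborel (fourier F)
    \<le> ennreal ((2 * pi) ^ DIM('a)) * L2_energy lborel F"
proof -
  let ?R = "ennreal ((2 * pi) ^ DIM('a)) * L2_energy lborel F"
  have le: "(\<integral>\<^sup>+\<xi>. ennreal ((norm (fourier F \<xi>))\<^sup>2 * gauss s \<xi>) \<partial>lborel) \<le> ?R" if s: "0 < s" for s
  proof -
    define \<Gamma> where "\<Gamma> u = gauss_const TYPE('a) s * gauss (1 / s) u" for u :: 'a
    have [measurable]: "\<Gamma> \<in> borel_measurable borel" unfolding \<Gamma>_def by measurable
    have \<Gamma>0: "0 \<le> \<Gamma> u" for u
      unfolding \<Gamma>_def using gauss_const_pos[OF s, where 'a='a] gauss_pos[of "1 / s" u] by simp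
    have \<Gamma>sym: "\<Gamma> (a - b) = \<Gamma> (b - a)" for a b
      unfolding \<Gamma>_def gauss_def by (simp add: inner_diff_left inner_diff_right inner_commute algebra_simps)
    have \<Gamma>1: "(\<integral>\<^sup>+u. ennreal (\<Gamma> (u - a)) \<partial>lborel) = ennreal ((2 * pi) ^ DIM('a))" for a
      unfolding \<Gamma>_def by (rule nn_integral_gauss_kernel[OF s])
    note form = fourier_gauss_form[OF s, folded \<Gamma>_def]
    let ?N = "\<lambda>a. ennreal ((norm (F a))\<^sup>2)"
    have dbl: "(\<integral>\<^sup>+a. (\<integral>\<^sup>+b. ?N a * ennreal (\<Gamma> (b - a)) \<partial>lborel) \<partial>lborel) = ?R"
      by (simp add: nn_integral_cmult \<Gamma>1 nn_integral_multc mult.commute)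
    have dbl': "(\<integral>\<^sup>+a. (\<integral>\<^sup>+b. ?N b * ennreal (\<Gamma> (b - a)) \<partial>lborel) \<partial>lborel) = ?R"
    proof -
      have "(\<integral>\<^sup>+a. (\<integral>\<^sup>+b. ?N b * ennreal (\<Gamma> (b - a)) \<partial>lborel) \<partial>lborel)
          = (\<integral>\<^sup>+b. (\<integral>\<^sup>+a. ?N b * ennreal (\<Gamma> (b - a)) \<partial>lborel) \<partial>lborel)"
        by (rule lborel_pair.Fubini') measurable
      also have "\<dots> = ?R" unfolding dbl[symmetric] by (simp only: \<Gamma>sym)
      finally show ?thesis .
    qed
    have "ennreal (Re (\<integral>p. F (fst p) * cnj (F (snd p)) * of_real (\<Gamma> (snd p - fst p)) \<partial>lborel))
        \<le> ennreal (norm (\<integral>p. F (fst p) * cnj (F (snd p)) * of_real (\<Gamma> (snd p - fst p)) \<partial>lborel))"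
      by (intro ennreal_leI complex_Re_le_cmod)
    also have "\<dots> \<le> (\<integral>\<^sup>+p. ennreal (norm (F (fst p) * cnj (F (snd p)) * of_real (\<Gamma> (snd p - fst p)))) \<partial>lborel)"
      by (rule integral_norm_bound_ennreal[OF form(2)])
    also have "\<dots> = (\<integral>\<^sup>+p. ennreal (norm (F (fst p) * cnj (F (snd p)) * of_real (\<Gamma> (snd p - fst p)))) \<partial>(lborel \<Otimes>\<^sub>M lborel))"
      by (simp only: lborel_prod)
    also have "\<dots> = (\<integral>\<^sup>+a. (\<integral>\<^sup>+b. ennreal (norm (F a * cnj (F b) * of_real (\<Gamma> (b - a)))) \<partial>lborel) \<partial>lborel)"
      by (subst lborel.nn_integral_fst[symmetric]) auto
    also have "\<dots> \<le> (\<integral>\<^sup>+a. (\<integral>\<^sup>+b. ennreal (1/2) * (?N a * ennreal (\<Gamma> (b - a))) + ennreal (1/2) * (?N b * ennreal (\<Gamma> (b - a))) \<partial>lborel) \<partial>lborel)"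
    proof (intro nn_integral_mono)
      fix a b
      have "norm (F a) * norm (F b) \<le> ((norm (F a))\<^sup>2 + (norm (F b))\<^sup>2) / 2"
        using sum_squares_bound[of "norm (F a)" "norm (F b)"] by simp
      then have "norm (F a) * norm (F b) * \<Gamma> (b - a) \<le> ((norm (F a))\<^sup>2 + (norm (F b))\<^sup>2) / 2 * \<Gamma> (b - a)"
        by (rule mult_right_mono[OF _ \<Gamma>0])
      also have "\<dots> = 1/2 * ((norm (F a))\<^sup>2 * \<Gamma> (b - a)) + 1/2 * ((norm (F b))\<^sup>2 * \<Gamma> (b - a))"
        by (simp add: field_simps)
      finally have "ennreal (norm (F a * cnj (F b) * of_real (\<Gamma> (b - a))))
          \<le> ennreal (1/2 * ((norm (F a))\<^sup>2 * \<Gamma> (b - a)) + 1/2 * ((norm (F b))\<^sup>2 * \<Gamma> (b - a)))"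
        using \<Gamma>0[of "b - a"] by (intro ennreal_leI) (simp add: norm_mult)
      also have "\<dots> = ennreal (1/2 * ((norm (F a))\<^sup>2 * \<Gamma> (b - a))) + ennreal (1/2 * ((norm (F b))\<^sup>2 * \<Gamma> (b - a)))"
        using \<Gamma>0 by (intro ennreal_plus) auto
      also have "\<dots> = ennreal (1/2) * (?N a * ennreal (\<Gamma> (b - a))) + ennreal (1/2) * (?N b * ennreal (\<Gamma> (b - a)))"
      proof -
        have "0 \<le> (1/2::real)" "0 \<le> (norm (F a))\<^sup>2" "0 \<le> (norm (F b))\<^sup>2" by auto
        then show ?thesis by (simp only: ennreal_mult')
      qed
      finally show "ennreal (norm (F a * cnj (F b) * of_real (\<Gamma> (b - a))))
          \<le> ennreal (1/2) * (?N a * ennreal (\<Gamma> (b - a))) + ennreal (1/2) * (?N b * ennreal (\<Gamma> (b - a)))" .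
    qed
    also have "\<dots> = ennreal (1/2) * ?R + ennreal (1/2) * ?R"
    proof -
      have "(\<integral>\<^sup>+a. (\<integral>\<^sup>+b. ennreal (1/2) * (?N a * ennreal (\<Gamma> (b - a))) + ennreal (1/2) * (?N b * ennreal (\<Gamma> (b - a))) \<partial>lborel) \<partial>lborel)
          = ennreal (1/2) * (\<integral>\<^sup>+a. (\<integral>\<^sup>+b. ?N a * ennreal (\<Gamma> (b - a)) \<partial>lborel) \<partial>lborel)
            + ennreal (1/2) * (\<integral>\<^sup>+a. (\<integral>\<^sup>+b. ?N b * ennreal (\<Gamma> (b - a)) \<partial>lborel) \<partial>lborel)"
        by (simp add: nn_integral_add nn_integral_cmult del: ennreal_half)
      then show ?thesis unfolding dbl dbl' .
    qed
    also have "\<dots> = ?R"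
    proof -
      have "ennreal (1/2) + ennreal (1/2) = ennreal (1/2 + 1/2)" by (rule ennreal_plus[symmetric]) auto
      then have "ennreal (1/2) + ennreal (1/2) = 1" by simp
      then have "(ennreal (1/2) + ennreal (1/2)) * ?R = 1 * ?R" by (simp only:)
      then show ?thesis by (simp only: distrib_right mult_1)
    qed
    finally show ?thesis unfolding form(1) .
  qed
  have "L2_energy lborel (fourier F)
      = (\<integral>\<^sup>+\<xi>. liminf (\<lambda>n. ennreal ((norm (fourier F \<xi>))\<^sup>2 * gauss (1 / real (Suc n)) \<xi>)) \<partial>lborel)"
  proof (rule nn_integral_cong)
    fix \<xi>
    have "(\<lambda>n. ennreal ((norm (fourier F \<xi>))\<^sup>2 * gauss (1 / real (Suc n)) \<xi>)) \<longlonglongrightarrow> ennreal ((norm (fourier F \<xi>))\<^sup>2 * 1)"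
      by (intro tendsto_ennrealI tendsto_mult tendsto_const gauss_tendsto_1)
    from lim_imp_Liminf[OF sequentially_bot this]
    show "ennreal ((norm (fourier F \<xi>))\<^sup>2) = liminf (\<lambda>n. ennreal ((norm (fourier F \<xi>))\<^sup>2 * gauss (1 / real (Suc n)) \<xi>))"
      by (simp only: mult_1_right)
  qed
  also have "\<dots> \<le> liminf (\<lambda>n. \<integral>\<^sup>+\<xi>. ennreal ((norm (fourier F \<xi>))\<^sup>2 * gauss (1 / real (Suc n)) \<xi>) \<partial>lborel)"
    by (rule nn_integral_liminf) measurable
  also have "\<dots> \<le> ?R"
  proof (rule Liminf_le)
    show "\<forall>\<^sub>F n in sequentially. (\<integral>\<^sup>+\<xi>. ennreal ((norm (fourier F \<xi>))\<^sup>2 * gauss (1 / real (Suc n)) \<xi>) \<partial>lborel) \<le> ?R"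
      by (intro always_eventually allI le) (simp only: zero_less_divide_1_iff of_nat_0_less_iff zero_less_Suc)
  qed simp
  finally show ?thesis .
qed

text \<open>In the Gaussian form the inner integral is, up to the constant, an average of
  \<open>F\<close> around \<open>a\<close>. Continuity makes it converge at every point and
  boundedness dominates it, so the form tends to the constant times the energy of \<open>F\<close>;
  \<open>gauss_le_1\<close> then discards the weight.\<close>

lemma nn_integral_fourier_ge_continuous:
  assumes cont: "continuous_on UNIV F" and bdd: "\<And>x. norm (F x) \<le> B"
    and F2: "integrable lborel (\<lambda>x. (norm (F x))\<^sup>2)"
  shows "ennreal ((2 * pi) ^ DIM('a)) * L2_energy lborel F
    \<le> L2_energy lborel (fourier F)"
proof -
  define c where "c = (2 * pi) ^ DIM('a)"
  have c: "0 < c" by (simp add: c_def)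
  have B0: "0 \<le> B" using order.trans[OF norm_ge_zero bdd] .
  define s where "s n = 1 / real (Suc n)" for n
  have s: "0 < s n" for n by (simp add: s_def)
  have s0: "s \<longlonglongrightarrow> 0" unfolding s_def by (rule LIMSEQ_inverse_real_of_nat[unfolded inverse_eq_divide])
  define g where "g z = gauss_const TYPE('a) 1 * gauss 1 z" for z :: 'a
  have g[measurable]: "g \<in> borel_measurable borel" unfolding g_def by measurable
  have g0: "0 \<le> g z" for z
    unfolding g_def using gauss_const_pos[of 1, where 'a='a] gauss_pos[of 1 z] by simp
  have gi: "integrable lborel g" unfolding g_def by (intro integrable_mult_right integrable_gauss) simp
  have gI: "(\<integral>z. g z \<partial>lborel) = c"
    unfolding g_def c_def using gauss_const_mult[of 1, where 'a='a] by (simp add: integral_gauss)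
  define W where "W n a = (\<integral>z. F (a + s n *\<^sub>R z) * of_real (g z) \<partial>lborel)" for n a
  have [measurable]: "W n \<in> borel_measurable borel" for n unfolding W_def by measurable
  have bW: "norm (F (a + s n *\<^sub>R z) * of_real (g z)) \<le> B * g z" for a n z
    using mult_right_mono[OF bdd g0] g0 by (simp add: norm_mult)
  have Wlim: "(\<lambda>n. W n a) \<longlonglongrightarrow> F a * of_real c" for a
  proof -
    have "(\<lambda>n. W n a) \<longlonglongrightarrow> (\<integral>z. F a * of_real (g z) \<partial>lborel)"
      unfolding W_def
    proof (rule integral_dominated_convergence[where w = "\<lambda>z. B * g z"])
      show "integrable lborel (\<lambda>z. B * g z)" using gi by simp
      show "AE z in lborel. (\<lambda>n. F (a + s n *\<^sub>R z) * of_real (g z)) \<longlonglongrightarrow> F a * of_real (g z)"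
      proof (intro AE_I2 tendsto_mult tendsto_const)
        fix z
        have "(\<lambda>n. a + s n *\<^sub>R z) \<longlonglongrightarrow> a + 0 *\<^sub>R z" by (intro tendsto_intros s0)
        then show "(\<lambda>n. F (a + s n *\<^sub>R z)) \<longlonglongrightarrow> F a"
          using cont by (intro continuous_on_tendsto_compose[OF cont]) auto
      qed
      show "AE z in lborel. norm (F (a + s n *\<^sub>R z) * of_real (g z)) \<le> B * g z" for n
        using bW by (rule AE_I2)
    qed measurable
    then show ?thesis using gi gI by simp
  qed
  have Wb: "norm (W n a) \<le> B * c" for n a
  proof -
    have iF: "integrable lborel (\<lambda>z. F (a + s n *\<^sub>R z) * of_real (g z))"
    proof (rule Bochner_Integration.integrable_bound[OF integrable_mult_right[OF gi, of B]])
      show "AE z in lborel. norm (F (a + s n *\<^sub>R z) * of_real (g z)) \<le> norm (B * g z)"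
        unfolding real_norm_def by (intro AE_I2 order.trans[OF bW abs_ge_self])
    qed measurable
    have "norm (W n a) \<le> (\<integral>z. norm (F (a + s n *\<^sub>R z) * of_real (g z)) \<partial>lborel)"
      unfolding W_def by (rule integral_norm_bound)
    also have "\<dots> \<le> (\<integral>z. B * g z \<partial>lborel)"
      by (rule integral_mono[OF integrable_norm[OF iF] integrable_mult_right[OF gi] bW])
    also have "\<dots> = B * c" using gi gI by simp
    finally show ?thesis .
  qed
  have form: "(\<integral>\<^sup>+\<xi>. ennreal ((norm (fourier F \<xi>))\<^sup>2 * gauss (s n) \<xi>) \<partial>lborel)
      = ennreal (Re (\<integral>a. F a * cnj (W n a) \<partial>lborel))" for n
  proof -
    define \<Gamma> where "\<Gamma> u = gauss_const TYPE('a) (s n) * gauss (1 / s n) u" for u :: 'a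
    have [measurable]: "\<Gamma> \<in> borel_measurable borel" unfolding \<Gamma>_def by measurable
    note form = fourier_gauss_form[OF s[of n], folded \<Gamma>_def]
    have "integrable (lborel \<Otimes>\<^sub>M lborel) (\<lambda>(a, b). F a * cnj (F b) * of_real (\<Gamma> (b - a)))"
      using form(2) by (simp only: lborel_prod case_prod_beta')
    from lborel_pair.integral_fst[OF this]
    have "(\<integral>p. F (fst p) * cnj (F (snd p)) * of_real (\<Gamma> (snd p - fst p)) \<partial>lborel)
        = (\<integral>a. (\<integral>b. F a * cnj (F b) * of_real (\<Gamma> (b - a)) \<partial>lborel) \<partial>lborel)"
      by (simp only: lborel_prod case_prod_beta')
    also have "\<dots> = (\<integral>a. F a * cnj (W n a) \<partial>lborel)"
    proof (rule Bochner_Integration.integral_cong[OF refl])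
      fix a
      have "(\<integral>b. F b * of_real (\<Gamma> (b - a)) \<partial>lborel)
          = (\<integral>x. (s n) ^ DIM('a) *\<^sub>R (F (a + s n *\<^sub>R x) * of_real (\<Gamma> (s n *\<^sub>R x))) \<partial>lborel)"
      proof -
        have "(\<integral>b. F b * of_real (\<Gamma> (b - a)) \<partial>lborel)
            = (\<integral>b. F b * of_real (\<Gamma> (b - a)) \<partial>density (distr lborel borel (\<lambda>x. a + s n *\<^sub>R x)) (\<lambda>_. ennreal (\<bar>s n\<bar> ^ DIM('a))))"
          using lborel_affine[of "s n" a] s[of n] by simp
        also have "\<dots> = (\<integral>b. (\<bar>s n\<bar> ^ DIM('a)) *\<^sub>R (F b * of_real (\<Gamma> (b - a))) \<partial>distr lborel borel (\<lambda>x. a + s n *\<^sub>R x))"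
          by (rule integral_density) auto
        also have "\<dots> = (\<integral>x. (\<bar>s n\<bar> ^ DIM('a)) *\<^sub>R (F (a + s n *\<^sub>R x) * of_real (\<Gamma> (a + s n *\<^sub>R x - a))) \<partial>lborel)"
          by (rule integral_distr) auto
        finally show ?thesis using s[of n] by simp
      qed
      also have "\<dots> = W n a" unfolding W_def
      proof (rule Bochner_Integration.integral_cong[OF refl])
        fix x :: 'a
        have "gauss (1 / s n) (s n *\<^sub>R x) = gauss 1 x"
          using s[of n] by (simp add: gauss_def power2_eq_square)
        moreover have "s n ^ DIM('a) * gauss_const TYPE('a) (s n) = gauss_const TYPE('a) 1"
        proof -
          have "s n * (sqrt (2 * pi) / s n) = sqrt (2 * pi) / 1" using s[of n] by simp
          then show ?thesis by (simp only: gauss_const_def power_mult_distrib[symmetric])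
        qed
        ultimately have "s n ^ DIM('a) * \<Gamma> (s n *\<^sub>R x) = g x" by (simp add: \<Gamma>_def g_def mult.assoc[symmetric])
        then show "(s n) ^ DIM('a) *\<^sub>R (F (a + s n *\<^sub>R x) * of_real (\<Gamma> (s n *\<^sub>R x))) = F (a + s n *\<^sub>R x) * of_real (g x)"
          by (simp add: scaleR_conv_of_real mult.left_commute flip: of_real_mult of_real_power)
      qed
      finally have "(\<integral>b. F b * of_real (\<Gamma> (b - a)) \<partial>lborel) = W n a" .
      then have "F a * cnj (\<integral>b. F b * of_real (\<Gamma> (b - a)) \<partial>lborel) = F a * cnj (W n a)" by simp
      then show "(\<integral>b. F a * cnj (F b) * of_real (\<Gamma> (b - a)) \<partial>lborel) = F a * cnj (W n a)"
        by (simp add: mult.assoc flip: Bochner_Integration.integral_cnj)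
    qed
    finally show ?thesis unfolding form(1) by simp
  qed
  have "(\<lambda>n. \<integral>a. F a * cnj (W n a) \<partial>lborel) \<longlonglongrightarrow> (\<integral>a. F a * cnj (F a * of_real c) \<partial>lborel)"
  proof (rule integral_dominated_convergence[where w = "\<lambda>a. B * c * norm (F a)"])
    show "integrable lborel (\<lambda>a. B * c * norm (F a))" using F_int by simp
    show "AE a in lborel. (\<lambda>n. F a * cnj (W n a)) \<longlonglongrightarrow> F a * cnj (F a * of_real c)"
      by (intro AE_I2 tendsto_intros Wlim)
    show "AE a in lborel. norm (F a * cnj (W n a)) \<le> B * c * norm (F a)" for n
    proof (rule AE_I2)
      show "norm (F a * cnj (W n a)) \<le> B * c * norm (F a)" for a
        using mult_right_mono[OF Wb[of n a], of "norm (F a)"] by (simp add: norm_mult mult.commute)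
    qed
  qed measurable
  then have "(\<lambda>n. ennreal (Re (\<integral>a. F a * cnj (W n a) \<partial>lborel))) \<longlonglongrightarrow> ennreal (Re (\<integral>a. F a * cnj (F a * of_real c) \<partial>lborel))"
    by (intro tendsto_ennrealI tendsto_Re)
  moreover have "Re (\<integral>a. F a * cnj (F a * of_real c) \<partial>lborel) = c * (\<integral>a. (norm (F a))\<^sup>2 \<partial>lborel)"
  proof -
    have eq: "F a * cnj (F a * of_real c) = of_real (c * (norm (F a))\<^sup>2)" for a
      using complex_norm_square[of "F a"] by (simp add: mult_ac)
    show ?thesis
      unfolding eq integral_complex_of_real Re_complex_of_real by (rule integral_mult_right_zero)
  qed
  ultimately have "(\<lambda>n. \<integral>\<^sup>+\<xi>. ennreal ((norm (fourier F \<xi>))\<^sup>2 * gauss (s n) \<xi>) \<partial>lborel) \<longlonglongrightarrow> ennreal (c * (\<integral>a. (norm (F a))\<^sup>2 \<partial>lborel))"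
    unfolding form by simp
  then have "ennreal (c * (\<integral>a. (norm (F a))\<^sup>2 \<partial>lborel)) \<le> L2_energy lborel (fourier F)"
  proof (rule LIMSEQ_le_const2, intro exI[of _ 0] allI impI nn_integral_mono ennreal_leI)
    show "(norm (fourier F \<xi>))\<^sup>2 * gauss (s n) \<xi> \<le> (norm (fourier F \<xi>))\<^sup>2" for n \<xi>
      using mult_left_mono[OF gauss_le_1[of "s n" \<xi>], of "(norm (fourier F \<xi>))\<^sup>2"] by simp
  qed
  moreover have "ennreal (c * (\<integral>a. (norm (F a))\<^sup>2 \<partial>lborel)) = ennreal c * L2_energy lborel F"
    using c by (simp add: nn_integral_eq_integral[OF F2] ennreal_mult')
  ultimately show ?thesis by (simp add: c_def)
qed

end

section \<open>Box averages and Plancherel's inequality\<close>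

definition box_average :: "real \<Rightarrow> ('a::euclidean_space \<Rightarrow> complex) \<Rightarrow> 'a \<Rightarrow> complex" where
  "box_average r F x = (1 / r ^ DIM('a)) *\<^sub>R (\<integral>y. indicator (cbox 0 (r *\<^sub>R One)) y *\<^sub>R F (x + y) \<partial>lborel)"

lemma measure_cbox_One: "0 \<le> r \<Longrightarrow> measure lborel (cbox 0 (r *\<^sub>R One :: 'a::euclidean_space)) = r ^ DIM('a)"
  by (simp add: measure_lborel_cbox_eq inner_sum_left inner_Basis if_distrib cong: if_cong)

lemma integrable_indicator_cbox: "integrable lborel (indicator (cbox a b) :: 'a::euclidean_space \<Rightarrow> real)"
  by (rule integrable_real_indicator[OF _ emeasure_lborel_cbox_finite]) simp

context
  fixes F :: "'a::euclidean_space \<Rightarrow> complex" and r :: real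
  assumes F_int': "integrable lborel F" and r: "0 < r"
begin

lemma box_average_F_borel[measurable]: "F \<in> borel_measurable borel"
  using borel_measurable_integrable[OF F_int'] by simp

text \<open>Identifies the averages with those over cubes with lowest corner \<open>x\<close>, to
  which the continuity of the indefinite integral and the differentiation theorem apply.\<close>

lemma box_average_eq_integral:
  "box_average r F x = integral (cbox x (x + r *\<^sub>R One)) F /\<^sub>R r ^ DIM('a)"
proof -
  have "set_integrable lborel (cbox x (x + r *\<^sub>R One)) F"
    unfolding set_integrable_def using F_int' by (intro integrable_mult_indicator) auto
  from set_borel_integral_eq_integral(2)[OF this]
  have "integral (cbox x (x + r *\<^sub>R One)) F
      = (\<integral>y. indicator (cbox x (x + r *\<^sub>R One)) y *\<^sub>R F y \<partial>lborel)"
    by (simp add: set_lebesgue_integral_def)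
  also have "\<dots> = (\<integral>y. indicator (cbox x (x + r *\<^sub>R One)) (y + x) *\<^sub>R F (y + x) \<partial>lborel)"
    by (rule lborel_integral_translate[symmetric]) measurable
  also have "\<dots> = (\<integral>y. indicator (cbox 0 (r *\<^sub>R One)) y *\<^sub>R F (x + y) \<partial>lborel)"
  proof (rule Bochner_Integration.integral_cong[OF refl])
    fix y :: 'a
    have "y + x \<in> cbox x (x + r *\<^sub>R One) \<longleftrightarrow> y \<in> cbox 0 (r *\<^sub>R One)"
      by (auto simp: mem_box inner_add_left)
    then show "indicator (cbox x (x + r *\<^sub>R One)) (y + x) *\<^sub>R F (y + x) = indicator (cbox 0 (r *\<^sub>R One)) y *\<^sub>R F (x + y)"
      by (simp add: indicator_def add.commute)
  qed
  finally show ?thesis by (simp add: box_average_def divide_inverse)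
qed

lemma continuous_on_box_average: "continuous_on UNIV (box_average r F)"
proof -
  have "continuous (at x0) (\<lambda>x. integral (cbox x (x + r *\<^sub>R One)) F)" for x0 :: 'a
  proof (unfold continuous_at_eps_delta, intro allI impI)
    fix e :: real assume e: "0 < e"
    \<comment> \<open>A fixed box that contains every cube of side \<open>r\<close> whose lowest
      corner is within 1 of \<open>x0\<close>; inside it the integral depends continuously on the
      two corners.\<close>
    define a where "a = x0 - (r + 2) *\<^sub>R One"
    define b where "b = x0 + (r + 2) *\<^sub>R One"
    have near: "x \<in> cbox a b" "x + r *\<^sub>R One \<in> cbox a b" if "norm (x - x0) \<le> 1" for x
    proof -
      have le: "- 1 \<le> x \<bullet> i - x0 \<bullet> i \<and> x \<bullet> i - x0 \<bullet> i \<le> 1" if "i \<in> Basis" for i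
        using Basis_le_norm[OF that, of "x - x0"] \<open>norm (x - x0) \<le> 1\<close>
        unfolding inner_diff_left by linarith
      have ai: "a \<bullet> i = x0 \<bullet> i - (r + 2)" "b \<bullet> i = x0 \<bullet> i + (r + 2)"
        "(x + r *\<^sub>R One) \<bullet> i = x \<bullet> i + r" if "i \<in> Basis" for i
        using that by (simp_all add: a_def b_def inner_diff_left inner_add_left)
      have "a \<bullet> i \<le> x \<bullet> i \<and> x \<bullet> i \<le> b \<bullet> i \<and> a \<bullet> i \<le> (x + r *\<^sub>R One) \<bullet> i \<and> (x + r *\<^sub>R One) \<bullet> i \<le> b \<bullet> i"
        if i: "i \<in> Basis" for i
        unfolding ai[OF i] using le[OF i] r by linarith
      then show "x \<in> cbox a b" "x + r *\<^sub>R One \<in> cbox a b"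
        unfolding mem_box by blast+
    qed
    have x0: "x0 \<in> cbox a b" "x0 + r *\<^sub>R One \<in> cbox a b" using near[of x0] by auto
    have "F integrable_on cbox a b"
      using integrable_on_lborel[OF F_int'] by (rule integrable_on_subcbox) auto
    then obtain d where d: "0 < d" "\<And>c' d'. \<lbrakk>c' \<in> cbox a b; d' \<in> cbox a b; norm (c' - x0) \<le> d; norm (d' - (x0 + r *\<^sub>R One)) \<le> d\<rbrakk>
        \<Longrightarrow> norm (integral (cbox c' d') F - integral (cbox x0 (x0 + r *\<^sub>R One)) F) < e"
      by (rule indefinite_integral_continuous[OF _ x0 e]) (rule that)
    show "\<exists>d>0. \<forall>x. dist x x0 < d \<longrightarrow> dist (integral (cbox x (x + r *\<^sub>R One)) F) (integral (cbox x0 (x0 + r *\<^sub>R One)) F) < e"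
    proof (intro exI[of _ "min d 1"] conjI allI impI)
      fix x assume "dist x x0 < min d 1"
      then have "norm (x - x0) \<le> d" "norm (x - x0) \<le> 1" by (auto simp: dist_norm)
      then show "dist (integral (cbox x (x + r *\<^sub>R One)) F) (integral (cbox x0 (x0 + r *\<^sub>R One)) F) < e"
        unfolding dist_norm by (intro d(2) near) auto
    qed (use d in simp)
  qed
  then have "continuous_on UNIV (\<lambda>x. integral (cbox x (x + r *\<^sub>R One)) F)"
    by (simp add: continuous_at_imp_continuous_on)
  then show ?thesis
    unfolding box_average_eq_integral[abs_def] by (intro continuous_intros)
qed

lemma integrable_box_pair:
  "integrable (lborel \<Otimes>\<^sub>M lborel) (\<lambda>(y, x). indicator (cbox 0 (r *\<^sub>R One)) y *\<^sub>R F (x + y))"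
proof (rule lborel_pair.Fubini_integrable)
  show "(\<lambda>(y, x). indicator (cbox 0 (r *\<^sub>R One)) y *\<^sub>R F (x + y)) \<in> borel_measurable (lborel \<Otimes>\<^sub>M lborel)"
    by measurable
  have n: "(\<integral>x. norm (F (x + y)) \<partial>lborel) = (\<integral>x. norm (F x) \<partial>lborel)" for y
    by (rule lborel_integral_translate) measurable
  have "integrable lborel (\<lambda>y::'a. indicator (cbox 0 (r *\<^sub>R One)) y * (\<integral>x. norm (F x) \<partial>lborel))"
    by (intro integrable_mult_left integrable_indicator_cbox)
  then show "integrable lborel (\<lambda>y. LINT x|lborel. norm (case (y, x) of (y, x) \<Rightarrow> indicator (cbox 0 (r *\<^sub>R One)) y *\<^sub>R F (x + y)))"
    by (simp add: n)
  show "AE y in lborel. integrable lborel (\<lambda>x. case (y, x) of (y, x) \<Rightarrow> indicator (cbox 0 (r *\<^sub>R One)) y *\<^sub>R F (x + y))"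
    using lborel_integrable_translate[of F] F_int' by simp
qed

lemma integrable_box_average: "integrable lborel (box_average r F)"
  using lborel_pair.integrable_snd[OF integrable_box_pair]
  unfolding box_average_def[abs_def] by (intro integrable_scaleR_right)

lemma norm_box_average_le: "norm (box_average r F x) \<le> (\<integral>y. norm (F y) \<partial>lborel) / r ^ DIM('a)"
proof -
  have Fx: "integrable lborel (\<lambda>y. F (y + x))" using lborel_integrable_translate[of F] F_int' by simp
  have "norm (\<integral>y. indicator (cbox 0 (r *\<^sub>R One)) y *\<^sub>R F (x + y) \<partial>lborel)
      \<le> (\<integral>y. norm (indicator (cbox 0 (r *\<^sub>R One)) y *\<^sub>R F (x + y)) \<partial>lborel)"
    by (rule integral_norm_bound)
  also have "\<dots> \<le> (\<integral>y. norm (F (y + x)) \<partial>lborel)"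
    using Fx by (intro integral_mono integrable_norm integrable_mult_indicator) (auto simp: add.commute indicator_def)
  also have "\<dots> = (\<integral>y. norm (F y) \<partial>lborel)" by (rule lborel_integral_translate) measurable
  finally show ?thesis using r by (simp add: box_average_def divide_right_mono divide_inverse mult.commute mult_left_mono)
qed

text \<open>Averaging translates multiplies the transform by the mean of the characters
  \<open>cis (\<xi> \<bullet> y)\<close> over the box, a number of modulus at most 1.\<close>

lemma norm_fourier_box_average_le: "norm (fourier (box_average r F) \<xi>) \<le> norm (fourier F \<xi>)"
proof -
  let ?C = "cbox 0 (r *\<^sub>R One :: 'a)"
  have int: "integrable (lborel \<Otimes>\<^sub>M lborel) (\<lambda>(y, x). (indicator ?C y *\<^sub>R F (x + y)) * cis (- (\<xi> \<bullet> x)))"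
    using integrable_mult_bounded[OF integrable_box_pair, of "\<lambda>p. cis (- (\<xi> \<bullet> snd p))" 1]
    by (simp add: case_prod_beta')
  have tr: "(\<integral>x. F (x + y) * cis (- (\<xi> \<bullet> x)) \<partial>lborel) = cis (\<xi> \<bullet> y) * fourier F \<xi>" for y
  proof -
    have "(\<integral>x. F (x + y) * cis (- (\<xi> \<bullet> x)) \<partial>lborel) = (\<integral>x. F (x + y) * cis (- (\<xi> \<bullet> ((x + y) - y))) \<partial>lborel)" by simp
    also have "\<dots> = (\<integral>x. F x * cis (- (\<xi> \<bullet> (x - y))) \<partial>lborel)" by (rule lborel_integral_translate) measurable
    also have "\<dots> = (\<integral>x. cis (\<xi> \<bullet> y) * (F x * cis (- (\<xi> \<bullet> x))) \<partial>lborel)"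
    proof (rule Bochner_Integration.integral_cong[OF refl])
      fix x
      have "cis (- (\<xi> \<bullet> (x - y))) = cis (\<xi> \<bullet> y) * cis (- (\<xi> \<bullet> x))"
        by (simp add: cis_mult inner_diff_right)
      then show "F x * cis (- (\<xi> \<bullet> (x - y))) = cis (\<xi> \<bullet> y) * (F x * cis (- (\<xi> \<bullet> x)))"
        by (simp only: mult.left_commute)
    qed
    finally show ?thesis by (simp add: fourier_def)
  qed
  have ib: "integrable lborel (\<lambda>y. indicator ?C y *\<^sub>R cis (\<xi> \<bullet> y))"
  proof (rule Bochner_Integration.integrable_bound[of _ "indicator ?C :: 'a \<Rightarrow> real"])
    show "integrable lborel (indicator ?C :: 'a \<Rightarrow> real)"
      by (rule integrable_indicator_cbox)
  qed auto
  have "(\<integral>x. (\<integral>y. indicator ?C y *\<^sub>R F (x + y) \<partial>lborel) * cis (- (\<xi> \<bullet> x)) \<partial>lborel)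
      = (\<integral>x. (\<integral>y. (indicator ?C y *\<^sub>R F (x + y)) * cis (- (\<xi> \<bullet> x)) \<partial>lborel) \<partial>lborel)"
    by (simp only: integral_mult_left_zero)
  also have "\<dots> = (\<integral>y. (\<integral>x. (indicator ?C y *\<^sub>R F (x + y)) * cis (- (\<xi> \<bullet> x)) \<partial>lborel) \<partial>lborel)"
    using lborel_pair.Fubini_integral[OF int] by simp
  also have "\<dots> = (\<integral>y. (indicator ?C y *\<^sub>R cis (\<xi> \<bullet> y)) * fourier F \<xi> \<partial>lborel)"
    by (intro Bochner_Integration.integral_cong refl) (simp add: tr)
  also have "\<dots> = (\<integral>y. indicator ?C y *\<^sub>R cis (\<xi> \<bullet> y) \<partial>lborel) * fourier F \<xi>"
    by (rule integral_mult_left_zero)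
  finally have eq: "fourier (box_average r F) \<xi> = (1 / r ^ DIM('a)) *\<^sub>R ((\<integral>y. indicator ?C y *\<^sub>R cis (\<xi> \<bullet> y) \<partial>lborel) * fourier F \<xi>)"
    unfolding fourier_def[of "box_average r F"] box_average_def by simp
  have "norm (\<integral>y. indicator ?C y *\<^sub>R cis (\<xi> \<bullet> y) \<partial>lborel) \<le> (\<integral>y. norm (indicator ?C y *\<^sub>R cis (\<xi> \<bullet> y)) \<partial>lborel)"
    by (rule integral_norm_bound)
  also have "\<dots> = (\<integral>y. indicator ?C y \<partial>lborel)" by (intro Bochner_Integration.integral_cong refl) simp
  also have "\<dots> = r ^ DIM('a)" using r by (simp add: measure_cbox_One)
  finally have "norm (\<integral>y. indicator ?C y *\<^sub>R cis (\<xi> \<bullet> y) \<partial>lborel) / r ^ DIM('a) \<le> 1" using r by simp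
  from mult_right_mono[OF this norm_ge_zero[of "fourier F \<xi>"]]
  show ?thesis unfolding eq using r by (simp add: norm_mult)
qed

end

text \<open>Box averages of an integrable function are continuous and bounded, so the inequality
  holds for them. Their transforms are dominated by that of \<open>F\<close>, and they converge to
  \<open>F\<close> almost everywhere; Fatou's lemma passes to the limit.\<close>

theorem plancherel_le:
  fixes F :: "'a::euclidean_space \<Rightarrow> complex"
  assumes F: "integrable lborel F"
  shows "ennreal ((2 * pi) ^ DIM('a)) * L2_energy lborel F
    \<le> L2_energy lborel (fourier F)"
proof -
  define c where "c = ennreal ((2 * pi) ^ DIM('a))"
  define R where "R = L2_energy lborel (fourier F)"
  have [measurable]: "F \<in> borel_measurable borel" using borel_measurable_integrable[OF F] by simp
  define s where "s n = 1 / real (Suc n)" for n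
  have s: "0 < s n" for n by (simp add: s_def)
  have s0: "s \<longlonglongrightarrow> 0" unfolding s_def by (rule LIMSEQ_inverse_real_of_nat[unfolded inverse_eq_divide])
  define A where "A n = box_average (s n) F" for n
  have Ai: "integrable lborel (A n)" for n unfolding A_def by (rule integrable_box_average[OF F s])
  then have [measurable]: "A n \<in> borel_measurable borel" for n using borel_measurable_integrable by fastforce
  have le: "c * L2_energy lborel (A n) \<le> R" for n
  proof -
    define B where "B = (\<integral>y. norm (F y) \<partial>lborel) / s n ^ DIM('a)"
    have b: "norm (A n x) \<le> B" for x unfolding A_def B_def by (rule norm_box_average_le[OF F s])
    have "integrable lborel (\<lambda>x. (norm (A n x))\<^sup>2)"
    proof (rule Bochner_Integration.integrable_bound[OF integrable_mult_right[OF integrable_norm[OF Ai], of B]])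
      show "AE x in lborel. norm ((norm (A n x))\<^sup>2) \<le> norm (B * norm (A n x))"
        using mult_right_mono[OF b norm_ge_zero] order.trans[OF norm_ge_zero b]
        by (intro AE_I2) (simp add: power2_eq_square)
    qed measurable
    then have "c * L2_energy lborel (A n) \<le> L2_energy lborel (fourier (A n))"
      unfolding c_def
      by (intro nn_integral_fourier_ge_continuous[OF Ai _ b]) (auto simp: A_def continuous_on_box_average[OF F s])
    also have "\<dots> \<le> R" unfolding R_def A_def
      by (intro nn_integral_mono ennreal_leI power_mono norm_fourier_box_average_le[OF F s]) simp
    finally show ?thesis .
  qed
  have "F integrable_on cbox a b" for a b
    using integrable_on_lborel[OF F] by (rule integrable_on_subcbox) auto
  then obtain N where N: "negligible N" and
    lim: "\<And>x e. \<lbrakk>x \<notin> N; 0 < e\<rbrakk> \<Longrightarrow> \<exists>d>0. \<forall>h. 0 < h \<and> h < d \<longrightarrow>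
        norm (integral (cbox x (x + h *\<^sub>R One)) F /\<^sub>R h ^ DIM('a) - F x) < e"
    using integrable_ccontinuous_explicit[of F] by blast
  have "AE x in lebesgue. x \<notin> N" using N by (simp add: negligible_iff_null_sets AE_not_in)
  then have "AE x in lborel. x \<notin> N" by (simp add: AE_completion_iff)
  then have conv: "AE x in lborel. (\<lambda>n. A n x) \<longlonglongrightarrow> F x"
  proof eventually_elim
    case (elim x)
    show ?case
    proof (rule tendstoI)
      fix e :: real assume "0 < e"
      from lim[OF elim this] obtain d where "0 < d" and
        lt: "\<forall>h. 0 < h \<and> h < d \<longrightarrow> norm (integral (cbox x (x + h *\<^sub>R One)) F /\<^sub>R h ^ DIM('a) - F x) < e"
        by blast
      have "\<forall>\<^sub>F n in sequentially. s n < d" using s0 \<open>0 < d\<close> by (rule order_tendstoD(2))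
      then show "\<forall>\<^sub>F n in sequentially. dist (A n x) (F x) < e"
        by eventually_elim (use lt s in \<open>simp add: A_def box_average_eq_integral[OF F s] dist_norm\<close>)
    qed
  qed
  have "c * L2_energy lborel F
      = (\<integral>\<^sup>+x. c * ennreal ((norm (F x))\<^sup>2) \<partial>lborel)" by (rule nn_integral_cmult[symmetric]) measurable
  also have "\<dots> = (\<integral>\<^sup>+x. liminf (\<lambda>n. c * ennreal ((norm (A n x))\<^sup>2)) \<partial>lborel)"
  proof (rule nn_integral_cong_AE, use conv in eventually_elim)
    case (elim x)
    have "(\<lambda>n. c * ennreal ((norm (A n x))\<^sup>2)) \<longlonglongrightarrow> c * ennreal ((norm (F x))\<^sup>2)"
      by (intro ennreal_tendsto_cmult tendsto_ennrealI tendsto_intros elim) (simp add: c_def)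
    from lim_imp_Liminf[OF sequentially_bot this] show ?case by (rule sym)
  qed
  also have "\<dots> \<le> liminf (\<lambda>n. \<integral>\<^sup>+x. c * ennreal ((norm (A n x))\<^sup>2) \<partial>lborel)"
    by (rule nn_integral_liminf) measurable
  also have "\<dots> \<le> R"
  proof (rule Liminf_le)
    show "\<forall>\<^sub>F n in sequentially. (\<integral>\<^sup>+x. c * ennreal ((norm (A n x))\<^sup>2) \<partial>lborel) \<le> R"
      by (intro always_eventually allI) (subst nn_integral_cmult, measurable, rule le)
  qed simp
  finally show ?thesis by (simp add: c_def R_def)
qed

section \<open>Hilbert transforms along a direction\<close>

text \<open>Cut off at both ends, the kernel is integrable: convolution along a line preserves
  integrability and becomes a Fourier multiplier. One parameter drives the inner cut-off to 0 and
  the outer one to infinity.\<close>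

definition pv_kernel :: "nat \<Rightarrow> real \<Rightarrow> complex" where
  "pv_kernel n t = (if 1 / real (Suc n) < \<bar>t\<bar> \<and> \<bar>t\<bar> < real (Suc n) then 1 / of_real t else 0)"

lemma measurable_pv_kernel[measurable]: "pv_kernel n \<in> borel_measurable borel"
  unfolding pv_kernel_def by measurable

lemma pv_kernel_uminus: "pv_kernel n (- t) = - pv_kernel n t"
  by (simp add: pv_kernel_def)

lemma norm_pv_kernel_le: "norm (pv_kernel n t) \<le> real (Suc n) * indicator {- real (Suc n)..real (Suc n)} t"
proof (cases "1 / real (Suc n) < \<bar>t\<bar> \<and> \<bar>t\<bar> < real (Suc n)")
  case True
  have "1 / \<bar>t\<bar> \<le> 1 / (1 / real (Suc n))" using True by (intro frac_le) auto
  moreover have "t \<in> {- real (Suc n)..real (Suc n)}" using True unfolding abs_less_iff by auto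
  ultimately show ?thesis using True by (simp add: pv_kernel_def norm_divide)
next
  case False
  then have "pv_kernel n t = 0" by (simp only: pv_kernel_def if_False)
  then show ?thesis by simp
qed

lemma integrable_pv_kernel: "integrable lborel (pv_kernel n)"
proof (rule Bochner_Integration.integrable_bound)
  show "integrable lborel (\<lambda>t. real (Suc n) * indicator {- real (Suc n)..real (Suc n)} t)"
    by (intro integrable_mult_right integrable_real_indicator) (auto simp: emeasure_lborel_Icc_eq)
  show "AE t in lborel. norm (pv_kernel n t) \<le> norm (real (Suc n) * indicator {- real (Suc n)..real (Suc n)} t)"
    unfolding real_norm_def by (intro AE_I2 order.trans[OF norm_pv_kernel_le abs_ge_self])
qed measurable

definition pv_multiplier :: "nat \<Rightarrow> real \<Rightarrow> complex" where
  "pv_multiplier n s = (\<integral>t. pv_kernel n t * cis (- (s * t)) \<partial>lborel)"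

lemma measurable_pv_multiplier[measurable]: "pv_multiplier n \<in> borel_measurable borel"
  unfolding pv_multiplier_def by measurable

lemma integral_sinc_indicator:
  fixes \<theta> :: real
  assumes "0 \<le> T"
  shows "integrable lborel (\<lambda>t. indicator {0<..<T} t * (sin (t * \<theta>) / t))"
    "(\<integral>t. indicator {0<..<T} t * (sin (t * \<theta>) / t) \<partial>lborel) = sgn \<theta> * Si (T * \<bar>\<theta>\<bar>)"
proof -
  show "integrable lborel (\<lambda>t. indicator {0<..<T} t * (sin (t * \<theta>) / t))"
    using integrable_sinc'[of T \<theta>] assms
    by (simp add: interval_lebesgue_integrable_def set_integrable_def zero_ereal_def einterval_eq)
  show "(\<integral>t. indicator {0<..<T} t * (sin (t * \<theta>) / t) \<partial>lborel) = sgn \<theta> * Si (T * \<bar>\<theta>\<bar>)"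
    using LBINT_I0c_sin_scale_divide[OF assms, of \<theta>] assms
    by (simp add: interval_lebesgue_integral_def set_lebesgue_integral_def zero_ereal_def einterval_eq)
qed

lemma pv_multiplier_eq:
  "pv_multiplier n s = - (2 * \<i>) * of_real (sgn s * (Si (real (Suc n) * \<bar>s\<bar>) - Si (1 / real (Suc n) * \<bar>s\<bar>)))"
proof -
  define a where "a = 1 / real (Suc n)"
  define b where "b = real (Suc n)"
  have "a \<le> 1" "1 \<le> b" by (auto simp: a_def b_def)
  then have ab: "0 < a" "a \<le> b" by (simp add: a_def, linarith)
  \<comment> \<open>The integral between \<open>a\<close> and \<open>b\<close> as a difference of
    integrals from 0, which the sine integral \<open>Si\<close> evaluates.\<close>
  let ?p = "\<lambda>t. indicator {0<..<b} t * (sin (t * s) / t) - indicator {0<..<a} t * (sin (t * s) / t)"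
  have pint: "integrable lborel ?p"
    by (intro Bochner_Integration.integrable_diff integral_sinc_indicator) (use ab in auto)
  have pval: "(\<integral>t. ?p t \<partial>lborel) = sgn s * (Si (b * \<bar>s\<bar>) - Si (a * \<bar>s\<bar>))"
  proof -
    have 0: "0 \<le> b" "0 \<le> a" using ab by auto
    have "(\<integral>t. ?p t \<partial>lborel) = (\<integral>t. indicator {0<..<b} t * (sin (t * s) / t) \<partial>lborel)
        - (\<integral>t. indicator {0<..<a} t * (sin (t * s) / t) \<partial>lborel)"
      by (rule Bochner_Integration.integral_diff[OF integral_sinc_indicator(1)[OF 0(1)] integral_sinc_indicator(1)[OF 0(2)]])
    then show ?thesis unfolding integral_sinc_indicator(2)[OF 0(1)] integral_sinc_indicator(2)[OF 0(2)]
      by (simp only: right_diff_distrib)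
  qed
  have kd: "pv_kernel n t = (if a < \<bar>t\<bar> \<and> \<bar>t\<bar> < b then 1 / of_real t else 0)" for t
    by (simp only: pv_kernel_def a_def b_def)
  have ki: "integrable lborel (\<lambda>t. pv_kernel n t * cis (r * t))" for r
    by (rule integrable_mult_bounded[OF integrable_pv_kernel, of _ 1]) auto
  \<comment> \<open>The kernel is odd, so half the difference of the integrals with opposite
    characters recovers the multiplier and keeps only the sine.\<close>
  have refl: "(\<integral>t. pv_kernel n t * cis (- (s * t)) \<partial>lborel) = - (\<integral>t. pv_kernel n t * cis (s * t) \<partial>lborel)"
    using integral_real_reflect[of "\<lambda>t. pv_kernel n t * cis (- (s * t))" 0] by (simp add: pv_kernel_uminus)
  have "2 * pv_multiplier n s = (\<integral>t. pv_kernel n t * cis (- (s * t)) \<partial>lborel) - (\<integral>t. pv_kernel n t * cis (s * t) \<partial>lborel)"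
    using refl by (simp add: pv_multiplier_def)
  also have "\<dots> = (\<integral>t. pv_kernel n t * cis (- (s * t)) - pv_kernel n t * cis (s * t) \<partial>lborel)"
    using ki[of s] ki[of "- s"] by (intro Bochner_Integration.integral_diff[symmetric]) auto
  also have "\<dots> = (\<integral>t. - (2 * \<i>) * of_real (?p t + ?p (0 - t)) \<partial>lborel)"
  proof (rule integral_cong_AE)
    \<comment> \<open>Where \<open>\<bar>t\<bar> = a\<close> the kernel vanishes, but the difference
      of the two open intervals may keep that endpoint.\<close>
    have "AE t in lborel. t \<noteq> a" "AE t in lborel. t \<noteq> - a" by (rule AE_lborel_singleton)+
    then show "AE t in lborel. pv_kernel n t * cis (- (s * t)) - pv_kernel n t * cis (s * t) = - (2 * \<i>) * of_real (?p t + ?p (0 - t))"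
    proof eventually_elim
      case (elim t)
      have "cis (- (s * t)) - cis (s * t) = - (2 * \<i>) * of_real (sin (t * s))"
        by (simp add: complex_eq_iff mult.commute)
      then have "pv_kernel n t * cis (- (s * t)) - pv_kernel n t * cis (s * t)
          = - (2 * \<i>) * (pv_kernel n t * of_real (sin (t * s)))"
        by (simp only: right_diff_distrib[symmetric] mult.left_commute)
      also have "pv_kernel n t * of_real (sin (t * s)) = of_real (?p t + ?p (0 - t))"
        using elim ab unfolding kd
        by (cases "0 < t") (auto simp: indicator_def abs_if)
      finally show ?case .
    qed
  qed measurable
  also have "\<dots> = - (2 * \<i>) * of_real (\<integral>t. ?p t + ?p (0 - t) \<partial>lborel)"
    by (simp only: integral_mult_right_zero integral_complex_of_real)
  also have "(\<integral>t. ?p t + ?p (0 - t) \<partial>lborel) = 2 * (\<integral>t. ?p t \<partial>lborel)"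
  proof -
    have "(\<integral>t. ?p t + ?p (0 - t) \<partial>lborel) = (\<integral>t. ?p t \<partial>lborel) + (\<integral>t. ?p (0 - t) \<partial>lborel)"
      by (rule Bochner_Integration.integral_add[OF pint]) (use integrable_real_reflect[of ?p 0] pint in blast)
    also have "(\<integral>t. ?p (0 - t) \<partial>lborel) = (\<integral>t. ?p t \<partial>lborel)" by (rule integral_real_reflect)
    finally show ?thesis by simp
  qed
  finally have "2 * pv_multiplier n s = 2 * (- (2 * \<i>) * of_real (sgn s * (Si (b * \<bar>s\<bar>) - Si (a * \<bar>s\<bar>))))"
    unfolding pval by simp
  then show ?thesis by (simp add: a_def b_def del: of_nat_Suc)
qed

lemma pv_multiplier_bounded: "\<exists>C>0. \<forall>n s. norm (pv_multiplier n s) \<le> C"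
proof -
  obtain B where B: "\<And>T. \<bar>Si T\<bar> \<le> B" using bounded_Si by blast
  have "norm (pv_multiplier n s) \<le> 4 * B + 1" for n s
  proof -
    define X where "X = Si (real (Suc n) * \<bar>s\<bar>) - Si (1 / real (Suc n) * \<bar>s\<bar>)"
    have X: "\<bar>X\<bar> \<le> 2 * B" unfolding X_def using B[of "real (Suc n) * \<bar>s\<bar>"] B[of "1 / real (Suc n) * \<bar>s\<bar>"] by linarith
    have "norm (pv_multiplier n s) = 2 * (\<bar>sgn s\<bar> * \<bar>X\<bar>)"
      unfolding pv_multiplier_eq X_def[symmetric] by (simp add: norm_mult abs_mult)
    also have "\<dots> \<le> 2 * (1 * \<bar>X\<bar>)" by (intro mult_left_mono mult_right_mono) (auto simp: sgn_if)
    finally show ?thesis using X by simp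
  qed
  moreover have "0 < 4 * B + 1" using B[of 0] by simp
  ultimately show ?thesis by blast
qed

lemma pv_multiplier_tendsto: "(\<lambda>n. pv_multiplier n s) \<longlonglongrightarrow> - (\<i> * pi) * of_real (sgn s)"
proof (cases "s = 0")
  case False
  have l1: "filterlim (\<lambda>n. real (Suc n) * \<bar>s\<bar>) at_top sequentially"
    using False by real_asymp
  have l2: "(\<lambda>n. 1 / real (Suc n) * \<bar>s\<bar>) \<longlonglongrightarrow> 0" by real_asymp
  have "(\<lambda>n. Si (real (Suc n) * \<bar>s\<bar>)) \<longlonglongrightarrow> pi / 2" by (rule filterlim_compose[OF Si_at_top l1])
  moreover have "(\<lambda>n. Si (1 / real (Suc n) * \<bar>s\<bar>)) \<longlonglongrightarrow> Si 0"
    by (rule isCont_tendsto_compose[OF isCont_Si l2])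
  ultimately have "(\<lambda>n. pv_multiplier n s) \<longlonglongrightarrow> - (2 * \<i>) * of_real (sgn s * (pi / 2 - Si 0))"
    unfolding pv_multiplier_eq by (intro tendsto_intros)
  moreover have "Si 0 = 0" by (simp add: Si_def interval_lebesgue_integral_def set_lebesgue_integral_def zero_ereal_def)
  ultimately show ?thesis by (simp add: mult_ac)
qed (simp add: pv_multiplier_eq)

section \<open>Two-sided truncations as Fourier multipliers\<close>

definition dir_pv :: "nat \<Rightarrow> 'a::euclidean_space \<Rightarrow> ('a \<Rightarrow> complex) \<Rightarrow> 'a \<Rightarrow> complex" where
  "dir_pv n w f x = (\<integral>t. pv_kernel n t * f (x - t *\<^sub>R w) \<partial>lborel)"

lemma measurable_dir_pv[measurable]:
  fixes f :: "'a::euclidean_space \<Rightarrow> complex"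
  assumes [measurable]: "f \<in> borel_measurable borel"
  shows "dir_pv n w f \<in> borel_measurable borel"
proof -
  have "(\<lambda>(x, t). pv_kernel n t * f (x - t *\<^sub>R w)) \<in> borel_measurable (borel \<Otimes>\<^sub>M borel)"
    by measurable
  then have "(\<lambda>x. \<integral>t. pv_kernel n t * f (x - t *\<^sub>R w) \<partial>lborel) \<in> borel_measurable borel"
    by measurable
  then show ?thesis by (simp add: dir_pv_def[abs_def])
qed

context
  fixes f :: "'a::euclidean_space \<Rightarrow> complex" and w :: 'a and n :: nat
  assumes f_int: "integrable lborel f"
begin

lemma dir_pv_f_borel[measurable]: "f \<in> borel_measurable borel"
  using borel_measurable_integrable[OF f_int] by simp

lemma integrable_dir_pv_pair:
  "integrable (lborel \<Otimes>\<^sub>M lborel) (\<lambda>(t, x). pv_kernel n t * f (x - t *\<^sub>R w))"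
proof (rule lborel_pair.Fubini_integrable)
  show "(\<lambda>(t, x). pv_kernel n t * f (x - t *\<^sub>R w)) \<in> borel_measurable (lborel \<Otimes>\<^sub>M lborel)"
    by measurable
  have n: "(\<integral>x. norm (f (x - t *\<^sub>R w)) \<partial>lborel) = (\<integral>x. norm (f x) \<partial>lborel)" for t
    using lborel_integral_translate[of "\<lambda>x. norm (f x)" "- (t *\<^sub>R w)"] by simp
  show "integrable lborel (\<lambda>t. LINT x|lborel. norm (case (t, x) of (t, x) \<Rightarrow> pv_kernel n t * f (x - t *\<^sub>R w)))"
    using integrable_pv_kernel[of n] by (simp add: norm_mult n)
  show "AE t in lborel. integrable lborel (\<lambda>x. case (t, x) of (t, x) \<Rightarrow> pv_kernel n t * f (x - t *\<^sub>R w))"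
    using lborel_integrable_translate[of f "- (_ *\<^sub>R w)"] f_int by simp
qed

lemma integrable_dir_pv: "integrable lborel (dir_pv n w f)"
  using lborel_pair.integrable_snd[OF integrable_dir_pv_pair] unfolding dir_pv_def[abs_def] by simp

lemma fourier_dir_pv: "fourier (dir_pv n w f) \<xi> = pv_multiplier n (\<xi> \<bullet> w) * fourier f \<xi>"
proof -
  have int: "integrable (lborel \<Otimes>\<^sub>M lborel) (\<lambda>(t, x). (pv_kernel n t * f (x - t *\<^sub>R w)) * cis (- (\<xi> \<bullet> x)))"
    using integrable_mult_bounded[OF integrable_dir_pv_pair, of "\<lambda>p. cis (- (\<xi> \<bullet> snd p))" 1]
    by (simp add: case_prod_beta')
  have tr: "(\<integral>x. f (x - t *\<^sub>R w) * cis (- (\<xi> \<bullet> x)) \<partial>lborel) = cis (- (\<xi> \<bullet> w * t)) * fourier f \<xi>" for t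
  proof -
    have "(\<integral>x. f (x - t *\<^sub>R w) * cis (- (\<xi> \<bullet> x)) \<partial>lborel)
        = (\<integral>x. f (x + - (t *\<^sub>R w)) * cis (- (\<xi> \<bullet> ((x + - (t *\<^sub>R w)) + t *\<^sub>R w))) \<partial>lborel)" by simp
    also have "\<dots> = (\<integral>x. f x * cis (- (\<xi> \<bullet> (x + t *\<^sub>R w))) \<partial>lborel)"
      by (rule lborel_integral_translate) measurable
    also have "\<dots> = (\<integral>x. cis (- (\<xi> \<bullet> w * t)) * (f x * cis (- (\<xi> \<bullet> x))) \<partial>lborel)"
    proof (rule Bochner_Integration.integral_cong[OF refl])
      fix x
      have "cis (- (\<xi> \<bullet> (x + t *\<^sub>R w))) = cis (- (\<xi> \<bullet> w * t)) * cis (- (\<xi> \<bullet> x))"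
        by (simp add: cis_mult inner_add_right mult.commute)
      then show "f x * cis (- (\<xi> \<bullet> (x + t *\<^sub>R w))) = cis (- (\<xi> \<bullet> w * t)) * (f x * cis (- (\<xi> \<bullet> x)))"
        by (simp only: mult.left_commute)
    qed
    finally show ?thesis by (simp add: fourier_def)
  qed
  have "fourier (dir_pv n w f) \<xi> = (\<integral>x. (\<integral>t. (pv_kernel n t * f (x - t *\<^sub>R w)) * cis (- (\<xi> \<bullet> x)) \<partial>lborel) \<partial>lborel)"
    unfolding fourier_def dir_pv_def by (simp only: integral_mult_left_zero)
  also have "\<dots> = (\<integral>t. (\<integral>x. (pv_kernel n t * f (x - t *\<^sub>R w)) * cis (- (\<xi> \<bullet> x)) \<partial>lborel) \<partial>lborel)"
    using lborel_pair.Fubini_integral[OF int] by simp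
  also have "\<dots> = (\<integral>t. (pv_kernel n t * cis (- (\<xi> \<bullet> w * t))) * fourier f \<xi> \<partial>lborel)"
    by (intro Bochner_Integration.integral_cong refl) (simp only: mult.assoc integral_mult_right_zero tr)
  also have "\<dots> = pv_multiplier n (\<xi> \<bullet> w) * fourier f \<xi>"
    unfolding pv_multiplier_def by (rule integral_mult_left_zero)
  finally show ?thesis .
qed

end

lemma fourier_diff:
  assumes "integrable lborel f" "integrable lborel g"
  shows "fourier (\<lambda>x. f x - g x) \<xi> = fourier f \<xi> - fourier g \<xi>"
proof -
  have "integrable lborel (\<lambda>x. h x * cis (- (\<xi> \<bullet> x)))" if "integrable lborel h" for h
    by (rule integrable_mult_bounded[OF that, of _ 1]) auto
  then show ?thesis using assms by (simp add: fourier_def left_diff_distrib)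
qed

section \<open>The spectral measure\<close>

definition spectral_measure :: "('a::euclidean_space \<times> real \<Rightarrow> complex) \<Rightarrow> ('a \<times> real) measure" where
  "spectral_measure f = density lborel (\<lambda>\<xi>. ennreal ((norm (fourier f \<xi>))\<^sup>2 / (2 * pi) ^ DIM('a \<times> real)))"

lemma sets_spectral_measure: "sets (spectral_measure f) = sets borel"
  by (simp add: spectral_measure_def)

lemma nn_integral_spectral_measure:
  fixes f :: "'a::euclidean_space \<times> real \<Rightarrow> complex"
  assumes [measurable]: "f \<in> borel_measurable borel" "g \<in> borel_measurable borel"
  shows "(\<integral>\<^sup>+\<xi>. g \<xi> \<partial>spectral_measure f)
    = ennreal (1 / (2 * pi) ^ DIM('a \<times> real)) * (\<integral>\<^sup>+\<xi>. g \<xi> * ennreal ((norm (fourier f \<xi>))\<^sup>2) \<partial>lborel)"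
proof -
  define c where "c = (2 * pi) ^ DIM('a \<times> real)"
  have c: "0 < c" by (simp add: c_def)
  have "(\<integral>\<^sup>+\<xi>. g \<xi> \<partial>spectral_measure f) = (\<integral>\<^sup>+\<xi>. ennreal ((norm (fourier f \<xi>))\<^sup>2 / c) * g \<xi> \<partial>lborel)"
    unfolding spectral_measure_def c_def[symmetric] by (rule nn_integral_density) measurable
  also have "\<dots> = (\<integral>\<^sup>+\<xi>. ennreal (1 / c) * (g \<xi> * ennreal ((norm (fourier f \<xi>))\<^sup>2)) \<partial>lborel)"
  proof (rule nn_integral_cong)
    fix \<xi>
    have "ennreal ((norm (fourier f \<xi>))\<^sup>2 / c) = ennreal (1 / c * (norm (fourier f \<xi>))\<^sup>2)" by simp
    also have "\<dots> = ennreal (1 / c) * ennreal ((norm (fourier f \<xi>))\<^sup>2)" using c by (intro ennreal_mult) auto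
    finally show "ennreal ((norm (fourier f \<xi>))\<^sup>2 / c) * g \<xi> = ennreal (1 / c) * (g \<xi> * ennreal ((norm (fourier f \<xi>))\<^sup>2))"
      by (simp only: mult_ac)
  qed
  also have "\<dots> = ennreal (1 / c) * (\<integral>\<^sup>+\<xi>. g \<xi> * ennreal ((norm (fourier f \<xi>))\<^sup>2) \<partial>lborel)"
    by (rule nn_integral_cmult) measurable
  finally show ?thesis by (simp only: c_def)
qed

text \<open>The upper half of Plancherel's theorem divided by its constant; for square-integrable
  \<open>f\<close> it makes the measure finite, as the separation argument demands.\<close>

lemma emeasure_spectral_measure_le:
  fixes f :: "'a::euclidean_space \<times> real \<Rightarrow> complex"
  assumes f: "integrable lborel f"
  shows "emeasure (spectral_measure f) UNIV \<le> L2_energy lborel f"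
proof -
  define c where "c = (2 * pi) ^ DIM('a \<times> real)"
  have c: "0 < c" by (simp add: c_def)
  have [measurable]: "f \<in> borel_measurable borel" using borel_measurable_integrable[OF f] by simp
  have "emeasure (spectral_measure f) UNIV = (\<integral>\<^sup>+\<xi>. 1 \<partial>spectral_measure f)"
    by (simp add: spectral_measure_def)
  also have "\<dots> = ennreal (1 / c) * (\<integral>\<^sup>+\<xi>. 1 * ennreal ((norm (fourier f \<xi>))\<^sup>2) \<partial>lborel)"
    unfolding c_def by (rule nn_integral_spectral_measure) measurable
  also have "(\<integral>\<^sup>+\<xi>. 1 * ennreal ((norm (fourier f \<xi>))\<^sup>2) \<partial>lborel) = L2_energy lborel (fourier f)"
    by (simp only: mult_1)
  also have "ennreal (1 / c) * L2_energy lborel (fourier f) \<le> ennreal (1 / c) * (ennreal c * L2_energy lborel f)"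
    unfolding c_def by (intro mult_left_mono nn_integral_fourier_le f) simp
  also have "\<dots> = (ennreal (1 / c) * ennreal c) * L2_energy lborel f"
    by (simp only: mult.assoc)
  also have "ennreal (1 / c) * ennreal c = 1" using c by (simp flip: ennreal_mult)
  finally show ?thesis by simp
qed

text \<open>The transfer behind every estimate of a truncated operator: the lower half of
  Plancherel's theorem for the integrable output \<open>F\<close>, with the frequency side read as
  an integral against the spectral measure of the input \<open>f\<close>.\<close>

lemma nn_integral_norm_le_of_fourier:
  fixes f F :: "'a::euclidean_space \<times> real \<Rightarrow> complex"
  assumes f: "f \<in> borel_measurable borel" and F: "integrable lborel F"
    and m[measurable]: "m \<in> borel_measurable borel" and eq: "\<And>\<xi>. fourier F \<xi> = m \<xi> * fourier f \<xi>"
  shows "L2_energy lborel F \<le> L2_energy (spectral_measure f) m"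
proof -
  define c where "c = (2 * pi) ^ DIM('a \<times> real)"
  have c: "0 < c" by (simp add: c_def)
  have "ennreal (1 / c) * (ennreal c * L2_energy lborel F)
      \<le> ennreal (1 / c) * L2_energy lborel (fourier F)"
    unfolding c_def by (intro mult_left_mono plancherel_le F) simp
  also have "ennreal (1 / c) * (ennreal c * L2_energy lborel F)
      = (ennreal (1 / c) * ennreal c) * L2_energy lborel F"
    by (simp only: mult.assoc)
  also have "ennreal (1 / c) * ennreal c = 1" using c by (simp flip: ennreal_mult)
  also have "ennreal (1 / c) * L2_energy lborel (fourier F)
      = L2_energy (spectral_measure f) m"
  proof -
    have "L2_energy (spectral_measure f) m
        = ennreal (1 / c) * (\<integral>\<^sup>+\<xi>. ennreal ((norm (m \<xi>))\<^sup>2) * ennreal ((norm (fourier f \<xi>))\<^sup>2) \<partial>lborel)"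
      unfolding c_def by (rule nn_integral_spectral_measure[OF f]) measurable
    moreover have "ennreal ((norm (fourier F \<xi>))\<^sup>2) = ennreal ((norm (m \<xi>))\<^sup>2) * ennreal ((norm (fourier f \<xi>))\<^sup>2)" for \<xi>
      unfolding eq norm_mult power_mult_distrib by (rule ennreal_mult) auto
    ultimately show ?thesis by (simp only:)
  qed
  finally show ?thesis by simp
qed

section \<open>Lines in the direction \<open>(v, 1)\<close>\<close>

lemma nn_integral_shear:
  fixes G :: "'a::euclidean_space \<times> real \<Rightarrow> ennreal" and v :: 'a
  assumes [measurable]: "G \<in> borel_measurable borel"
  shows "(\<integral>\<^sup>+x. G x \<partial>lborel) = (\<integral>\<^sup>+y. (\<integral>\<^sup>+s. G (y + s *\<^sub>R v, s) \<partial>lborel) \<partial>lborel)"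
proof -
  have "(\<integral>\<^sup>+x. G x \<partial>lborel) = (\<integral>\<^sup>+x. G x \<partial>(lborel \<Otimes>\<^sub>M lborel))" by (simp only: lborel_prod)
  also have "\<dots> = (\<integral>\<^sup>+s. (\<integral>\<^sup>+y. G (y, s) \<partial>lborel) \<partial>lborel)"
    by (rule lborel_pair.nn_integral_snd[symmetric]) (simp add: lborel_prod)
  also have "\<dots> = (\<integral>\<^sup>+s. (\<integral>\<^sup>+y. G (y + s *\<^sub>R v, s) \<partial>lborel) \<partial>lborel)"
  proof (rule nn_integral_cong)
    fix s
    show "(\<integral>\<^sup>+y. G (y, s) \<partial>lborel) = (\<integral>\<^sup>+y. G (y + s *\<^sub>R v, s) \<partial>lborel)"
      using nn_integral_lborel_translate[of "\<lambda>y. G (y, s)" "s *\<^sub>R v"] by simp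
  qed
  also have "\<dots> = (\<integral>\<^sup>+y. (\<integral>\<^sup>+s. G (y + s *\<^sub>R v, s) \<partial>lborel) \<partial>lborel)"
    by (rule lborel_pair.Fubini') measurable
  finally show ?thesis .
qed

text \<open>The shear \<open>(y, s) \<mapsto> (y + s *\<^sub>R v, s)\<close> preserves Lebesgue
  measure and maps vertical lines to lines in the direction \<open>(v, 1)\<close>. Tonelli's theorem
  asks for a Borel predicate, and this shapes the treatment of convergence below.\<close>

lemma AE_shear:
  fixes P :: "'a::euclidean_space \<times> real \<Rightarrow> bool" and v :: 'a
  assumes [measurable]: "Measurable.pred borel P"
    and ae: "AE y in lborel. AE s in lborel. P (y + s *\<^sub>R v, s)"
  shows "AE x in lborel. P x"
proof -
  let ?I = "\<lambda>x. indicator {x. \<not> P x} x :: ennreal"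
  have [measurable]: "{x. \<not> P x} \<in> sets borel" by measurable
  have "(\<integral>\<^sup>+x. ?I x \<partial>lborel) = (\<integral>\<^sup>+y. (\<integral>\<^sup>+s. ?I (y + s *\<^sub>R v, s) \<partial>lborel) \<partial>lborel)"
    by (rule nn_integral_shear) measurable
  also have "\<dots> = (\<integral>\<^sup>+(y::'a). 0 \<partial>lborel)"
  proof (rule nn_integral_cong_AE, use ae in eventually_elim)
    case (elim y)
    have "(\<integral>\<^sup>+s. ?I (y + s *\<^sub>R v, s) \<partial>lborel) = (\<integral>\<^sup>+(s::real). 0 \<partial>lborel)"
      by (rule nn_integral_cong_AE, use elim in eventually_elim) simp
    then show ?case by simp
  qed
  finally have "(\<integral>\<^sup>+x. ?I x \<partial>lborel) = 0" by simp
  then have "AE x in lborel. ?I x = 0" by (subst (asm) nn_integral_0_iff_AE) auto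
  then show ?thesis by eventually_elim (simp add: indicator_def split: if_splits)
qed

text \<open>The good points: there every truncated integral converges absolutely, so that linearity
  and continuity in the cut-off hold pointwise.\<close>

definition line_L2 :: "'a::euclidean_space \<Rightarrow> ('a \<Rightarrow> complex) \<Rightarrow> 'a \<Rightarrow> bool" where
  "line_L2 w f x \<longleftrightarrow> L2_energy lborel (\<lambda>t. f (x - t *\<^sub>R w)) < \<infinity>"

text \<open>The Borel counterpart of \<open>truncated_dir_hilbert\<close>, without the factor
  \<open>1 / pi\<close>, expressed through the restriction to the line so that the one-dimensional
  theory applies.\<close>

definition dir_trunc :: "real \<Rightarrow> 'a::euclidean_space \<Rightarrow> ('a \<Rightarrow> complex) \<Rightarrow> 'a \<Rightarrow> complex" where
  "dir_trunc \<delta> w f x = truncated_hilbert (\<lambda>s. f (x + s *\<^sub>R w)) \<delta> 0"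

lemma truncated_hilbert_translate:
  "truncated_hilbert (\<lambda>s. g (x + s)) \<delta> y = truncated_hilbert g \<delta> (x + y)"
  by (simp add: truncated_hilbert_def add_diff_eq)

lemma dir_trunc_eq: "dir_trunc \<delta> w f x = (\<integral>t. indicator {t. \<delta> < \<bar>t\<bar>} t *\<^sub>R (f (x - t *\<^sub>R w) / of_real t) \<partial>lborel)"
  unfolding dir_trunc_def truncated_hilbert_def by simp

lemma shear_line: "(y + s *\<^sub>R v, s) + r *\<^sub>R (v, 1) = (y + (s + r) *\<^sub>R v, s + r :: real)"
  by (simp add: scaleR_add_left)

lemma shear_line_diff: "(y + s *\<^sub>R v, s) - r *\<^sub>R (v, 1) = (y + (s - r) *\<^sub>R v, s - r :: real)"
  by (simp add: scaleR_diff_left)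

lemma dir_trunc_shear:
  "dir_trunc \<delta> (v, 1) f (y + s *\<^sub>R v, s) = truncated_hilbert (\<lambda>s. f (y + s *\<^sub>R v, s)) \<delta> s"
  using truncated_hilbert_translate[of "\<lambda>s. f (y + s *\<^sub>R v, s)" s \<delta> 0]
  unfolding dir_trunc_def shear_line by simp

lemma AE_section_L2:
  fixes f :: "'a::euclidean_space \<times> real \<Rightarrow> complex" and v :: 'a
  assumes [measurable]: "f \<in> borel_measurable borel"
    and f2: "L2_energy lborel f < \<infinity>"
  shows "AE y in lborel. L2_energy lborel (\<lambda>s. f (y + s *\<^sub>R v, s)) < \<infinity>"
proof -
  have "(\<integral>\<^sup>+y. L2_energy lborel (\<lambda>s. f (y + s *\<^sub>R v, s)) \<partial>lborel) \<noteq> \<infinity>"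
    using f2 nn_integral_shear[of "\<lambda>x. ennreal ((norm (f x))\<^sup>2)" v] by simp
  then have "AE y in lborel. L2_energy lborel (\<lambda>s. f (y + s *\<^sub>R v, s)) \<noteq> \<infinity>"
    by (rule nn_integral_PInf_AE[rotated]) measurable
  then show ?thesis by eventually_elim (simp add: less_top)
qed

lemma AE_line_L2:
  fixes f :: "'a::euclidean_space \<times> real \<Rightarrow> complex" and v :: 'a
  assumes f[measurable]: "f \<in> borel_measurable borel"
    and f2: "L2_energy lborel f < \<infinity>"
  shows "AE x in lborel. line_L2 (v, 1) f x"
proof (rule AE_shear[where v = v])
  have "(\<lambda>(x, t). ennreal ((norm (f (x - t *\<^sub>R (v, 1))))\<^sup>2)) \<in> borel_measurable (borel \<Otimes>\<^sub>M borel)"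
    by measurable
  then show "Measurable.pred borel (line_L2 (v, 1) f)" unfolding line_L2_def by measurable
  show "AE y in lborel. AE s in lborel. line_L2 (v, 1) f (y + s *\<^sub>R v, s)"
    using AE_section_L2[OF f f2, of v]
  proof eventually_elim
    case (elim y)
    have "line_L2 (v, 1) f (y + s *\<^sub>R v, s)" for s
      using elim nn_integral_real_reflect[of "\<lambda>s. ennreal ((norm (f (y + s *\<^sub>R v, s)))\<^sup>2)" s]
      unfolding line_L2_def shear_line_diff by simp
    then show ?case by simp
  qed
qed

lemma line_L2_integrable:
  fixes f :: "'a::euclidean_space \<Rightarrow> complex"
  assumes [measurable]: "f \<in> borel_measurable borel" and "line_L2 w f x" "0 < \<delta>"
  shows "integrable lborel (\<lambda>t. indicator {t. \<delta> < \<bar>t\<bar>} t *\<^sub>R (f (x - t *\<^sub>R w) / of_real t))"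
proof -
  let ?g = "\<lambda>s. f (x + s *\<^sub>R w)"
  have "L2_energy lborel ?g = L2_energy lborel (\<lambda>s. ?g (0 - s))"
    by (rule nn_integral_real_reflect[symmetric]) measurable
  also have "\<dots> < \<infinity>" using assms(2) unfolding line_L2_def by simp
  finally have "L2_energy lborel ?g < \<infinity>" .
  from integrable_truncated_inverse[OF _ this \<open>0 < \<delta>\<close>, of 0] show ?thesis by simp
qed

text \<open>Convergence as \<open>\<delta> \<rightarrow> 0\<close> is tested on rational \<open>\<delta>\<close> only: this makes the exceptional set
  measurable, and right-continuity in \<open>\<delta>\<close> recovers the limit.\<close>

definition rational_Cauchy :: "(real \<Rightarrow> complex) \<Rightarrow> bool" where
  "rational_Cauchy F \<longleftrightarrow> (\<forall>k::nat. \<exists>j::nat. \<forall>p\<in>\<rat>. \<forall>q\<in>\<rat>. 0 < p \<longrightarrow> p < 1 / real (Suc j) \<longrightarrow> 0 < q \<longrightarrow>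
     q < 1 / real (Suc j) \<longrightarrow> norm (F p - F q) \<le> 1 / real (Suc k))"

lemma rational_Cauchy_of_tendsto:
  assumes "(F \<longlongrightarrow> l) (at_right 0)"
  shows "rational_Cauchy F"
  unfolding rational_Cauchy_def
proof
  fix k
  have "0 < 1 / real (Suc k) / 2" by simp
  then obtain d where d: "0 < d" "\<And>\<delta>. 0 < \<delta> \<Longrightarrow> \<delta> < d \<Longrightarrow> dist (F \<delta>) l < 1 / real (Suc k) / 2"
    using tendstoD[OF assms] unfolding eventually_at_right_field by blast
  obtain j where j: "1 / real (Suc j) < d" using d(1) reals_Archimedean by (auto simp: inverse_eq_divide)
  have "norm (F p - F q) \<le> 1 / real (Suc k)" if "0 < p" "p < 1 / real (Suc j)" "0 < q" "q < 1 / real (Suc j)" for p q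
  proof -
    have "dist (F p) (F q) \<le> dist (F p) l + dist (F q) l" by (rule dist_triangle2)
    also have "\<dots> \<le> 1 / real (Suc k) / 2 + 1 / real (Suc k) / 2"
      using that j d(2)[of p] d(2)[of q] by (intro add_mono) auto
    finally show ?thesis by (simp only: dist_norm field_sum_of_halves)
  qed
  then show "\<exists>j. \<forall>p\<in>\<rat>. \<forall>q\<in>\<rat>. 0 < p \<longrightarrow> p < 1 / real (Suc j) \<longrightarrow> 0 < q \<longrightarrow> q < 1 / real (Suc j) \<longrightarrow> norm (F p - F q) \<le> 1 / real (Suc k)"
    by blast
qed

lemma tendsto_of_rational_Cauchy:
  assumes RC: "rational_Cauchy F"
    and cont: "\<And>\<delta>. 0 < \<delta> \<Longrightarrow> (F \<longlongrightarrow> F \<delta>) (at_right \<delta>)"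
  shows "\<exists>l. (F \<longlongrightarrow> l) (at_right 0)"
proof -
  \<comment> \<open>Right-continuity supplies a rational slightly above \<delta> with nearly the
    same value; comparing through two such rationals triples the error.\<close>
  have approx: "\<exists>p\<in>\<rat>. \<delta> < p \<and> p < d \<and> norm (F p - F \<delta>) < e" if pos: "0 < \<delta>" "\<delta> < d" "0 < e" for \<delta> d e
  proof -
    obtain b where b: "\<delta> < b" "\<And>y. \<delta> < y \<Longrightarrow> y < b \<Longrightarrow> dist (F y) (F \<delta>) < e"
      using tendstoD[OF cont[OF pos(1)] pos(3)] unfolding eventually_at_right_field by blast
    obtain p where "p \<in> \<rat>" "\<delta> < p" "p < min b d" using Rats_dense_in_real[of \<delta> "min b d"] b pos by auto
    then show ?thesis using b(2)[of p] by (auto simp: dist_norm)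
  qed
  have C: "\<exists>j::nat. \<forall>p q. 0 < p \<longrightarrow> p < 1 / real (Suc j) \<longrightarrow> 0 < q \<longrightarrow> q < 1 / real (Suc j) \<longrightarrow> norm (F p - F q) \<le> 3 / real (Suc k)" for k :: nat
  proof -
    obtain j :: nat where j: "\<And>p q. p \<in> \<rat> \<Longrightarrow> q \<in> \<rat> \<Longrightarrow> 0 < p \<Longrightarrow> p < 1 / real (Suc j) \<Longrightarrow> 0 < q \<Longrightarrow>
        q < 1 / real (Suc j) \<Longrightarrow> norm (F p - F q) \<le> 1 / real (Suc k)"
      using RC unfolding rational_Cauchy_def by blast
    have "norm (F p - F q) \<le> 3 / real (Suc k)" if pq: "0 < p" "p < 1 / real (Suc j)" "0 < q" "q < 1 / real (Suc j)" for p q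
    proof -
      have e: "0 < 1 / real (Suc k)" by simp
      obtain p' where p': "p' \<in> \<rat>" "p < p'" "p' < 1 / real (Suc j)" "norm (F p' - F p) < 1 / real (Suc k)"
        using approx[OF pq(1,2) e] by blast
      obtain q' where q': "q' \<in> \<rat>" "q < q'" "q' < 1 / real (Suc j)" "norm (F q' - F q) < 1 / real (Suc k)"
        using approx[OF pq(3,4) e] by blast
      have "norm (F p' - F q') \<le> 1 / real (Suc k)" using j p' q' pq by auto
      moreover have "F p - F q = (F p' - F q') - (F p' - F p) + (F q' - F q)" by simp
      then have "norm (F p - F q) \<le> norm (F p' - F q') + norm (F p' - F p) + norm (F q' - F q)"
        by (metis (no_types, lifting) add_right_mono norm_triangle_ineq norm_triangle_ineq4 order_trans)
      ultimately have "norm (F p - F q) \<le> 1 / real (Suc k) + 1 / real (Suc k) + 1 / real (Suc k)"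
        using p'(4) q'(4) by linarith
      then show ?thesis by simp
    qed
    then show ?thesis by blast
  qed
  \<comment> \<open>The double successor keeps \<open>s n\<close> strictly below
    \<open>1 / real (Suc n)\<close>, as the strict bounds in \<open>C\<close> demand.\<close>
  define s where "s n = 1 / real (Suc (Suc n))" for n
  have s: "0 < s n" "s n < 1 / real (Suc n)" for n by (auto simp: s_def frac_less2)
  have small: "\<exists>k. 3 / real (Suc k) < e" if "0 < e" for e :: real
  proof -
    obtain k where "inverse (real (Suc k)) < e / 3" using reals_Archimedean[of "e / 3"] \<open>0 < e\<close> by auto
    then show ?thesis by (intro exI[of _ k]) (simp add: inverse_eq_divide)
  qed
  have "Cauchy (\<lambda>n. F (s n))"
  proof (rule CauchyI)
    fix e :: real assume "0 < e"
    then obtain k where k: "3 / real (Suc k) < e" using small by blast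
    obtain j where j: "\<And>p q. 0 < p \<Longrightarrow> p < 1 / real (Suc j) \<Longrightarrow> 0 < q \<Longrightarrow> q < 1 / real (Suc j) \<Longrightarrow> norm (F p - F q) \<le> 3 / real (Suc k)"
      using C[of k] by blast
    have "s n < 1 / real (Suc j)" if "j \<le> n" for n
    proof -
      have "1 / real (Suc n) \<le> 1 / real (Suc j)" using that by (intro frac_le) auto
      then show ?thesis using s(2)[of n] by linarith
    qed
    then have "\<forall>m\<ge>j. \<forall>n\<ge>j. norm (F (s m) - F (s n)) < e"
      using j[OF s(1) _ s(1)] k by (meson le_less_trans)
    then show "\<exists>M. \<forall>m\<ge>M. \<forall>n\<ge>M. norm (F (s m) - F (s n)) < e" by blast
  qed
  then obtain l where l: "(\<lambda>n. F (s n)) \<longlonglongrightarrow> l" using Cauchy_convergent_iff convergent_def by blast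
  have "(F \<longlongrightarrow> l) (at_right 0)"
  proof (rule tendstoI)
    fix e :: real assume "0 < e"
    then obtain k where k: "3 / real (Suc k) < e" using small by blast
    obtain j where j: "\<And>p q. 0 < p \<Longrightarrow> p < 1 / real (Suc j) \<Longrightarrow> 0 < q \<Longrightarrow> q < 1 / real (Suc j) \<Longrightarrow> norm (F p - F q) \<le> 3 / real (Suc k)"
      using C[of k] by blast
    have "dist (F \<delta>) l < e" if \<delta>: "0 < \<delta>" "\<delta> < 1 / real (Suc j)" for \<delta>
    proof -
      have "(\<lambda>n. norm (F \<delta> - F (s n))) \<longlonglongrightarrow> norm (F \<delta> - l)" by (intro tendsto_intros l)
      moreover have "\<forall>n\<ge>j. norm (F \<delta> - F (s n)) \<le> 3 / real (Suc k)"
      proof (intro allI impI)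
        fix n assume "j \<le> n"
        then have "1 / real (Suc n) \<le> 1 / real (Suc j)" by (intro frac_le) auto
        then show "norm (F \<delta> - F (s n)) \<le> 3 / real (Suc k)" using s[of n] \<delta> by (intro j) auto
      qed
      ultimately have "norm (F \<delta> - l) \<le> 3 / real (Suc k)" by (intro LIMSEQ_le_const2) auto
      then show ?thesis using k by (simp add: dist_norm)
    qed
    then show "\<forall>\<^sub>F \<delta> in at_right 0. dist (F \<delta>) l < e"
      unfolding eventually_at_right_field by (intro exI[of _ "1 / real (Suc j)"]) simp
  qed
  then show ?thesis by blast
qed

lemma measurable_dir_trunc[measurable]:
  fixes f :: "'a::euclidean_space \<Rightarrow> complex"
  assumes [measurable]: "f \<in> borel_measurable borel"
  shows "dir_trunc \<delta> w f \<in> borel_measurable borel"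
proof -
  have "(\<lambda>(x, t). indicator {t. \<delta> < \<bar>t\<bar>} t *\<^sub>R (f (x - t *\<^sub>R w) / of_real t)) \<in> borel_measurable (borel \<Otimes>\<^sub>M borel)"
    by measurable
  then have "(\<lambda>x. \<integral>t. indicator {t. \<delta> < \<bar>t\<bar>} t *\<^sub>R (f (x - t *\<^sub>R w) / of_real t) \<partial>lborel) \<in> borel_measurable borel"
    by measurable
  then show ?thesis by (simp only: dir_trunc_eq[abs_def])
qed

text \<open>For cut-offs above \<delta> that tend to it, the sets \<open>S n < \<bar>t\<bar>\<close>
  stay inside \<open>\<delta> < \<bar>t\<bar>\<close> and eventually contain each of its points; so
  the integrand at \<delta> dominates.\<close>

lemma dir_trunc_right_continuous:
  fixes f :: "'a::euclidean_space \<Rightarrow> complex"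
  assumes [measurable]: "f \<in> borel_measurable borel" and x: "line_L2 w f x" and \<delta>: "0 < \<delta>"
  shows "((\<lambda>\<delta>. dir_trunc \<delta> w f x) \<longlongrightarrow> dir_trunc \<delta> w f x) (at_right \<delta>)"
proof (rule tendsto_at_right_sequentially[of \<delta> "\<delta> + 1"])
  fix S :: "nat \<Rightarrow> real" assume S: "\<And>n. \<delta> < S n" "S \<longlonglongrightarrow> \<delta>"
  show "(\<lambda>n. dir_trunc (S n) w f x) \<longlonglongrightarrow> dir_trunc \<delta> w f x"
    unfolding dir_trunc_eq
  proof (rule integral_dominated_convergence)
    show "integrable lborel (\<lambda>t. norm (indicator {t. \<delta> < \<bar>t\<bar>} t *\<^sub>R (f (x - t *\<^sub>R w) / of_real t)))"
      by (intro integrable_norm line_L2_integrable x \<delta>) simp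
    show "AE t in lborel. (\<lambda>n. indicator {t. S n < \<bar>t\<bar>} t *\<^sub>R (f (x - t *\<^sub>R w) / of_real t))
        \<longlonglongrightarrow> indicator {t. \<delta> < \<bar>t\<bar>} t *\<^sub>R (f (x - t *\<^sub>R w) / of_real t)"
    proof (rule AE_I2)
      fix t
      have "\<forall>\<^sub>F n in sequentially. indicator {t. \<delta> < \<bar>t\<bar>} t = (indicator {t. S n < \<bar>t\<bar>} t :: real)"
      proof (cases "\<delta> < \<bar>t\<bar>")
        case True
        then have "\<forall>\<^sub>F n in sequentially. S n < \<bar>t\<bar>" using S(2) by (intro order_tendstoD(2)[of S \<delta>]) auto
        then show ?thesis by eventually_elim (use True in simp)
      next
        case False
        then have "\<not> S n < \<bar>t\<bar>" for n using S(1)[of n] by linarith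
        then show ?thesis using False by simp
      qed
      then have "(\<lambda>n. indicator {t. S n < \<bar>t\<bar>} t :: real) \<longlonglongrightarrow> indicator {t. \<delta> < \<bar>t\<bar>} t"
        by (intro Lim_transform_eventually[OF tendsto_const])
      then show "(\<lambda>n. indicator {t. S n < \<bar>t\<bar>} t *\<^sub>R (f (x - t *\<^sub>R w) / of_real t))
        \<longlonglongrightarrow> indicator {t. \<delta> < \<bar>t\<bar>} t *\<^sub>R (f (x - t *\<^sub>R w) / of_real t)"
        by (intro tendsto_scaleR tendsto_const)
    qed
    show "AE t in lborel. norm (indicator {t. S n < \<bar>t\<bar>} t *\<^sub>R (f (x - t *\<^sub>R w) / of_real t))
        \<le> norm (indicator {t. \<delta> < \<bar>t\<bar>} t *\<^sub>R (f (x - t *\<^sub>R w) / of_real t))" for n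
    proof (rule AE_I2)
      fix t
      have "S n < \<bar>t\<bar> \<Longrightarrow> \<delta> < \<bar>t\<bar>" using S(1)[of n] by linarith
      then show "norm (indicator {t. S n < \<bar>t\<bar>} t *\<^sub>R (f (x - t *\<^sub>R w) / of_real t))
        \<le> norm (indicator {t. \<delta> < \<bar>t\<bar>} t *\<^sub>R (f (x - t *\<^sub>R w) / of_real t))"
        by (auto simp: indicator_def)
    qed
  qed measurable
qed simp

theorem AE_dir_trunc_tendsto:
  fixes f :: "'a::euclidean_space \<times> real \<Rightarrow> complex"
  assumes f[measurable]: "f \<in> borel_measurable borel"
    and f2: "L2_energy lborel f < \<infinity>"
  shows "AE x in lborel. \<exists>l. ((\<lambda>\<delta>. dir_trunc \<delta> (v, 1) f x) \<longlongrightarrow> l) (at_right 0)"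
proof -
  have "AE x in lborel. rational_Cauchy (\<lambda>\<delta>. dir_trunc \<delta> (v, 1) f x)"
  proof (rule AE_shear[where v = v])
    have "countable (\<rat> :: real set)" by (rule countable_rat)
    then show "Measurable.pred borel (\<lambda>x. rational_Cauchy (\<lambda>\<delta>. dir_trunc \<delta> (v, 1) f x))"
      unfolding rational_Cauchy_def by measurable
    show "AE y in lborel. AE s in lborel. rational_Cauchy (\<lambda>\<delta>. dir_trunc \<delta> (v, 1) f (y + s *\<^sub>R v, s))"
      using AE_section_L2[OF f f2, of v]
    proof eventually_elim
      case (elim y)
      have "AE s in lborel. \<exists>l. ((\<lambda>\<delta>. truncated_hilbert (\<lambda>s. f (y + s *\<^sub>R v, s)) \<delta> s) \<longlongrightarrow> l) (at_right 0)"
        by (rule truncated_hilbert_tendsto[OF _ elim]) measurable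
      then show ?case
        unfolding dir_trunc_shear by eventually_elim (auto intro: rational_Cauchy_of_tendsto)
    qed
  qed
  moreover have "AE x in lborel. line_L2 (v, 1) f x" by (rule AE_line_L2[OF f f2])
  ultimately show ?thesis
  proof eventually_elim
    case (elim x)
    then show ?case by (intro tendsto_of_rational_Cauchy dir_trunc_right_continuous) auto
  qed
qed

lemma nn_integral_norm_lim_le:
  fixes G :: "nat \<Rightarrow> 'a \<Rightarrow> complex"
  assumes [measurable]: "\<And>n. G n \<in> borel_measurable M"
    and lim: "AE x in M. (\<lambda>n. G n x) \<longlonglongrightarrow> L x"
    and b: "\<And>n. L2_energy M (G n) \<le> b n" and bB: "b \<longlonglongrightarrow> B"
  shows "L2_energy M L \<le> B"
proof -
  have "L2_energy M L = (\<integral>\<^sup>+x. liminf (\<lambda>n. ennreal ((norm (G n x))\<^sup>2)) \<partial>M)"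
  proof (rule nn_integral_cong_AE, use lim in eventually_elim)
    case (elim x)
    have "(\<lambda>n. ennreal ((norm (G n x))\<^sup>2)) \<longlonglongrightarrow> ennreal ((norm (L x))\<^sup>2)"
      by (intro tendsto_ennrealI tendsto_intros elim)
    from lim_imp_Liminf[OF sequentially_bot this] show ?case by (rule sym)
  qed
  also have "\<dots> \<le> liminf (\<lambda>n. \<integral>\<^sup>+x. ennreal ((norm (G n x))\<^sup>2) \<partial>M)"
    by (rule nn_integral_liminf) measurable
  also have "\<dots> \<le> liminf b" by (intro Liminf_mono always_eventually allI b)
  also have "\<dots> = B" by (rule lim_imp_Liminf[OF sequentially_bot bB])
  finally show ?thesis .
qed

lemma pv_kernel_line_integrable:
  fixes f :: "'a::euclidean_space \<Rightarrow> complex"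
  assumes f[measurable]: "f \<in> borel_measurable borel" and x: "line_L2 w f x"
  shows "integrable lborel (\<lambda>t. pv_kernel n t * f (x - t *\<^sub>R w))"
proof (rule Bochner_Integration.integrable_bound)
  show "integrable lborel (\<lambda>t. indicator {t. 1 / real (Suc n) < \<bar>t\<bar>} t *\<^sub>R (f (x - t *\<^sub>R w) / of_real t))"
    by (rule line_L2_integrable[OF f x]) simp
  show "AE t in lborel. norm (pv_kernel n t * f (x - t *\<^sub>R w))
      \<le> norm (indicator {t. 1 / real (Suc n) < \<bar>t\<bar>} t *\<^sub>R (f (x - t *\<^sub>R w) / of_real t))"
    by (intro AE_I2) (auto simp: pv_kernel_def norm_mult norm_divide indicator_def simp del: of_nat_Suc)
qed measurable

text \<open>Separates the two cut-offs: the two-sided truncation differs from the one at 0 by the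
  tail over \<open>\<bar>t\<bar> \<ge> Suc n\<close>, which vanishes by dominated convergence
  because \<open>f\<close> is square integrable on the line.\<close>

lemma dir_pv_tendsto:
  fixes f :: "'a::euclidean_space \<Rightarrow> complex"
  assumes f[measurable]: "f \<in> borel_measurable borel" and x: "line_L2 w f x"
    and l: "((\<lambda>\<delta>. dir_trunc \<delta> w f x) \<longlongrightarrow> l) (at_right 0)"
  shows "(\<lambda>n. dir_pv n w f x) \<longlonglongrightarrow> l"
proof -
  let ?T = "\<lambda>n t. indicator {t. 1 / real (Suc n) < \<bar>t\<bar>} t *\<^sub>R (f (x - t *\<^sub>R w) / of_real t)"
  let ?E = "\<lambda>n t. ?T n t - pv_kernel n t * f (x - t *\<^sub>R w)"
  \<comment> \<open>The tails start at \<open>Suc n \<ge> 1\<close>, so any fixed cut-off below 1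
    dominates them all.\<close>
  let ?h = "\<lambda>t. indicator {t. 1/2 < \<bar>t\<bar>} t *\<^sub>R (f (x - t *\<^sub>R w) / of_real t)"
  have Ti: "integrable lborel (?T n)" for n by (rule line_L2_integrable[OF f x]) simp
  have Ki: "integrable lborel (\<lambda>t. pv_kernel n t * f (x - t *\<^sub>R w))" for n by (rule pv_kernel_line_integrable[OF f x])
  have E_eq: "?E n t = (if real (Suc n) \<le> \<bar>t\<bar> then ?T n t else 0)" for n t
    by (auto simp: pv_kernel_def indicator_def simp del: of_nat_Suc)
  have "(\<lambda>n. \<integral>t. ?E n t \<partial>lborel) \<longlonglongrightarrow> (\<integral>t. 0 \<partial>(lborel :: real measure))"
  proof (rule integral_dominated_convergence[where w = "\<lambda>t. norm (?h t)"])
    show "integrable lborel (\<lambda>t. norm (?h t))" by (intro integrable_norm line_L2_integrable[OF f x]) simp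
    show "AE t in lborel. (\<lambda>n. ?E n t) \<longlonglongrightarrow> 0"
    proof (rule AE_I2)
      fix t
      obtain m :: nat where m: "\<bar>t\<bar> < real m" using reals_Archimedean2 by blast
      have "\<forall>\<^sub>F n in sequentially. 0 = ?E n t"
        unfolding E_eq using eventually_ge_at_top[of m] by eventually_elim (use m in simp)
      then show "(\<lambda>n. ?E n t) \<longlonglongrightarrow> 0" by (rule Lim_transform_eventually[OF tendsto_const])
    qed
    show "AE t in lborel. norm (?E n t) \<le> norm (?h t)" for n
    proof (rule AE_I2)
      fix t
      have "1 \<le> real (Suc n)" by simp
      then have "real (Suc n) \<le> \<bar>t\<bar> \<Longrightarrow> 1/2 < \<bar>t\<bar>" by linarith
      then show "norm (?E n t) \<le> norm (?h t)" unfolding E_eq by (auto simp: indicator_def)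
    qed
  qed measurable
  then have E0: "(\<lambda>n. \<integral>t. ?E n t \<partial>lborel) \<longlonglongrightarrow> 0" by simp
  have "filterlim (\<lambda>n. 1 / real (Suc n)) (at_right 0) sequentially"
    by real_asymp
  then have "(\<lambda>n. dir_trunc (1 / real (Suc n)) w f x) \<longlonglongrightarrow> l" by (rule filterlim_compose[OF l])
  from tendsto_diff[OF this E0]
  have "(\<lambda>n. dir_trunc (1 / real (Suc n)) w f x - (\<integral>t. ?E n t \<partial>lborel)) \<longlonglongrightarrow> l" by simp
  moreover have "dir_trunc (1 / real (Suc n)) w f x - (\<integral>t. ?E n t \<partial>lborel) = dir_pv n w f x" for n
    unfolding dir_trunc_eq dir_pv_def Bochner_Integration.integral_diff[OF Ti Ki] by simp
  ultimately show ?thesis by (simp only:)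
qed

section \<open>The limit operator and its energy\<close>

definition hilbert_approx :: "nat \<Rightarrow> 'a::euclidean_space \<Rightarrow> ('a \<times> real \<Rightarrow> complex) \<Rightarrow> 'a \<times> real \<Rightarrow> complex" where
  "hilbert_approx n v f x = 1 / of_real pi * dir_pv n (v, 1) f x"

text \<open>A limit along a sequence of Borel functions is Borel measurable on the whole space,
  whereas the principal value is unspecified on a null set; the two agree almost everywhere.\<close>

definition hilbert_limit :: "'a::euclidean_space \<Rightarrow> ('a \<times> real \<Rightarrow> complex) \<Rightarrow> 'a \<times> real \<Rightarrow> complex" where
  "hilbert_limit v f x = lim (\<lambda>n. hilbert_approx n v f x)"

lemma measurable_hilbert_approx[measurable]:
  assumes "f \<in> borel_measurable borel"
  shows "hilbert_approx n v f \<in> borel_measurable borel"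
  unfolding hilbert_approx_def[abs_def] by (intro borel_measurable_times borel_measurable_const measurable_dir_pv assms)

lemma measurable_hilbert_limit[measurable]:
  assumes [measurable]: "f \<in> borel_measurable borel"
  shows "hilbert_limit v f \<in> borel_measurable borel"
  unfolding hilbert_limit_def by measurable

lemma AE_hilbert_limit:
  fixes f :: "'a::euclidean_space \<times> real \<Rightarrow> complex"
  assumes f: "f \<in> borel_measurable borel"
    and f2: "L2_energy lborel f < \<infinity>"
  shows "AE x in lborel. ((\<lambda>\<delta>. 1 / of_real pi * dir_trunc \<delta> (v, 1) f x) \<longlongrightarrow> hilbert_limit v f x) (at_right 0)
    \<and> (\<lambda>n. hilbert_approx n v f x) \<longlonglongrightarrow> hilbert_limit v f x \<and> line_L2 (v, 1) f x"
  using AE_dir_trunc_tendsto[OF f f2, of v] AE_line_L2[OF f f2, of v]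
proof eventually_elim
  case (elim x)
  then obtain l where l: "((\<lambda>\<delta>. dir_trunc \<delta> (v, 1) f x) \<longlongrightarrow> l) (at_right 0)" by blast
  have "(\<lambda>n. hilbert_approx n v f x) \<longlonglongrightarrow> 1 / of_real pi * l"
    unfolding hilbert_approx_def by (intro tendsto_mult tendsto_const dir_pv_tendsto[OF f elim(2) l])
  moreover from this have "hilbert_limit v f x = 1 / of_real pi * l" unfolding hilbert_limit_def by (rule limI)
  moreover have "((\<lambda>\<delta>. 1 / of_real pi * dir_trunc \<delta> (v, 1) f x) \<longlongrightarrow> 1 / of_real pi * l) (at_right 0)"
    by (intro tendsto_mult tendsto_const l)
  ultimately show ?case using elim(2) by simp
qed

lemma fourier_cmult: "fourier (\<lambda>x. c * F x) \<xi> = c * fourier F \<xi>"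
  by (simp add: fourier_def mult.assoc)

lemma AE_inner_neq_0:
  fixes w :: "'a::euclidean_space"
  assumes "w \<noteq> 0"
  shows "AE \<xi> in lborel. \<xi> \<bullet> w \<noteq> 0"
proof -
  have "negligible {\<xi>. w \<bullet> \<xi> = 0}" using assms by (intro negligible_hyperplane) simp
  then have "{\<xi>. w \<bullet> \<xi> = 0} \<in> null_sets lebesgue" by (simp only: negligible_iff_null_sets)
  then have "AE \<xi> in lebesgue. \<xi> \<notin> {\<xi>. w \<bullet> \<xi> = 0}" by (rule AE_not_in)
  then have "AE \<xi> in lborel. \<xi> \<notin> {\<xi>. w \<bullet> \<xi> = 0}" by (simp only: AE_completion_iff)
  then show ?thesis by eventually_elim (simp add: inner_commute)
qed

lemma AE_spectral_measure:
  fixes f :: "'a::euclidean_space \<times> real \<Rightarrow> complex"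
  assumes [measurable]: "f \<in> borel_measurable borel" and "AE \<xi> in lborel. P \<xi>"
  shows "AE \<xi> in spectral_measure f. P \<xi>"
  unfolding spectral_measure_def by (subst AE_density) (use assms(2) in auto)

lemma hilbert_multiplier_tendsto:
  "(\<lambda>n. 1 / of_real pi * pv_multiplier n s) \<longlonglongrightarrow> - \<i> * of_real (sgn s)"
proof -
  have "(\<lambda>n. 1 / of_real pi * pv_multiplier n s) \<longlonglongrightarrow> 1 / of_real pi * (- (\<i> * pi) * of_real (sgn s))"
    by (intro tendsto_mult tendsto_const pv_multiplier_tendsto)
  then show ?thesis by simp
qed

lemma hilbert_multiplier_bounded: "\<exists>C>0. \<forall>n s. norm (1 / of_real pi * pv_multiplier n s) \<le> C"
proof -
  obtain C where C: "0 < C" "\<And>n s. norm (pv_multiplier n s) \<le> C" using pv_multiplier_bounded by blast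
  have "norm (1 / of_real pi * pv_multiplier n s) \<le> C / pi" for n s
    using C(2)[of n s] by (simp add: norm_mult norm_divide divide_right_mono)
  then show ?thesis using C(1) by (intro exI[of _ "C / pi"]) auto
qed

context
  fixes f :: "'a::euclidean_space \<times> real \<Rightarrow> complex"
  assumes f_int: "integrable lborel f" and f2: "L2_energy lborel f < \<infinity>"
begin

lemma hilbert_f_borel[measurable]: "f \<in> borel_measurable borel"
  using borel_measurable_integrable[OF f_int] by simp

lemma finite_spectral_measure: "finite_measure (spectral_measure f)"
proof
  have "emeasure (spectral_measure f) UNIV \<noteq> \<infinity>"
    using le_less_trans[OF emeasure_spectral_measure_le[OF f_int] f2] by simp
  then show "emeasure (spectral_measure f) (space (spectral_measure f)) \<noteq> \<infinity>"
    by (simp add: spectral_measure_def)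
qed

lemma integrable_hilbert_approx: "integrable lborel (hilbert_approx n v f)"
  unfolding hilbert_approx_def[abs_def] by (intro integrable_mult_right integrable_dir_pv f_int)

lemma fourier_hilbert_approx:
  "fourier (hilbert_approx n v f) \<xi> = 1 / of_real pi * pv_multiplier n (\<xi> \<bullet> (v, 1)) * fourier f \<xi>"
  unfolding hilbert_approx_def[abs_def] fourier_cmult fourier_dir_pv[OF f_int] by (simp only: mult.assoc)

lemma nn_integral_multiplier_limit:
  assumes m[measurable]: "\<And>n. m n \<in> borel_measurable borel" and m0[measurable]: "m0 \<in> borel_measurable borel"
    and b: "\<And>n \<xi>. norm (m n \<xi>) \<le> C" and lim: "\<And>\<xi>. (\<lambda>n. m n \<xi>) \<longlonglongrightarrow> m0 \<xi>"
  shows "(\<lambda>n. \<integral>\<^sup>+\<xi>. ennreal ((norm (m n \<xi> :: complex))\<^sup>2) \<partial>spectral_measure f)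
      \<longlonglongrightarrow> L2_energy (spectral_measure f) (m0)"
proof (rule nn_integral_dominated_convergence[where w = "\<lambda>_. ennreal (C\<^sup>2)"])
  have sets: "sets (spectral_measure f) = sets borel" by (rule sets_spectral_measure)
  note sets[measurable_cong]
  show "(\<lambda>\<xi>. ennreal ((norm (m n \<xi>))\<^sup>2)) \<in> borel_measurable (spectral_measure f)" for n by measurable
  show "(\<lambda>\<xi>. ennreal ((norm (m0 \<xi>))\<^sup>2)) \<in> borel_measurable (spectral_measure f)" by measurable
  show "(\<lambda>_. ennreal (C\<^sup>2)) \<in> borel_measurable (spectral_measure f)" by measurable
  show "AE \<xi> in spectral_measure f. ennreal ((norm (m n \<xi>))\<^sup>2) \<le> ennreal (C\<^sup>2)" for n
    using b by (intro AE_I2 ennreal_leI power_mono) auto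
  interpret finite_measure "spectral_measure f" by (rule finite_spectral_measure)
  show "(\<integral>\<^sup>+\<xi>. ennreal (C\<^sup>2) \<partial>spectral_measure f) < \<infinity>"
    by (simp add: emeasure_eq_measure ennreal_mult'[symmetric])
  show "AE \<xi> in spectral_measure f. (\<lambda>n. ennreal ((norm (m n \<xi>))\<^sup>2)) \<longlonglongrightarrow> ennreal ((norm (m0 \<xi>))\<^sup>2)"
    by (intro AE_I2 tendsto_ennrealI tendsto_intros lim)
qed

lemma nn_integral_hilbert_limit_le:
  "L2_energy lborel (hilbert_limit v f) \<le> emeasure (spectral_measure f) UNIV"
proof -
  obtain C where C: "\<And>n s. norm (1 / of_real pi * pv_multiplier n s) \<le> C" using hilbert_multiplier_bounded by blast
  define m where "m n \<xi> = 1 / of_real pi * pv_multiplier n (\<xi> \<bullet> (v, 1))" for n and \<xi> :: "'a \<times> real"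
  define m0 where "m0 \<xi> = - \<i> * of_real (sgn (\<xi> \<bullet> (v, 1)))" for \<xi> :: "'a \<times> real"
  have [measurable]: "m n \<in> borel_measurable borel" "m0 \<in> borel_measurable borel" for n
    unfolding m_def m0_def by measurable
  have "L2_energy lborel (hilbert_limit v f) \<le> L2_energy (spectral_measure f) (m0)"
  proof (rule nn_integral_norm_lim_le)
    show "AE x in lborel. (\<lambda>n. hilbert_approx n v f x) \<longlonglongrightarrow> hilbert_limit v f x"
      using AE_hilbert_limit[OF hilbert_f_borel f2, of v] by eventually_elim simp
    show "L2_energy lborel (hilbert_approx n v f) \<le> L2_energy (spectral_measure f) (m n)" for n
      by (rule nn_integral_norm_le_of_fourier[OF hilbert_f_borel integrable_hilbert_approx])
         (measurable, simp add: m_def fourier_hilbert_approx)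
    show "(\<lambda>n. \<integral>\<^sup>+\<xi>. ennreal ((norm (m n \<xi>))\<^sup>2) \<partial>spectral_measure f) \<longlonglongrightarrow> L2_energy (spectral_measure f) (m0)"
    proof (rule nn_integral_multiplier_limit)
      show "norm (m n \<xi>) \<le> C" for n \<xi> unfolding m_def by (rule C)
      show "(\<lambda>n. m n \<xi>) \<longlonglongrightarrow> m0 \<xi>" for \<xi> unfolding m_def m0_def by (rule hilbert_multiplier_tendsto)
    qed measurable
  qed measurable
  also have "\<dots> \<le> (\<integral>\<^sup>+\<xi>. 1 \<partial>spectral_measure f)"
  proof (rule nn_integral_mono)
    fix \<xi>
    have "(norm (m0 \<xi>))\<^sup>2 \<le> 1" by (simp add: m0_def norm_mult sgn_if)
    then show "ennreal ((norm (m0 \<xi>))\<^sup>2) \<le> 1" using ennreal_leI[of "(norm (m0 \<xi>))\<^sup>2" 1] by simp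
  qed
  also have "\<dots> = emeasure (spectral_measure f) UNIV" by (simp add: spectral_measure_def)
  finally show ?thesis .
qed

text \<open>In the limit the multiplier is \<open>- \<i>\<close> times a difference of signs: of
  modulus at most 2 on \<open>sep v w\<close>, whence the 4, and 0 almost everywhere else. Fatou's
  lemma bounds the pointwise limit, and dominated convergence on the finite spectral measure
  evaluates the limit of the multiplier energies.\<close>

lemma nn_integral_hilbert_limit_diff_le:
  "L2_energy lborel (\<lambda>x. hilbert_limit v f x - hilbert_limit w f x)
    \<le> 4 * emeasure (spectral_measure f) (sep v w)"
proof -
  obtain C where C: "\<And>n s. norm (1 / of_real pi * pv_multiplier n s) \<le> C" using hilbert_multiplier_bounded by blast
  define m where "m n \<xi> = 1 / of_real pi * pv_multiplier n (\<xi> \<bullet> (v, 1)) - 1 / of_real pi * pv_multiplier n (\<xi> \<bullet> (w, 1))" for n and \<xi> :: "'a \<times> real"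
  define m0 where "m0 \<xi> = - \<i> * of_real (sgn (\<xi> \<bullet> (v, 1))) - - \<i> * of_real (sgn (\<xi> \<bullet> (w, 1)))" for \<xi> :: "'a \<times> real"
  have [measurable]: "m n \<in> borel_measurable borel" "m0 \<in> borel_measurable borel" for n
    unfolding m_def m0_def by measurable
  have "L2_energy lborel (\<lambda>x. hilbert_limit v f x - hilbert_limit w f x)
      \<le> L2_energy (spectral_measure f) (m0)"
  proof (rule nn_integral_norm_lim_le)
    show "AE x in lborel. (\<lambda>n. hilbert_approx n v f x - hilbert_approx n w f x) \<longlonglongrightarrow> hilbert_limit v f x - hilbert_limit w f x"
      using AE_hilbert_limit[OF hilbert_f_borel f2, of v] AE_hilbert_limit[OF hilbert_f_borel f2, of w]
      by eventually_elim (auto intro: tendsto_diff)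
    show "L2_energy lborel (\<lambda>x. hilbert_approx n v f x - hilbert_approx n w f x) \<le> L2_energy (spectral_measure f) (m n)" for n
    proof (rule nn_integral_norm_le_of_fourier[OF hilbert_f_borel])
      show "integrable lborel (\<lambda>x. hilbert_approx n v f x - hilbert_approx n w f x)"
        by (intro Bochner_Integration.integrable_diff integrable_hilbert_approx)
      show "fourier (\<lambda>x. hilbert_approx n v f x - hilbert_approx n w f x) \<xi> = m n \<xi> * fourier f \<xi>" for \<xi>
        unfolding fourier_diff[OF integrable_hilbert_approx integrable_hilbert_approx] fourier_hilbert_approx m_def
        by (rule left_diff_distrib[symmetric])
    qed measurable
    show "(\<lambda>n. \<integral>\<^sup>+\<xi>. ennreal ((norm (m n \<xi>))\<^sup>2) \<partial>spectral_measure f) \<longlonglongrightarrow> L2_energy (spectral_measure f) (m0)"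
    proof (rule nn_integral_multiplier_limit)
      show "norm (m n \<xi>) \<le> C + C" for n \<xi>
        unfolding m_def by (rule order.trans[OF norm_triangle_ineq4 add_mono[OF C C]])
      show "(\<lambda>n. m n \<xi>) \<longlonglongrightarrow> m0 \<xi>" for \<xi> unfolding m_def m0_def by (intro tendsto_diff hilbert_multiplier_tendsto)
    qed measurable
  qed measurable
  also have "\<dots> \<le> (\<integral>\<^sup>+\<xi>. 4 * indicator (sep v w) \<xi> \<partial>spectral_measure f)"
  proof (rule nn_integral_mono_AE)
    \<comment> \<open>\<open>sep\<close> counts 0 as negative whereas \<open>sgn\<close> does not.
      The conventions differ only on two hyperplanes, genuine ones since \<open>(v, 1)\<close> and
      \<open>(w, 1)\<close> are nonzero, and these are null for a measure with a density.\<close>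
    have "AE \<xi> in spectral_measure f. \<xi> \<bullet> (v, 1) \<noteq> 0 \<and> \<xi> \<bullet> (w, 1) \<noteq> 0"
    proof (rule AE_spectral_measure[OF hilbert_f_borel])
      have nz: "(u, 1::real) \<noteq> 0" for u :: 'a by (simp add: zero_prod_def)
      show "AE \<xi> in lborel. \<xi> \<bullet> (v, 1::real) \<noteq> 0 \<and> \<xi> \<bullet> (w, 1::real) \<noteq> 0"
        using AE_inner_neq_0[OF nz[of v]] AE_inner_neq_0[OF nz[of w]] by eventually_elim blast
    qed
    then show "AE \<xi> in spectral_measure f. ennreal ((norm (m0 \<xi>))\<^sup>2) \<le> 4 * indicator (sep v w) \<xi>"
    proof eventually_elim
      case (elim \<xi>)
      have eq: "m0 \<xi> = - \<i> * of_real (sgn (\<xi> \<bullet> (v, 1)) - sgn (\<xi> \<bullet> (w, 1)))"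
        unfolding m0_def of_real_diff right_diff_distrib ..
      show ?case
      proof (cases "\<xi> \<in> sep v w")
        case True
        have "\<bar>sgn (\<xi> \<bullet> (v, 1)) - sgn (\<xi> \<bullet> (w, 1))\<bar> \<le> 2" by (simp only: sgn_if) auto
        then have "norm (m0 \<xi>) \<le> 2" unfolding eq norm_mult norm_of_real by simp
        then have "(norm (m0 \<xi>))\<^sup>2 \<le> 2\<^sup>2" by (intro power_mono) auto
        then have "ennreal ((norm (m0 \<xi>))\<^sup>2) \<le> ennreal 4" by (intro ennreal_leI) simp
        then show ?thesis using True by simp
      next
        case False
        then have "(0 < \<xi> \<bullet> (v, 1)) = (0 < \<xi> \<bullet> (w, 1))" by (simp only: sep_def mem_Collect_eq) simp
        then have "sgn (\<xi> \<bullet> (v, 1)) - sgn (\<xi> \<bullet> (w, 1)) = 0" using elim by (simp only: sgn_if)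
        then have "m0 \<xi> = 0" unfolding eq by (simp only:) simp
        then show ?thesis by simp
      qed
    qed
  qed
  also have "\<dots> = 4 * emeasure (spectral_measure f) (sep v w)"
    by (rule nn_integral_cmult_indicator) (simp add: sets_spectral_measure)
  finally show ?thesis .
qed

end

section \<open>From integrable to square-integrable functions\<close>

lemma integrable_cball_restrict:
  fixes f :: "'a::euclidean_space \<Rightarrow> complex"
  assumes [measurable]: "f \<in> borel_measurable borel"
    and f2: "L2_energy lborel f < \<infinity>"
  shows "integrable lborel (\<lambda>x. indicator (cball 0 R) x *\<^sub>R f x)"
proof -
  have "(\<integral>\<^sup>+x. ennreal (norm (indicator (cball 0 R) x *\<^sub>R f x)) \<partial>lborel)
      \<le> (\<integral>\<^sup>+x. ennreal ((norm (f x))\<^sup>2) + indicator (cball 0 R) x \<partial>lborel)"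
  proof (rule nn_integral_mono)
    fix x
    have "ennreal (norm (f x)) \<le> ennreal ((norm (f x))\<^sup>2 + 1)" by (intro ennreal_leI le_power2_add_1)
    also have "\<dots> = ennreal ((norm (f x))\<^sup>2) + 1" by (simp add: ennreal_plus)
    finally show "ennreal (norm (indicator (cball 0 R) x *\<^sub>R f x)) \<le> ennreal ((norm (f x))\<^sup>2) + indicator (cball 0 R) x"
      by (cases "x \<in> cball 0 R") simp_all
  qed
  also have "\<dots> = L2_energy lborel f + emeasure lborel (cball (0::'a) R)"
    by (subst nn_integral_add) (simp_all add: borel_measurable_indicator)
  also have "\<dots> < \<infinity>" using f2 emeasure_lborel_cball_finite[of "0::'a" R] by simp
  finally show ?thesis
    unfolding integrable_iff_bounded by (intro conjI borel_measurable_scaleR borel_measurable_indicator) simp_all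
qed

text \<open>A crude bound, uniform in \<open>v\<close>, which shows that cutting \<open>f\<close> to
  a large ball changes little. Two limits are taken in turn: the radius of the ball tends to
  infinity with \<open>n\<close> fixed, where the cut-off kernel permits domination on lines, and
  then \<open>n\<close> does.\<close>

lemma nn_integral_hilbert_limit_bounded:
  "\<exists>C>0. \<forall>(v::'a::euclidean_space) f. f \<in> borel_measurable borel \<longrightarrow> L2_energy lborel f < \<infinity> \<longrightarrow>
    L2_energy lborel (hilbert_limit v f) \<le> ennreal C * L2_energy lborel f"
proof -
  obtain C where C: "0 < C" "\<And>n s. norm (1 / of_real pi * pv_multiplier n s) \<le> C" using hilbert_multiplier_bounded by blast
  have "L2_energy lborel (hilbert_limit v f) \<le> ennreal (C\<^sup>2) * L2_energy lborel f"
    if f[measurable]: "f \<in> borel_measurable borel" and f2: "L2_energy lborel f < \<infinity>"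
    for v :: 'a and f
  proof -
    let ?B = "ennreal (C\<^sup>2) * L2_energy lborel f"
    define g where "g j x = indicator (cball 0 (real j)) x *\<^sub>R f x" for j x
    have gi: "integrable lborel (g j)" for j unfolding g_def by (rule integrable_cball_restrict[OF f f2])
    have g[measurable]: "g j \<in> borel_measurable borel" for j using borel_measurable_integrable[OF gi[of j]] by simp
    have gf: "norm (g j x) \<le> norm (f x)" for j x by (simp add: g_def indicator_def)
    have g2: "L2_energy lborel (g j) < \<infinity>" for j
      by (rule le_less_trans[OF _ f2]) (intro nn_integral_mono ennreal_leI power_mono gf norm_ge_zero)
    have gj: "L2_energy lborel (hilbert_approx n v (g j)) \<le> ?B" for n j
    proof -
      have "L2_energy lborel (hilbert_approx n v (g j))
          \<le> L2_energy (spectral_measure (g j)) (\<lambda>\<xi>. 1 / of_real pi * pv_multiplier n (\<xi> \<bullet> (v, 1)))"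
        by (rule nn_integral_norm_le_of_fourier[OF g integrable_hilbert_approx[OF gi g2]])
           (measurable, rule fourier_hilbert_approx[OF gi g2])
      also have "\<dots> \<le> (\<integral>\<^sup>+\<xi>. ennreal (C\<^sup>2) \<partial>spectral_measure (g j))"
        by (intro nn_integral_mono ennreal_leI power_mono C) simp
      also have "\<dots> = ennreal (C\<^sup>2) * emeasure (spectral_measure (g j)) UNIV" by (simp add: spectral_measure_def)
      also have "\<dots> \<le> ennreal (C\<^sup>2) * L2_energy lborel (g j)"
        by (intro mult_left_mono emeasure_spectral_measure_le gi) simp
      also have "\<dots> \<le> ?B"
        by (intro mult_left_mono nn_integral_mono ennreal_leI power_mono gf) auto
      finally show ?thesis .
    qed
    have fn: "L2_energy lborel (hilbert_approx n v f) \<le> ?B" for n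
    proof (rule nn_integral_norm_lim_le[OF _ _ gj tendsto_const])
      show "AE x in lborel. (\<lambda>j. hilbert_approx n v (g j) x) \<longlonglongrightarrow> hilbert_approx n v f x"
        using AE_line_L2[OF f f2, of v]
      proof eventually_elim
        case (elim x)
        have "(\<lambda>j. dir_pv n (v, 1) (g j) x) \<longlonglongrightarrow> dir_pv n (v, 1) f x"
          unfolding dir_pv_def
        proof (rule integral_dominated_convergence)
          show "integrable lborel (\<lambda>t. norm (pv_kernel n t * f (x - t *\<^sub>R (v, 1))))"
            by (intro integrable_norm pv_kernel_line_integrable[OF f elim])
          show "AE t in lborel. (\<lambda>j. pv_kernel n t * g j (x - t *\<^sub>R (v, 1))) \<longlonglongrightarrow> pv_kernel n t * f (x - t *\<^sub>R (v, 1))"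
          proof (intro AE_I2 tendsto_mult tendsto_const)
            fix t
            let ?y = "x - t *\<^sub>R (v, 1)"
            obtain m :: nat where m: "norm ?y < real m" using reals_Archimedean2 by blast
            have "\<forall>\<^sub>F j in sequentially. f ?y = g j ?y"
              using eventually_ge_at_top[of m]
            proof eventually_elim
              case (elim j)
              then have "?y \<in> cball 0 (real j)" using m by (simp only: mem_cball dist_0_norm)
              then show ?case by (simp only: g_def indicator_simps scaleR_one)
            qed
            then show "(\<lambda>j. g j ?y) \<longlonglongrightarrow> f ?y" by (rule Lim_transform_eventually[OF tendsto_const])
          qed
          show "AE t in lborel. norm (pv_kernel n t * g j (x - t *\<^sub>R (v, 1))) \<le> norm (pv_kernel n t * f (x - t *\<^sub>R (v, 1)))" for j
            unfolding norm_mult by (intro AE_I2 mult_left_mono gf norm_ge_zero)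
        qed measurable
        then show ?case unfolding hilbert_approx_def by (intro tendsto_mult tendsto_const)
      qed
    qed measurable
    show ?thesis
    proof (rule nn_integral_norm_lim_le[OF _ _ fn tendsto_const])
      show "AE x in lborel. (\<lambda>n. hilbert_approx n v f x) \<longlonglongrightarrow> hilbert_limit v f x"
        using AE_hilbert_limit[OF f f2, of v] by eventually_elim simp
    qed measurable
  qed
  then show ?thesis using C(1) by (intro exI[of _ "C\<^sup>2"]) auto
qed

text \<open>\<open>lim\<close> is additive where the sequences converge; at such points linearity is
  inherited from the truncations, whose integrals exist by \<open>line_L2\<close>.\<close>

lemma AE_hilbert_limit_diff:
  fixes f g :: "'a::euclidean_space \<times> real \<Rightarrow> complex"
  assumes f[measurable]: "f \<in> borel_measurable borel" and f2: "L2_energy lborel f < \<infinity>"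
    and g[measurable]: "g \<in> borel_measurable borel" and g2: "L2_energy lborel g < \<infinity>"
    and d2: "L2_energy lborel (\<lambda>x. f x - g x) < \<infinity>"
  shows "AE x in lborel. hilbert_limit v (\<lambda>x. f x - g x) x = hilbert_limit v f x - hilbert_limit v g x"
proof -
  have "(\<lambda>x. f x - g x) \<in> borel_measurable borel" by measurable
  from AE_hilbert_limit[OF f f2, of v] AE_hilbert_limit[OF g g2, of v] AE_hilbert_limit[OF this d2, of v]
  show ?thesis
  proof eventually_elim
    case (elim x)
    have "dir_pv n (v, 1) (\<lambda>x. f x - g x) x = dir_pv n (v, 1) f x - dir_pv n (v, 1) g x" for n
      using pv_kernel_line_integrable[OF f, of "(v, 1)" x n] pv_kernel_line_integrable[OF g, of "(v, 1)" x n] elim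
      unfolding dir_pv_def by (simp only: right_diff_distrib Bochner_Integration.integral_diff)
    then have "hilbert_approx n v (\<lambda>x. f x - g x) x = hilbert_approx n v f x - hilbert_approx n v g x" for n
      unfolding hilbert_approx_def by (simp only: right_diff_distrib)
    moreover have "(\<lambda>n. hilbert_approx n v f x - hilbert_approx n v g x) \<longlonglongrightarrow> hilbert_limit v f x - hilbert_limit v g x"
      using elim by (intro tendsto_diff) auto
    ultimately have "(\<lambda>n. hilbert_approx n v (\<lambda>x. f x - g x) x) \<longlonglongrightarrow> hilbert_limit v f x - hilbert_limit v g x"
      by (simp only:)
    then show ?case using elim(3) LIMSEQ_unique by blast
  qed
qed

section \<open>The maximal estimate\<close>

text \<open>Chaining applies to the restriction of \<open>f\<close> to a ball, which has a Fourier
  integral. The error of the restriction is summed over all of \<Omega>; its dependence on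
  \<open>card \<Omega>\<close> is harmless, as it vanishes in the limit with \<Omega> fixed.\<close>

theorem nn_integral_Max_hilbert_limit_le:
  assumes "0 < \<epsilon>"
  shows "\<exists>C>0. \<forall>(\<Omega> :: 'a::euclidean_space set) f. finite \<Omega> \<longrightarrow> \<Omega> \<noteq> {} \<longrightarrow> f \<in> borel_measurable borel \<longrightarrow>
    L2_energy lborel f < \<infinity> \<longrightarrow>
    (\<integral>\<^sup>+x. ennreal ((Max ((\<lambda>v. norm (hilbert_limit v f x)) ` \<Omega>))\<^sup>2) \<partial>lborel)
      \<le> ennreal ((C * card \<Omega> powr ((real DIM('a) - 1) / (2 * DIM('a)) + \<epsilon>))\<^sup>2) * L2_energy lborel f"
proof -
  obtain C where C: "0 < C" and chain0: "\<forall>(M :: ('a \<times> real) measure) (L :: ('a \<times> real) measure)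
      (h :: 'a \<Rightarrow> 'a \<times> real \<Rightarrow> complex) \<Omega>.
    finite_measure M \<longrightarrow> sets M = sets borel \<longrightarrow> (\<forall>v. h v \<in> borel_measurable L) \<longrightarrow>
    (\<forall>v. L2_energy L (h v) \<le> ennreal (4 * measure M UNIV)) \<longrightarrow>
    (\<forall>v w. L2_energy L (\<lambda>x. h v x - h w x) \<le> ennreal (4 * measure M (sep v w))) \<longrightarrow>
    finite \<Omega> \<longrightarrow> \<Omega> \<noteq> {} \<longrightarrow>
    (\<integral>\<^sup>+x. ennreal ((Max ((\<lambda>v. norm (h v x)) ` \<Omega>))\<^sup>2) \<partial>L)
      \<le> ennreal ((C * card \<Omega> powr ((real DIM('a) - 1) / (2 * DIM('a)) + \<epsilon>) * sqrt (measure M UNIV))\<^sup>2)"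
    using chaining_bound[OF assms, where 'a = 'a and 'b = "'a \<times> real"] by (elim exE conjE) (rule that)
  note chain = chain0[rule_format]
  obtain B where B: "0 < B" and hb0: "\<forall>(v :: 'a) f. f \<in> borel_measurable borel \<longrightarrow> L2_energy lborel f < \<infinity> \<longrightarrow>
    L2_energy lborel (hilbert_limit v f) \<le> ennreal B * L2_energy lborel f"
    using nn_integral_hilbert_limit_bounded[where 'a = 'a] by (elim exE conjE) (rule that)
  note hb = hb0[rule_format]
  have "(\<integral>\<^sup>+x. ennreal ((Max ((\<lambda>v. norm (hilbert_limit v f x)) ` \<Omega>))\<^sup>2) \<partial>lborel)
      \<le> ennreal ((C * card \<Omega> powr ((real DIM('a) - 1) / (2 * DIM('a)) + \<epsilon>))\<^sup>2) * L2_energy lborel f"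
    if fin: "finite \<Omega>" and ne: "\<Omega> \<noteq> {}" and f[measurable]: "f \<in> borel_measurable borel"
      and f2: "L2_energy lborel f < \<infinity>" for \<Omega> :: "'a set" and f
  proof -
    define K where "K = C * card \<Omega> powr ((real DIM('a) - 1) / (2 * DIM('a)) + \<epsilon>)"
    have K: "0 \<le> K" using C by (simp add: K_def)
    define I where "I = enn2real (L2_energy lborel f)"
    have I: "L2_energy lborel f = ennreal I" "0 \<le> I"
      using f2 by (auto simp: I_def less_top)
    define g where "g j x = indicator (cball 0 (real j)) x *\<^sub>R f x" for j x
    have gi: "integrable lborel (g j)" for j unfolding g_def by (rule integrable_cball_restrict[OF f f2])
    have g[measurable]: "g j \<in> borel_measurable borel" for j using borel_measurable_integrable[OF gi[of j]] by simp
    have gf: "norm (g j x) \<le> norm (f x)" "norm (f x - g j x) \<le> norm (f x)" for j x by (simp_all add: g_def indicator_def)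
    have g2le: "L2_energy lborel (g j) \<le> ennreal I"
      and d2le: "L2_energy lborel (\<lambda>x. f x - g j x) \<le> ennreal I" for j
      unfolding I(1)[symmetric] by (intro nn_integral_mono ennreal_leI power_mono gf norm_ge_zero)+
    have g2: "L2_energy lborel (g j) < \<infinity>"
      and d2: "L2_energy lborel (\<lambda>x. f x - g j x) < \<infinity>" for j
      using g2le[of j] d2le[of j] by (auto intro: le_less_trans)
    define r where "r j = enn2real (L2_energy lborel (\<lambda>x. f x - g j x))" for j
    have r: "L2_energy lborel (\<lambda>x. f x - g j x) = ennreal (r j)" "0 \<le> r j" for j
      using d2[of j] by (auto simp: r_def less_top)
    have "(\<lambda>j. \<integral>\<^sup>+x. ennreal ((norm (f x - g j x))\<^sup>2) \<partial>lborel) \<longlonglongrightarrow> (\<integral>\<^sup>+x. 0 \<partial>(lborel :: ('a \<times> real) measure))"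
    proof (rule nn_integral_dominated_convergence[where w = "\<lambda>x. ennreal ((norm (f x))\<^sup>2)"])
      show "AE x in lborel. ennreal ((norm (f x - g j x))\<^sup>2) \<le> ennreal ((norm (f x))\<^sup>2)" for j
        by (intro AE_I2 ennreal_leI power_mono gf) simp
      show "AE x in lborel. (\<lambda>j. ennreal ((norm (f x - g j x))\<^sup>2)) \<longlonglongrightarrow> 0"
      proof (rule AE_I2)
        fix x :: "'a \<times> real"
        obtain m :: nat where m: "norm x < real m" using reals_Archimedean2 by blast
        have "\<forall>\<^sub>F j in sequentially. 0 = ennreal ((norm (f x - g j x))\<^sup>2)"
          using eventually_ge_at_top[of m] by eventually_elim (use m in \<open>simp add: g_def\<close>)
        then show "(\<lambda>j. ennreal ((norm (f x - g j x))\<^sup>2)) \<longlonglongrightarrow> 0" by (rule Lim_transform_eventually[OF tendsto_const])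
      qed
    qed (use f2 in measurable)
    then have "(\<lambda>j. ennreal (r j)) \<longlonglongrightarrow> ennreal 0" by (simp add: r(1))
    then have r0: "r \<longlonglongrightarrow> 0" using r(2) by (subst (asm) tendsto_ennreal_iff) auto
    \<comment> \<open>Dominates the error for every \<open>v\<close> in \<Omega> at once; its energy
      is at most \<open>card \<Omega> * B * r j\<close>, which tends to 0.\<close>
    define D where "D j x = sqrt (\<Sum>v\<in>\<Omega>. (norm (hilbert_limit v f x - hilbert_limit v (g j) x))\<^sup>2)" for j x
    have D: "(\<integral>\<^sup>+x. ennreal ((D j x)\<^sup>2) \<partial>lborel) \<le> ennreal ((sqrt (card \<Omega> * B * r j))\<^sup>2)" for j
    proof -
      have "(\<integral>\<^sup>+x. ennreal ((D j x)\<^sup>2) \<partial>lborel)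
          = (\<integral>\<^sup>+x. (\<Sum>v\<in>\<Omega>. ennreal ((norm (hilbert_limit v f x - hilbert_limit v (g j) x))\<^sup>2)) \<partial>lborel)"
        unfolding D_def by (intro nn_integral_cong) (simp add: sum_nonneg)
      also have "\<dots> = (\<Sum>v\<in>\<Omega>. \<integral>\<^sup>+x. ennreal ((norm (hilbert_limit v f x - hilbert_limit v (g j) x))\<^sup>2) \<partial>lborel)"
        by (rule nn_integral_sum) measurable
      also have "\<dots> \<le> (\<Sum>v\<in>\<Omega>. ennreal (B * r j))"
      proof (rule sum_mono)
        fix v
        have "L2_energy lborel (\<lambda>x. hilbert_limit v f x - hilbert_limit v (g j) x)
            = L2_energy lborel (\<lambda>x. hilbert_limit v (\<lambda>x. f x - g j x) x)"
          by (rule nn_integral_cong_AE)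
             (use AE_hilbert_limit_diff[OF f f2 g g2 d2, of v j] in \<open>eventually_elim, simp\<close>)
        also have "\<dots> \<le> ennreal B * L2_energy lborel (\<lambda>x. f x - g j x)"
          by (rule hb[OF _ d2]) measurable
        also have "\<dots> = ennreal (B * r j)" using B by (simp add: r ennreal_mult')
        finally show "L2_energy lborel (\<lambda>x. hilbert_limit v f x - hilbert_limit v (g j) x) \<le> ennreal (B * r j)" .
      qed
      also have "\<dots> = ennreal ((sqrt (card \<Omega> * B * r j))\<^sup>2)"
        using B r(2)[of j] by (simp add: ennreal_mult' ennreal_of_nat_eq_real_of_nat mult.assoc)
      finally show ?thesis .
    qed
    have G: "(\<integral>\<^sup>+x. ennreal ((Max ((\<lambda>v. norm (hilbert_limit v (g j) x)) ` \<Omega>))\<^sup>2) \<partial>lborel) \<le> ennreal ((K * sqrt I)\<^sup>2)" for j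
    proof -
      let ?M = "spectral_measure (g j)"
      interpret finite_measure ?M by (rule finite_spectral_measure[OF gi g2])
      have M: "4 * emeasure ?M S = ennreal (4 * measure ?M S)" for S
        by (simp add: emeasure_eq_measure ennreal_mult')
      have "measure ?M UNIV \<le> I"
        using order.trans[OF emeasure_spectral_measure_le[OF gi] g2le, of j] I(2) by (simp add: emeasure_eq_measure)
      have "(\<integral>\<^sup>+x. ennreal ((Max ((\<lambda>v. norm (hilbert_limit v (g j) x)) ` \<Omega>))\<^sup>2) \<partial>lborel)
          \<le> ennreal ((K * sqrt (measure ?M UNIV))\<^sup>2)"
        unfolding K_def
      proof (rule chain[OF _ _ _ _ _ fin ne])
        show "finite_measure ?M" by (rule finite_spectral_measure[OF gi g2])
        show "sets ?M = sets borel" by (rule sets_spectral_measure)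
        show "L2_energy lborel (hilbert_limit v (g j)) \<le> ennreal (4 * measure ?M UNIV)" for v
        proof -
          have "L2_energy lborel (hilbert_limit v (g j)) \<le> ennreal (measure ?M UNIV)"
            using nn_integral_hilbert_limit_le[OF gi[of j] g2[of j], of v] unfolding emeasure_eq_measure .
          also have "\<dots> \<le> ennreal (4 * measure ?M UNIV)" by (intro ennreal_leI) simp
          finally show ?thesis .
        qed
        show "L2_energy lborel (\<lambda>x. hilbert_limit v (g j) x - hilbert_limit w (g j) x)
            \<le> ennreal (4 * measure ?M (sep v w))" for v w
          unfolding M[symmetric] by (rule nn_integral_hilbert_limit_diff_le[OF gi g2])
      qed measurable
      also have "\<dots> \<le> ennreal ((K * sqrt I)\<^sup>2)"
        using K \<open>measure ?M UNIV \<le> I\<close> by (intro ennreal_leI power_mono mult_left_mono) auto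
      finally show ?thesis .
    qed
    have le: "(\<integral>\<^sup>+x. ennreal ((Max ((\<lambda>v. norm (hilbert_limit v f x)) ` \<Omega>))\<^sup>2) \<partial>lborel)
        \<le> ennreal ((K * sqrt I + sqrt (card \<Omega> * B * r j))\<^sup>2)" for j
    proof -
      have Mm[measurable]: "(\<lambda>x. Max ((\<lambda>v. norm (hilbert_limit v (g j) x)) ` \<Omega>)) \<in> borel_measurable lborel"
        using fin ne by (intro borel_measurable_Max) auto
      have "Max ((\<lambda>v. norm (hilbert_limit v f x)) ` \<Omega>) \<le> Max ((\<lambda>v. norm (hilbert_limit v (g j) x)) ` \<Omega>) + D j x" for x
      proof (rule Max.boundedI)
        fix a assume "a \<in> (\<lambda>v. norm (hilbert_limit v f x)) ` \<Omega>"
        then obtain v where v: "v \<in> \<Omega>" "a = norm (hilbert_limit v f x)" by blast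
        have "norm (hilbert_limit v (g j) x) \<le> Max ((\<lambda>v. norm (hilbert_limit v (g j) x)) ` \<Omega>)"
          using fin v(1) by simp
        moreover have "(norm (hilbert_limit v f x - hilbert_limit v (g j) x))\<^sup>2 \<le>
            (\<Sum>v\<in>\<Omega>. (norm (hilbert_limit v f x - hilbert_limit v (g j) x))\<^sup>2)"
          by (rule member_le_sum[OF v(1) _ fin]) simp
        then have "norm (hilbert_limit v f x - hilbert_limit v (g j) x) \<le> D j x"
          unfolding D_def by (rule real_le_rsqrt)
        ultimately show "a \<le> Max ((\<lambda>v. norm (hilbert_limit v (g j) x)) ` \<Omega>) + D j x"
          using norm_triangle_sub[of "hilbert_limit v f x" "hilbert_limit v (g j) x"] v(2) by linarith
      qed (use fin ne in auto)
      moreover have "0 \<le> Max ((\<lambda>v. norm (hilbert_limit v f x)) ` \<Omega>)" for x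
        using fin ne by (auto simp: Max_ge_iff)
      ultimately have "(\<integral>\<^sup>+x. ennreal ((Max ((\<lambda>v. norm (hilbert_limit v f x)) ` \<Omega>))\<^sup>2) \<partial>lborel)
          \<le> (\<integral>\<^sup>+x. ennreal ((Max ((\<lambda>v. norm (hilbert_limit v (g j) x)) ` \<Omega>) + D j x)\<^sup>2) \<partial>lborel)"
        by (intro nn_integral_mono ennreal_leI power_mono)
      also have "\<dots> \<le> ennreal ((K * sqrt I + sqrt (card \<Omega> * B * r j))\<^sup>2)"
      proof (rule nn_integral_power2_add_le[OF Mm _ G D])
        show "D j \<in> borel_measurable lborel" unfolding D_def by measurable
        show "0 \<le> K * sqrt I" "0 \<le> sqrt (card \<Omega> * B * r j)" using K I(2) B r(2)[of j] by auto
      qed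
      finally show ?thesis .
    qed
    have "(\<lambda>j. ennreal ((K * sqrt I + sqrt (card \<Omega> * B * r j))\<^sup>2)) \<longlonglongrightarrow> ennreal ((K * sqrt I + sqrt (card \<Omega> * B * 0))\<^sup>2)"
      by (intro tendsto_ennrealI tendsto_intros r0)
    from LIMSEQ_le_const[OF this] le
    have "(\<integral>\<^sup>+x. ennreal ((Max ((\<lambda>v. norm (hilbert_limit v f x)) ` \<Omega>))\<^sup>2) \<partial>lborel)
        \<le> ennreal ((K * sqrt I + sqrt (card \<Omega> * B * 0))\<^sup>2)" by blast
    also have "\<dots> = ennreal (K\<^sup>2) * ennreal I" using I(2) by (simp add: power_mult_distrib ennreal_mult')
    finally show ?thesis unfolding K_def I(1) .
  qed
  then show ?thesis using C by (intro exI[of _ C]) blast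
qed

section \<open>Lebesgue measurable functions and the principal value\<close>

lemma lebesgue_ex_borel_representative:
  fixes f :: "'a::euclidean_space \<Rightarrow> complex"
  assumes "f \<in> borel_measurable lebesgue"
  shows "\<exists>g\<in>borel_measurable borel. AE x in lborel. f x = g x"
proof -
  have "(\<lambda>x. Re (f x)) \<in> borel_measurable lebesgue" "(\<lambda>x. Im (f x)) \<in> borel_measurable lebesgue"
    using assms by measurable
  then obtain a b where [measurable]: "a \<in> borel_measurable lborel" "b \<in> borel_measurable lborel"
    and ab: "AE x in lborel. Re (f x) = a x" "AE x in lborel. Im (f x) = b x"
    using completion_ex_borel_measurable_real by metis
  have "(\<lambda>x. of_real (a x) + \<i> * of_real (b x)) \<in> borel_measurable borel" by measurable
  moreover have "AE x in lborel. f x = of_real (a x) + \<i> * of_real (b x)"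
    using ab by eventually_elim (simp add: complex_eq_iff)
  ultimately show ?thesis by (intro bexI[where x = "\<lambda>x. of_real (a x) + \<i> * of_real (b x)"])
qed

text \<open>For each \<open>t\<close> a translate of a null set is null, and Fubini's theorem
  exchanges the roles of \<open>x\<close> and \<open>t\<close>. Hence altering a function on a null
  set leaves its truncations unchanged at almost every point.\<close>

lemma AE_AE_line:
  fixes w :: "'a::euclidean_space"
  assumes "AE y in lborel. P y"
  shows "AE x in lborel. AE t in lborel. P (x - t *\<^sub>R w)"
proof -
  obtain N where N: "N \<in> null_sets lborel" "{y. \<not> P y} \<subseteq> N"
    using assms by (auto simp: eventually_ae_filter)
  then have [measurable]: "N \<in> sets borel" by (auto simp: null_sets_def)
  have "AE x in lborel. x - t *\<^sub>R w \<notin> N" for t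
  proof -
    have "(\<integral>\<^sup>+x. indicator N (x + - (t *\<^sub>R w)) \<partial>lborel) = (\<integral>\<^sup>+x. indicator N x \<partial>lborel)"
      by (rule nn_integral_lborel_translate) measurable
    also have "\<dots> = 0" using N(1) by (simp add: null_sets_def)
    finally have "AE x in lborel. (indicator N (x + - (t *\<^sub>R w)) :: ennreal) = 0"
      by (subst (asm) nn_integral_0_iff_AE) auto
    then show ?thesis by eventually_elim (simp add: indicator_eq_0_iff)
  qed
  then have "AE t in lborel. AE x in lborel. x - t *\<^sub>R w \<notin> N" by simp
  moreover have "{p \<in> space (lborel \<Otimes>\<^sub>M lborel). fst p - snd p *\<^sub>R w \<notin> N} \<in> sets (lborel \<Otimes>\<^sub>M lborel)"
    by measurable
  ultimately have "AE x in lborel. AE t in lborel. x - t *\<^sub>R w \<notin> N"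
    by (subst lborel_pair.AE_commute)
  then show ?thesis by eventually_elim (use N(2) in \<open>auto elim!: eventually_mono\<close>)
qed

text \<open>\<open>f\<close> need not be Borel measurable along the line; agreement almost
  everywhere with \<open>g\<close> and the completeness of Lebesgue measure supply
  measurability.\<close>

lemma truncated_dir_hilbert_eq_dir_trunc:
  fixes f g :: "(real ^ 'n) \<times> real \<Rightarrow> complex"
  assumes g[measurable]: "g \<in> borel_measurable borel"
    and eq: "AE t in lborel. f (x - t *\<^sub>R (v, 1)) = g (x - t *\<^sub>R (v, 1))"
  shows "truncated_dir_hilbert \<delta> v f x = 1 / of_real pi * dir_trunc \<delta> (v, 1) g x"
proof -
  let ?F = "\<lambda>t. indicator {t. \<delta> < \<bar>t\<bar>} t *\<^sub>R (f (x - t *\<^sub>R (v, 1)) / of_real t)"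
  let ?G = "\<lambda>t. indicator {t. \<delta> < \<bar>t\<bar>} t *\<^sub>R (g (x - t *\<^sub>R (v, 1)) / of_real t)"
  have Gb: "?G \<in> borel_measurable lborel" by measurable
  have FG: "AE t in lebesgue. ?F t = ?G t"
    using AE_completion[OF eq] by eventually_elim (simp only:)
  have Gl: "?G \<in> borel_measurable lebesgue" by (rule measurable_completion[OF Gb])
  have "AE t in lebesgue. ?G t = ?F t" using FG by eventually_elim (rule sym)
  from borel_measurable_AE[OF Gl this] have Fl: "?F \<in> borel_measurable lebesgue" .
  have "(\<integral>t. ?F t \<partial>lebesgue) = (\<integral>t. ?G t \<partial>lebesgue)" by (rule integral_cong_AE[OF Fl Gl FG])
  also have "\<dots> = (\<integral>t. ?G t \<partial>lborel)" by (rule integral_completion[OF Gb])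
  finally show ?thesis unfolding truncated_dir_hilbert_def set_lebesgue_integral_def dir_trunc_eq by (simp only:)
qed

lemma AE_dir_hilbert_eq:
  fixes f g :: "(real ^ 'n) \<times> real \<Rightarrow> complex"
  assumes g: "g \<in> borel_measurable borel"
    and g2: "L2_energy lborel g < \<infinity>"
    and eq: "AE x in lborel. f x = g x"
  shows "AE x in lborel. dir_hilbert v f x = hilbert_limit v g x"
  using AE_AE_line[OF eq, of "(v, 1)"] AE_hilbert_limit[OF g g2, of v]
proof eventually_elim
  case (elim x)
  have "((\<lambda>\<delta>. truncated_dir_hilbert \<delta> v f x) \<longlongrightarrow> hilbert_limit v g x) (at_right 0)"
    unfolding truncated_dir_hilbert_eq_dir_trunc[OF g elim(1)] using elim(2) by blast
  then show ?case unfolding dir_hilbert_def by (rule tendsto_Lim[OF trivial_limit_at_right_real])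
qed

text \<open>Membership in \<open>L2\<close> belongs to the claim: the integral in
  \<open>L2_norm\<close> has the default value 0 when it does not exist, and the norm inequality
  alone would then say nothing.\<close>

theorem theorem1p1:
  assumes "CARD('n::finite) \<ge> 2"
  shows "\<forall>\<epsilon>>0. \<exists>C>0. \<forall>N\<ge>1. \<forall>\<Omega> :: (real ^ 'n) set. \<forall>f :: (real ^ 'n) \<times> real \<Rightarrow> complex.
    finite \<Omega> \<and> card \<Omega> = N \<and> f \<in> L2 \<longrightarrow>
      max_dir_hilbert \<Omega> f \<in> L2 \<and>
      L2_norm (max_dir_hilbert \<Omega> f)
        \<le> C * real N powr ((real CARD('n) - 1) / (2 * real CARD('n)) + \<epsilon>) * L2_norm f"
proof (intro allI impI)
  fix \<epsilon> :: real assume "0 < \<epsilon>"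
  obtain C where C: "0 < C" and bound0: "\<forall>(\<Omega> :: (real ^ 'n) set) f. finite \<Omega> \<longrightarrow> \<Omega> \<noteq> {} \<longrightarrow> f \<in> borel_measurable borel \<longrightarrow>
    L2_energy lborel f < \<infinity> \<longrightarrow>
    (\<integral>\<^sup>+x. ennreal ((Max ((\<lambda>v. norm (hilbert_limit v f x)) ` \<Omega>))\<^sup>2) \<partial>lborel)
      \<le> ennreal ((C * card \<Omega> powr ((real DIM(real ^ 'n) - 1) / (2 * DIM(real ^ 'n)) + \<epsilon>))\<^sup>2) *
        L2_energy lborel f"
    using nn_integral_Max_hilbert_limit_le[OF \<open>0 < \<epsilon>\<close>, where 'a = "real ^ 'n"] by (elim exE conjE) (rule that)
  have dim: "DIM(real ^ 'n) = CARD('n)" by simp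
  note bound = bound0[rule_format, unfolded dim]
  have main: "max_dir_hilbert \<Omega> f \<in> L2 \<and>
      L2_norm (max_dir_hilbert \<Omega> f)
        \<le> C * real (card \<Omega>) powr ((real CARD('n) - 1) / (2 * real CARD('n)) + \<epsilon>) * L2_norm f"
    if fin: "finite \<Omega>" and ne: "\<Omega> \<noteq> {}" and f: "f \<in> L2" for \<Omega> :: "(real ^ 'n) set" and f :: "(real ^ 'n) \<times> real \<Rightarrow> complex"
  proof -
    define K where "K = C * real (card \<Omega>) powr ((real CARD('n) - 1) / (2 * real CARD('n)) + \<epsilon>)"
    have K: "0 \<le> K" using C by (simp add: K_def)
    have fm: "f \<in> borel_measurable lebesgue" and fi: "integrable lebesgue (\<lambda>x. (norm (f x))\<^sup>2)"
      using f by (auto simp: L2_def)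
    \<comment> \<open>The Fourier and line arguments concern Borel functions, so \<open>f\<close>
      enters through a Borel representative; energies and, almost everywhere, principal values are
      the same.\<close>
    obtain g where g[measurable]: "g \<in> borel_measurable borel" and fg: "AE x in lborel. f x = g x"
      using lebesgue_ex_borel_representative[OF fm] by blast
    have f_eq: "L2_energy lebesgue f = ennreal ((L2_norm f)\<^sup>2)"
      by (simp add: nn_integral_eq_integral[OF fi] L2_norm_def)
    have "L2_energy lborel g = L2_energy lborel f"
      by (rule nn_integral_cong_AE) (use fg in \<open>eventually_elim, simp\<close>)
    then have g_eq: "L2_energy lborel g = ennreal ((L2_norm f)\<^sup>2)"
      unfolding f_eq[symmetric] nn_integral_completion .
    then have g2: "L2_energy lborel g < \<infinity>" by simp
    let ?m = "\<lambda>x. Max ((\<lambda>v. norm (hilbert_limit v g x)) ` \<Omega>)"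
    have m[measurable]: "?m \<in> borel_measurable lborel" using fin ne by (intro borel_measurable_Max) auto
    have "AE x in lborel. \<forall>v\<in>\<Omega>. dir_hilbert v f x = hilbert_limit v g x"
      by (intro AE_finite_allI fin AE_dir_hilbert_eq g g2 fg)
    then have m_eq: "AE x in lborel. ?m x = max_dir_hilbert \<Omega> f x"
    proof eventually_elim
      case (elim x)
      then have "(\<lambda>v. norm (hilbert_limit v g x)) ` \<Omega> = (\<lambda>v. norm (dir_hilbert v f x)) ` \<Omega>" by simp
      then show ?case unfolding max_dir_hilbert_def using fin ne by (simp add: cSup_eq_Max)
    qed
    have mh: "max_dir_hilbert \<Omega> f \<in> borel_measurable lebesgue"
      by (rule borel_measurable_AE[OF measurable_completion[OF m] AE_completion[OF m_eq]])
    have "L2_energy lebesgue (max_dir_hilbert \<Omega> f) = (\<integral>\<^sup>+x. ennreal ((?m x)\<^sup>2) \<partial>lborel)"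
      unfolding nn_integral_completion by (rule nn_integral_cong_AE) (use m_eq in \<open>eventually_elim, simp\<close>)
    also have "\<dots> \<le> ennreal (K\<^sup>2) * ennreal ((L2_norm f)\<^sup>2)"
      using bound[OF fin ne g g2] unfolding K_def g_eq by simp
    also have "\<dots> = ennreal ((K * L2_norm f)\<^sup>2)" by (simp add: power_mult_distrib ennreal_mult')
    finally have le: "L2_energy lebesgue (max_dir_hilbert \<Omega> f) \<le> ennreal ((K * L2_norm f)\<^sup>2)" .
    have mi: "integrable lebesgue (\<lambda>x. (norm (max_dir_hilbert \<Omega> f x))\<^sup>2)"
    proof (rule integrableI_bounded)
      show "(\<lambda>x. (norm (max_dir_hilbert \<Omega> f x))\<^sup>2) \<in> borel_measurable lebesgue" using mh by measurable
      show "(\<integral>\<^sup>+x. ennreal (norm ((norm (max_dir_hilbert \<Omega> f x))\<^sup>2)) \<partial>lebesgue) < \<infinity>"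
        using le_less_trans[OF le ennreal_less_top] by simp
    qed
    have "L2_energy lebesgue (max_dir_hilbert \<Omega> f) = ennreal ((L2_norm (max_dir_hilbert \<Omega> f))\<^sup>2)"
      unfolding nn_integral_eq_integral[OF mi AE_I2[OF zero_le_power2]] by (simp add: L2_norm_def)
    then have "(L2_norm (max_dir_hilbert \<Omega> f))\<^sup>2 \<le> (K * L2_norm f)\<^sup>2" using le by simp
    then have "L2_norm (max_dir_hilbert \<Omega> f) \<le> K * L2_norm f"
      by (rule power2_le_imp_le) (use K in \<open>simp add: L2_norm_def\<close>)
    then show ?thesis using mh mi unfolding K_def L2_def by simp
  qed
  show "\<exists>C>0. \<forall>N\<ge>1. \<forall>\<Omega> :: (real ^ 'n) set. \<forall>f :: (real ^ 'n) \<times> real \<Rightarrow> complex.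
    finite \<Omega> \<and> card \<Omega> = N \<and> f \<in> L2 \<longrightarrow>
      max_dir_hilbert \<Omega> f \<in> L2 \<and>
      L2_norm (max_dir_hilbert \<Omega> f)
        \<le> C * real N powr ((real CARD('n) - 1) / (2 * real CARD('n)) + \<epsilon>) * L2_norm f"
  proof (intro exI conjI allI impI)
    show "0 < C" by (rule C)
    fix N :: nat and \<Omega> :: "(real ^ 'n) set" and f :: "(real ^ 'n) \<times> real \<Rightarrow> complex"
    assume "1 \<le> N" and *: "finite \<Omega> \<and> card \<Omega> = N \<and> f \<in> L2"
    \<comment> \<open>\<open>1 \<le> N\<close> makes the supremum range over a nonempty set, where
      it is a maximum.\<close>
    then have "\<Omega> \<noteq> {}" by auto
    with * main show "max_dir_hilbert \<Omega> f \<in> L2"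
      "L2_norm (max_dir_hilbert \<Omega> f)
        \<le> C * real N powr ((real CARD('n) - 1) / (2 * real CARD('n)) + \<epsilon>) * L2_norm f" by blast+
  qed
qed

end
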